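(* Let $f$ and $c_i$ ($i\in\mathcal{E}\cup\mathcal{I}$) be polynomials in $\mathbb{R}[x]$, $x=(x_1,\dots,x_n)$, where $\mathcal{E},\mathcal{I}$ are disjoint finite index sets, and consider the problem $$f_{\min}:=\min f(x)\quad\text{s.t. } c_i(x)=0\ (i\in\mathcal{E}),\ c_j(x)\ge 0\ (j\in\mathcal{I}).$$ Let $\mathcal{K}$, $\mathcal{K}_c$ be the sets of critical pairs and critical points (defined in the context). Suppose $\mathcal{K}_c\neq\emptyset$ and that Assumption A holds with polynomials $p_i$, and let $\phi,\psi$, $f_c$, $f_k$, $f_k'$ be as defined in the context. If (i) $\mathrm{IQ}(c_{eq},c_{in})+\mathrm{IQ}(\phi,\psi)$ is archimedean, or (ii) $\mathrm{IQ}(c_{eq},c_{in})$ is archimedean, or (iii) Assumption B holds, then $f_k=f_k'=f_c$ for all $k$ sufficiently large. Consequently, if the minimum value $f_{\min}$ is achieved at a critical point (i.e., at a feasible point $u\in\mathcal{K}_c$), then $f_k=f_k'=f_{\min}$ for all $k$ sufficiently large provided one of (i)–(iii) holds.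
   Context: Notation: $\mathbb{R}[x]_d$ is the space of real polynomials of degree $\le d$; $\Sigma[x]$ is the cone of sums of squares of polynomials and $\Sigma[x]_d=\Sigma[x]\cap\mathbb{R}[x]_d$. Write $c_{eq}=(c_i)_{i\in\mathcal{E}}$, $c_{in}=(c_j)_{j\in\mathcal{I}}$. Critical pairs: $\mathcal{K}=\{(x,\lambda)\in\mathbb{R}^n\times\mathbb{R}^{\mathcal{E}\cup\mathcal{I}} : c_i(x)=0\ (i\in\mathcal{E}),\ \lambda_jc_j(x)=0\ (j\in\mathcal{I}),\ \nabla f(x)=\sum_{i\in\mathcal{E}\cup\mathcal{I}}\lambda_i\nabla c_i(x)\}$, and $\mathcal{K}_c=\{u:\exists\lambda,\ (u,\lambda)\in\mathcal{K}\}$ (the real critical points). Assumption A: for each $i\in\mathcal{E}\cup\mathcal{I}$ there is a polynomial $p_i\in\mathbb{R}[x]$ such that $\lambda_i=p_i(x)$ for all $(x,\lambda)\in\mathcal{K}$. Given such $p_i$, define the polynomial tuples $\phi=\big(\nabla f-\sum_{i\in\mathcal{E}\cup\mathcal{I}}p_i\nabla c_i,\ (p_jc_j)_{j\in\mathcal{I}}\big)$ (the $n$ entries of the vector followed by the products $p_jc_j$) and $\psi=(p_j)_{j\in\mathcal{I}}$. Let $f_c$ be the optimal value of $\min f(x)$ s.t. $c_{eq}(x)=0,\ c_{in}(x)\ge0,\ \phi(x)=0,\ \psi(x)\ge0$, with $f_c=+\infty$ if this problem is infeasible. For tuples $h=(h_1,\dots,h_s)$, $g=(g_1,\dots,g_t)$: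 $\mathrm{Ideal}(h)=\sum h_i\mathbb{R}[x]$, $\mathrm{Ideal}(h)_{2k}=\sum h_i\mathbb{R}[x]_{2k-\deg h_i}$; $\mathrm{Qmod}(g)=\Sigma[x]+\sum g_i\Sigma[x]$, $\mathrm{Qmod}(g)_{2k}=\Sigma[x]_{2k}+\sum g_i\Sigma[x]_{2k-\deg g_i}$; $\mathrm{IQ}(h,g)=\mathrm{Ideal}(h)+\mathrm{Qmod}(g)$ and $\mathrm{IQ}(h,g)_{2k}=\mathrm{Ideal}(h)_{2k}+\mathrm{Qmod}(g)_{2k}$. A set $\mathrm{IQ}(h,g)$ (or a sum of such sets) is archimedean if it contains a polynomial $p$ such that $\{x\in\mathbb{R}^n:p(x)\ge0\}$ is compact. Assumption B: there exists $\rho\in\mathrm{Qmod}(c_{in},\psi)$ such that for every $u\in\mathcal{K}_c$ with $f(u)<f_c$ one has $\rho(u)<0$. Moment relaxations: for $y=(y_\alpha)_{\alpha\in\mathbb{N}^n_{2k}}$ (indexed by exponents with $|\alpha|\le 2k$), let $\langle\sum f_\alpha x^\alpha,y\rangle=\sum f_\alpha y_\alpha$. For $q\in\mathbb{R}[x]_{2k}$ the localizing matrix $L_q^{(k)}(y)$ is the symmetric matrix with $\mathrm{vec}(a_1)^TL_q^{(k)}(y)\mathrm{vec}(a_2)=\langle qa_1a_2,y\rangle$ for all $a_1,a_2\in\mathbb{R}[x]_{k-\lceil\deg(q)/2\rceil}$ (vec = coefficient vector); $M_k(y)=L_1^{(k)}(y)$; for a tuple $q$, $L_q^{(k)}(y)$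 is the block diagonal matrix of the $L_{q_i}^{(k)}(y)$. Define $f_k'=\min\langle f,y\rangle$ s.t. $\langle1,y\rangle=1$, $M_k(y)\succeq0$, $L_{c_{eq}}^{(k)}(y)=0$, $L_{c_{in}}^{(k)}(y)\succeq0$, $L_\phi^{(k)}(y)=0$, $L_\psi^{(k)}(y)\succeq0$, $y\in\mathbb{R}^{\mathbb{N}^n_{2k}}$; and $f_k=\max\gamma$ s.t. $f-\gamma\in\mathrm{IQ}(c_{eq},c_{in})_{2k}+\mathrm{IQ}(\phi,\psi)_{2k}$. *)

theory Defs
  imports "HOL-Analysis.Analysis" "HOL-Library.Poly_Mapping"
begin

text \<open>Real multivariate polynomials in the variables indexed by the finite type 'v
  (so n = CARD('v)), represented by their coefficients: a polynomial is a finitely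
  supported map from exponent vectors (monomials) to real coefficients.
  Points of R^n are vectors of type real^'v.\<close>

type_synonym 'v mpoly = "('v \<Rightarrow>\<^sub>0 nat) \<Rightarrow>\<^sub>0 real"

definition mdeg_mono :: "('v::finite \<Rightarrow>\<^sub>0 nat) \<Rightarrow> nat" where
  "mdeg_mono a = (\<Sum>v\<in>UNIV. Poly_Mapping.lookup a v)"

text \<open>Total degree (the zero polynomial gets degree 0; it lies in every R[x]_d with d \<ge> 0).\<close>
definition mdeg :: "'v::finite mpoly \<Rightarrow> nat" where
  "mdeg p = Max (insert 0 (mdeg_mono ` Poly_Mapping.keys p))"

definition mconst :: "real \<Rightarrow> 'v::finite mpoly" where
  "mconst c = Poly_Mapping.single 0 c"

definition meval :: "'v::finite mpoly \<Rightarrow> real^'v \<Rightarrow> real" where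
  "meval p x = (\<Sum>a\<in>Poly_Mapping.keys p. Poly_Mapping.lookup p a * (\<Prod>v\<in>UNIV. (x $ v) ^ Poly_Mapping.lookup a v))"

definition mpderiv :: "'v::finite \<Rightarrow> 'v mpoly \<Rightarrow> 'v mpoly" where
  "mpderiv v p = (\<Sum>a\<in>Poly_Mapping.keys p.
     Poly_Mapping.single (a - Poly_Mapping.single v 1) (Poly_Mapping.lookup p a * real (Poly_Mapping.lookup a v)))"

definition poly_space :: "int \<Rightarrow> 'v::finite mpoly set" where
  "poly_space d = {p. p = 0 \<or> int (mdeg p) \<le> d}"

definition SOS :: "'v::finite mpoly set" where
  "SOS = {p. \<exists>qs. p = sum_list (map (\<lambda>q. q * q) qs)}"

definition SOS_trunc :: "int \<Rightarrow> 'v::finite mpoly set" where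
  "SOS_trunc d = SOS \<inter> poly_space d"

text \<open>Tuples of polynomials are represented by finite sets of polynomials
  (Ideal and Qmod, and their truncations, depend only on the set of entries).\<close>

definition Ideal :: "'v::finite mpoly set \<Rightarrow> 'v mpoly set" where
  "Ideal H = {q. \<exists>a. q = (\<Sum>h\<in>H. h * a h)}"

definition Ideal_trunc :: "'v::finite mpoly set \<Rightarrow> nat \<Rightarrow> 'v mpoly set" where
  "Ideal_trunc H d = {q. \<exists>a. (\<forall>h\<in>H. a h \<in> poly_space (int d - int (mdeg h)))
      \<and> q = (\<Sum>h\<in>H. h * a h)}"

definition Qmod :: "'v::finite mpoly set \<Rightarrow> 'v mpoly set" where
  "Qmod G = {q. \<exists>s0 s. s0 \<in> SOS \<and> (\<forall>g\<in>G. s g \<in> SOS) \<and> q = s0 + (\<Sum>g\<in>G. g * s g)}"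

definition Qmod_trunc :: "'v::finite mpoly set \<Rightarrow> nat \<Rightarrow> 'v mpoly set" where
  "Qmod_trunc G d = {q. \<exists>s0 s. s0 \<in> SOS_trunc (int d)
      \<and> (\<forall>g\<in>G. s g \<in> SOS_trunc (int d - int (mdeg g))) \<and> q = s0 + (\<Sum>g\<in>G. g * s g)}"

definition IQ :: "'v::finite mpoly set \<Rightarrow> 'v mpoly set \<Rightarrow> 'v mpoly set" where
  "IQ H G = {a + b | a b. a \<in> Ideal H \<and> b \<in> Qmod G}"

definition IQ_trunc :: "'v::finite mpoly set \<Rightarrow> 'v mpoly set \<Rightarrow> nat \<Rightarrow> 'v mpoly set" where
  "IQ_trunc H G d = {a + b | a b. a \<in> Ideal_trunc H d \<and> b \<in> Qmod_trunc G d}"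

definition set_plus_mp :: "'v::finite mpoly set \<Rightarrow> 'v mpoly set \<Rightarrow> 'v mpoly set" where
  "set_plus_mp A B = {a + b | a b. a \<in> A \<and> b \<in> B}"

definition archimedean :: "'v::finite mpoly set \<Rightarrow> bool" where
  "archimedean S \<longleftrightarrow> (\<exists>p\<in>S. compact {x. meval p x \<ge> 0})"

text \<open>Moment vectors y indexed by monomials; a y \<in> R^{N^n_{2k}} is represented as a
  function vanishing on monomials of degree > 2k.\<close>
definition mpair :: "'v::finite mpoly \<Rightarrow> (('v \<Rightarrow>\<^sub>0 nat) \<Rightarrow> real) \<Rightarrow> real" where
  "mpair p y = (\<Sum>a\<in>Poly_Mapping.keys p. Poly_Mapping.lookup p a * y a)"

text \<open>L_q^{(k)}(y) is the symmetric matrix of the bilinear form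
  (a1,a2) \<mapsto> <q a1 a2, y> on R[x]_{k - ceil(deg q / 2)}; these predicates say it is
  positive semidefinite, resp. zero.\<close>
definition loc_psd :: "nat \<Rightarrow> 'v::finite mpoly \<Rightarrow> (('v \<Rightarrow>\<^sub>0 nat) \<Rightarrow> real) \<Rightarrow> bool" where
  "loc_psd k q y \<longleftrightarrow> (\<forall>a\<in>poly_space (int k - int ((mdeg q + 1) div 2)). mpair (q * a * a) y \<ge> 0)"

definition loc_zero :: "nat \<Rightarrow> 'v::finite mpoly \<Rightarrow> (('v \<Rightarrow>\<^sub>0 nat) \<Rightarrow> real) \<Rightarrow> bool" where
  "loc_zero k q y \<longleftrightarrow> (\<forall>a1\<in>poly_space (int k - int ((mdeg q + 1) div 2)).
      \<forall>a2\<in>poly_space (int k - int ((mdeg q + 1) div 2)). mpair (q * a1 * a2) y = 0)"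

definition crit_pairs :: "'v::finite mpoly \<Rightarrow> ('i \<Rightarrow> 'v mpoly) \<Rightarrow> 'i set \<Rightarrow> 'i set
    \<Rightarrow> ((real^'v) \<times> ('i \<Rightarrow> real)) set" where
  "crit_pairs f c E I = {(x, lam).
      (\<forall>i\<in>E. meval (c i) x = 0) \<and> (\<forall>j\<in>I. lam j * meval (c j) x = 0) \<and>
      (\<forall>v. meval (mpderiv v f) x = (\<Sum>i\<in>E \<union> I. lam i * meval (mpderiv v (c i)) x))}"

definition crit_points :: "'v::finite mpoly \<Rightarrow> ('i \<Rightarrow> 'v mpoly) \<Rightarrow> 'i set \<Rightarrow> 'i set
    \<Rightarrow> (real^'v) set" where
  "crit_points f c E I = {u. \<exists>lam. (u, lam) \<in> crit_pairs f c E I}"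

definition phi_set :: "'v::finite mpoly \<Rightarrow> ('i \<Rightarrow> 'v mpoly) \<Rightarrow> ('i \<Rightarrow> 'v mpoly)
    \<Rightarrow> 'i set \<Rightarrow> 'i set \<Rightarrow> 'v mpoly set" where
  "phi_set f c p E I =
     range (\<lambda>v. mpderiv v f - (\<Sum>i\<in>E \<union> I. p i * mpderiv v (c i))) \<union> (\<lambda>j. p j * c j) ` I"

definition psi_set :: "('i \<Rightarrow> 'v::finite mpoly) \<Rightarrow> 'i set \<Rightarrow> 'v mpoly set" where
  "psi_set p I = p ` I"

definition feasible :: "('i \<Rightarrow> 'v::finite mpoly) \<Rightarrow> 'i set \<Rightarrow> 'i set \<Rightarrow> real^'v \<Rightarrow> bool" where
  "feasible c E I x \<longleftrightarrow> (\<forall>i\<in>E. meval (c i) x = 0) \<and> (\<forall>j\<in>I. meval (c j) x \<ge> 0)"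

text \<open>f_c (= +\<infinity> if infeasible).\<close>
definition f_c :: "'v::finite mpoly \<Rightarrow> ('i \<Rightarrow> 'v mpoly) \<Rightarrow> ('i \<Rightarrow> 'v mpoly)
    \<Rightarrow> 'i set \<Rightarrow> 'i set \<Rightarrow> ereal" where
  "f_c f c p E I = Inf {ereal (meval f x) | x. feasible c E I x
      \<and> (\<forall>q\<in>phi_set f c p E I. meval q x = 0) \<and> (\<forall>q\<in>psi_set p I. meval q x \<ge> 0)}"

definition f_mom :: "nat \<Rightarrow> 'v::finite mpoly \<Rightarrow> ('i \<Rightarrow> 'v mpoly) \<Rightarrow> ('i \<Rightarrow> 'v mpoly)
    \<Rightarrow> 'i set \<Rightarrow> 'i set \<Rightarrow> ereal" where
  "f_mom k f c p E I = Inf {ereal (mpair f y) | y.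
      (\<forall>a. mdeg_mono a > 2 * k \<longrightarrow> y a = 0) \<and>
      mpair 1 y = 1 \<and> loc_psd k 1 y \<and>
      (\<forall>i\<in>E. loc_zero k (c i) y) \<and> (\<forall>j\<in>I. loc_psd k (c j) y) \<and>
      (\<forall>q\<in>phi_set f c p E I. loc_zero k q y) \<and> (\<forall>q\<in>psi_set p I. loc_psd k q y)}"

definition f_sos :: "nat \<Rightarrow> 'v::finite mpoly \<Rightarrow> ('i \<Rightarrow> 'v mpoly) \<Rightarrow> ('i \<Rightarrow> 'v mpoly)
    \<Rightarrow> 'i set \<Rightarrow> 'i set \<Rightarrow> ereal" where
  "f_sos k f c p E I = Sup {ereal \<gamma> | \<gamma>. f - mconst \<gamma> \<in>
      set_plus_mp (IQ_trunc (c ` E) (c ` I) (2 * k)) (IQ_trunc (phi_set f c p E I) (psi_set p I) (2 * k))}"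

end

theory Submission
  imports Defs "HOL-Algebra.Algebraic_Closure_Type"
begin

text \<open>
  Let \<open>M\<close> be the quadratic module with ideal generated by all constraints of the problem defining \<open>f\<^sub>c\<close>.
  It suffices to find reals \<open>v\<^sub>i \<ge> f\<^sub>c\<close> with \<open>- \<pi>(f)\<^sup>2 \<in> M\<close> for \<open>\<pi> = \<Prod>\<^sub>i (t - v\<^sub>i)\<close>: for \<open>\<gamma> < f\<^sub>c\<close> the
  univariate polynomial \<open>t - \<gamma> + C \<pi>\<^sup>2\<close> is nonnegative for large \<open>C\<close>, hence a sum of squares, and
  substituting \<open>f\<close> certifies \<open>f - \<gamma>\<close> in a degree that does not depend on \<open>\<gamma>\<close>.

  Suppose \<open>\<rho> \<in> M\<close> is negative at all critical points with \<open>f < f\<^sub>c\<close>. If no such \<open>\<pi>\<close> existed, Zorn's lemma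
  would give a prime cone of the polynomial ring containing \<open>\<rho>\<close> and, in its support, the critical
  equations, but no \<open>\<pi>(f)\<close>. In its residue field every derivation kills \<open>f\<close>, because \<open>df = \<Sum> p\<^sub>i dc\<^sub>i\<close> and
  \<open>p\<^sub>i = 0\<close> or \<open>c\<^sub>i = 0\<close>; hence \<open>f\<close> is algebraic over the reals, so it is a real number \<open>v\<close>, and \<open>v < f\<^sub>c\<close>. By the
  Artin--Lang theorem there is a real critical point with \<open>f = v\<close> and \<open>\<rho> \<ge> 0\<close>, a contradiction. The
  Artin--Lang theorem is proved by embedding the residue field into a real closed field and transferring
  sign conditions to the reals one variable at a time.

  In the archimedean cases such a \<open>\<rho>\<close> is constructed: \<open>f\<close> takes finitely many values at the critical points,
  on the compact set of those with \<open>f < f\<^sub>c\<close> some combination \<open>\<Sum> g (1 - g / N)\<^sup>2\<^sup>l\<close> of the inequality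
  constraints is negative, and Woermann's argument extends this to all critical points with \<open>f < f\<^sub>c\<close>.

  At a minimizer, Assumption A makes the multipliers unique, so the active gradients are linearly
  independent and the multipliers of the inequalities are nonnegative; therefore \<open>f\<^sub>c = f\<^sub>m\<^sub>i\<^sub>n\<close>.
\<close>


text \<open>The obstacle is that \<open>M\<close> is only a quadratic module: products of
  constraints need not lie in it, so the Positivstellensatz cannot be applied to the constraints
  themselves. Condensing them into one \<rho> removes this: modulo the equations, the preordering
  generated by a single element consists of the s + \<rho> t with sums of squares s and t, and this
  stays inside \<open>M\<close>. The square in the certificate is forced by the method: a prime cone
  over a preordering can keep d out of its support only if the preordering does not contain -d^2.
  That the relaxations are exact at a finite order rests on uniformity in \<gamma>. Only the scalar
  C depends on \<gamma>, and it may blow up as \<gamma> approaches the optimal value; but scaling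
  does not raise degrees, and values \<gamma> strictly below the optimum are enough for a supremum.
  If the restricted problem is infeasible, no real v is admissible and the certificate reads -1 in
  \<open>M\<close>.\<close>

hide_const (open) Polynomials.degree Polynomials.lead_coeff up_ring.monom up_ring.coeff module.smult Coset.order

section \<open>Ordered fields with the intermediate value property\<close>

text \<open>The intermediate value property for polynomials is what the comparison of sign diagrams
  rests on. Polynomials enter through coefficient functions, so that the axiom speaks of field
  operations and order alone.\<close>

class real_closed = linordered_field +
  assumes ivt_sum: "a < b \<Longrightarrow> (\<Sum>k\<le>n. f k * a ^ k) < 0 \<Longrightarrow> (\<Sum>k\<le>n. f k * b ^ k) > 0 \<Longrightarrow>
    \<exists>x>a. x < b \<and> (\<Sum>k\<le>n. f k * x ^ k) = 0"

lemma real_closed_IVT_pos: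
  fixes f :: "'a::real_closed poly"
  assumes "a < b" "poly f a < 0" "poly f b > 0"
  shows "\<exists>x>a. x < b \<and> poly f x = 0"
  using ivt_sum[where a=a and b=b and n="degree f" and f="coeff f"] assms by (simp add: poly_altdef)

lemma real_closed_IVT:
  fixes f :: "'a::real_closed poly"
  assumes "a < b" "poly f a * poly f b < 0"
  shows "\<exists>x>a. x < b \<and> poly f x = 0"
proof (cases "poly f a < 0")
  case True
  with assms show ?thesis using real_closed_IVT_pos[of a b f] by (auto simp: mult_less_0_iff)
next
  case False
  with assms show ?thesis using real_closed_IVT_pos[of a b "-f"] by (auto simp: mult_less_0_iff)
qed

lemma real_closed_Rolle:
  fixes f :: "'a::real_closed poly"
  assumes ab: "a < b" and fa: "poly f a = 0" and fb: "poly f b = 0"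
  shows "\<exists>x>a. x < b \<and> poly (pderiv f) x = 0"
proof (cases "f = 0")
  case True
  then show ?thesis using dense[OF ab] by auto
next
  case f0: False
  define S where "S = {x. a < x \<and> x \<le> b \<and> poly f x = 0}"
  have fin: "finite S" using poly_roots_finite[OF f0] by (rule rev_finite_subset) (auto simp: S_def)
  have bS: "b \<in> S" using ab fb by (simp add: S_def)
  define d where "d = Min S"
  have dS: "d \<in> S" using fin bS unfolding d_def by (intro Min_in) auto
  have noroot: "poly f x \<noteq> 0" if "a < x" "x < d" for x
  proof
    assume "poly f x = 0"
    hence "x \<in> S" using that dS by (auto simp: S_def)
    hence "d \<le> x" using fin by (simp add: d_def)
    thus False using that by simp
  qed
  have ad: "a < d" "d \<le> b" "poly f d = 0" using dS by (auto simp: S_def)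
  obtain g1 where g1: "f = [:-a,1:] ^ order a f * g1" "\<not> [:-a,1:] dvd g1"
    using order_decomp[OF f0] by blast
  have "order a f \<noteq> 0" using fa f0 by (simp add: order_root)
  then obtain m where m: "order a f = Suc m" by (cases "order a f") auto
  have g1a: "poly g1 a \<noteq> 0" using g1(2) by (simp add: poly_eq_0_iff_dvd)
  have g10: "g1 \<noteq> 0" using g1(2) by auto
  have g1d: "poly g1 d = 0" 
  proof -
    have "poly ([:-a,1:] ^ order a f * g1) d = 0" using ad g1(1) by simp
    thus ?thesis using ad(1) by simp
  qed
  obtain g where g: "g1 = [:-d,1:] ^ order d g1 * g" "\<not> [:-d,1:] dvd g"
    using order_decomp[OF g10] by blast
  have "order d g1 \<noteq> 0" using g1d g10 by (simp add: order_root)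
  then obtain n where n: "order d g1 = Suc n" by (cases "order d g1") auto
  have gd: "poly g d \<noteq> 0" using g(2) by (simp add: poly_eq_0_iff_dvd)
  have ga: "poly g a \<noteq> 0" using g1a g(1) by (metis mult_eq_0_iff poly_mult)
  have f_eq: "f = [:-a,1:] ^ Suc m * ([:-d,1:] ^ Suc n * g)" using g1(1) g(1) m n by simp
  have same: "poly g a * poly g d > 0"
  proof (rule ccontr)
    assume "\<not> poly g a * poly g d > 0"
    hence "poly g a * poly g d < 0" using ga gd by (metis mult_eq_0_iff linorder_neqE)
    from real_closed_IVT[OF ad(1) this] obtain x where "x > a" "x < d" "poly g x = 0" by blast
    with noroot[of x] f_eq show False by simp
  qed
  define h where "h = of_nat (Suc m) * ([:-d,1:] * g) + of_nat (Suc n) * ([:-a,1:] * g) + [:-a,1:] * [:-d,1:] * pderiv g"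
  have der: "pderiv (A ^ Suc m * (D ^ Suc n * g)) = A^m * D^n * (of_nat (Suc m) * (D * g) + of_nat (Suc n) * (A * g) + A * D * pderiv g)"
    if "pderiv A = 1" "pderiv D = 1" for A D :: "'a poly"
  proof -
    have sm: "smult (of_nat k) q = of_nat k * q" for k and q :: "'a poly" by (simp add: of_nat_poly)
    show ?thesis unfolding pderiv_mult pderiv_power_Suc that sm
      by (simp add: algebra_simps del: of_nat_Suc)
  qed
  have pf: "pderiv f = [:-a,1:]^m * [:-d,1:]^n * h"
    unfolding f_eq h_def by (rule der) (simp_all add: pderiv_pCons)
  have ha: "poly h a = of_nat (Suc m) * (a - d) * poly g a"
    and hd: "poly h d = of_nat (Suc n) * (d - a) * poly g d"
    by (simp_all add: h_def of_nat_poly algebra_simps)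
  have "poly h a * poly h d = - (of_nat (Suc m) * of_nat (Suc n) * ((d - a)*(d-a)) * (poly g a * poly g d))"
    unfolding ha hd by (simp add: algebra_simps del: of_nat_Suc)
  also have "\<dots> < 0" using ad(1) same by (simp del: of_nat_Suc)
  finally obtain x where "x > a" "x < d" "poly h x = 0" using real_closed_IVT[OF ad(1)] by blast
  thus ?thesis using ad(2) pf by (intro exI[of _ x]) auto
qed

lemma real_closed_MVT:
  fixes f :: "'a::real_closed poly"
  assumes "a < b"
  shows "\<exists>x>a. x < b \<and> poly f b - poly f a = (b - a) * poly (pderiv f) x"
proof -
  define s where "s = (poly f b - poly f a) / (b - a)"
  define g where "g = f - [:poly f a - s * a, s:]"
  have "s * (b - a) = poly f b - poly f a" using assms by (simp add: s_def)
  hence "poly g a = 0" "poly g b = 0" by (auto simp: g_def algebra_simps)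
  from real_closed_Rolle[OF assms this] obtain x where x: "x > a" "x < b" "poly (pderiv g) x = 0" by blast
  have "poly (pderiv f) x = s" using x(3) by (simp add: g_def pderiv_diff pderiv_pCons)
  thus ?thesis using x assms by (intro exI[of _ x]) (simp add: s_def)
qed

lemma real_closed_increasing:
  fixes f :: "'a::real_closed poly"
  assumes "a < b" "\<And>x. a < x \<Longrightarrow> x < b \<Longrightarrow> poly (pderiv f) x > 0"
  shows "poly f a < poly f b"
proof -
  obtain x where x: "x > a" "x < b" "poly f b - poly f a = (b - a) * poly (pderiv f) x"
    using real_closed_MVT[OF assms(1), of f] by blast
  have "(b - a) * poly (pderiv f) x > 0" using assms x by simp
  thus ?thesis using x(3) by simp
qed

text \<open>The two arguments live in different fields, so values of \<open>sgn\<close> cannot be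
  compared.\<close>

definition same_sign :: "'a::linordered_field \<Rightarrow> 'b::linordered_field \<Rightarrow> bool" where
  "same_sign u v \<longleftrightarrow> (u > 0 \<longleftrightarrow> v > 0) \<and> (u < 0 \<longleftrightarrow> v < 0)"

lemma same_sign_zero:
  fixes u :: "'a::linordered_field" and v :: "'b::linordered_field"
  shows "same_sign u v \<Longrightarrow> u = 0 \<longleftrightarrow> v = 0"
  unfolding same_sign_def by (cases u "0::'a" rule: linorder_cases; cases v "0::'b" rule: linorder_cases) auto

lemma same_sign_pos_mult:
  "c > 0 \<Longrightarrow> d > 0 \<Longrightarrow> same_sign (c * u) (d * v) \<Longrightarrow> same_sign u v"
  by (auto simp: same_sign_def zero_less_mult_iff mult_less_0_iff)

lemma same_sign_uminus: "same_sign (- u) (- v) = same_sign u v"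
  by (auto simp: same_sign_def)

lemma poly_tends_up:
  fixes f :: "'a::linordered_field poly"
  assumes "degree f > 0" "lead_coeff f > 0"
  shows "\<exists>m. \<forall>x\<ge>m. poly f x \<ge> b"
  using assms
proof (induction f arbitrary: b)
  case 0 then show ?case by simp
next
  case (pCons c g)
  have g0: "g \<noteq> 0" using pCons.prems by auto
  show ?case
  proof (cases "degree g = 0")
    case True
    then obtain l where l: "g = [:l:]" by (metis degree_eq_zeroE)
    hence "l > 0" using pCons.prems g0 by simp
    then show ?thesis by (intro exI[of _ "(b - c) / l"]) (auto simp: l field_simps)
  next
    case False
    hence "degree g > 0" "lead_coeff g > 0" using pCons.prems g0 by auto
    from pCons.IH[OF this, of 1] obtain m where m: "\<And>x. x \<ge> m \<Longrightarrow> poly g x \<ge> 1" by blast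
    have "poly (pCons c g) x \<ge> b" if x: "x \<ge> max m (max 0 (b - c))" for x
    proof -
      have "x * 1 \<le> x * poly g x" using m[of x] x by (intro mult_left_mono) auto
      thus ?thesis using x by simp
    qed
    thus ?thesis by blast
  qed
qed

lemma poly_sign_pinfty:
  fixes f :: "'a::linordered_field poly"
  assumes "degree f > 0"
  shows "\<exists>m. \<forall>x\<ge>m. same_sign (poly f x) (lead_coeff f)"
proof -
  have "lead_coeff f \<noteq> 0" using assms by auto
  then consider "lead_coeff f > 0" | "lead_coeff (-f) > 0" by (metis lead_coeff_minus neg_0_less_iff_less linorder_neqE)
  then show ?thesis
  proof cases
    case 1
    with poly_tends_up[OF assms, of 1] obtain m where m: "\<forall>x\<ge>m. poly f x \<ge> 1" by blast
    show ?thesis by (rule exI[of _ m]) (use m 1 in \<open>force simp: same_sign_def\<close>)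
  next
    case 2
    with poly_tends_up[of "-f" 1] assms obtain m where m: "\<forall>x\<ge>m. poly (-f) x \<ge> 1" by auto
    have "same_sign (poly f x) (lead_coeff f)" if "x \<ge> m" for x
    proof -
      have "poly f x < 0" using m that by (metis poly_minus neg_0_less_iff_less zero_less_one less_le_trans)
      thus ?thesis using 2 by (simp add: same_sign_def)
    qed
    thus ?thesis by blast
  qed
qed

text \<open>These give end points for the unbounded cells of a sign diagram; the left end follows
  from the right one by substituting -X.\<close>

lemma
  fixes f :: "'a::linordered_field poly" and g :: "'b::linordered_field poly"
  assumes "degree f = degree g" "degree f > 0" "same_sign (lead_coeff f) (lead_coeff g)"
  shows right_end_same_sign: "\<exists>s t. s > x \<and> t > y \<and> same_sign (poly f s) (poly g t)"
    and left_end_same_sign: "\<exists>s t. s < x \<and> t < y \<and> same_sign (poly f s) (poly g t)"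
proof -
  have R: "\<exists>s t. s > x \<and> t > y \<and> same_sign (poly f s) (poly g t)"
    if fg: "degree f = degree g" "degree f > 0" "same_sign (lead_coeff f) (lead_coeff g)"
    for f :: "'a poly" and g :: "'b poly" and x y
  proof -
    obtain m where m: "\<forall>x\<ge>m. same_sign (poly f x) (lead_coeff f)" using poly_sign_pinfty[OF fg(2)] by blast
    obtain m' where m': "\<forall>x\<ge>m'. same_sign (poly g x) (lead_coeff g)" using poly_sign_pinfty[of g] fg by auto
    show ?thesis
      by (rule exI[of _ "max m (x+1)"], rule exI[of _ "max m' (y+1)"])
        (use m m' fg(3) in \<open>simp add: same_sign_def less_max_iff_disj\<close>)
  qed
  show "\<exists>s t. s > x \<and> t > y \<and> same_sign (poly f s) (poly g t)" using R[OF assms] .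
  have d: "degree (pcompose f [:0,-1:]) = degree f" "degree (pcompose g [:0,-1:]) = degree g" by (simp_all add: degree_pcompose)
  have l: "lead_coeff (pcompose f [:0,-1:]) = lead_coeff f * (-1)^degree f"
    "lead_coeff (pcompose g [:0,-1:]) = lead_coeff g * (-1)^degree g" by (subst lead_coeff_comp; simp)+
  have "same_sign (lead_coeff (pcompose f [:0,-1:])) (lead_coeff (pcompose g [:0,-1:]))"
    using assms(3) unfolding l assms(1)
    by (cases "even (degree g)") (simp_all add: same_sign_uminus)
  from R[OF _ _ this, of "-x" "-y"] assms(1,2) d
  obtain s t where "s > -x" "t > -y" "same_sign (poly f (-s)) (poly g (-t))"
    by (auto simp: poly_pcompose)
  thus "\<exists>s t. s < x \<and> t < y \<and> same_sign (poly f s) (poly g t)"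
    by (intro exI[of _ "-s"] exI[of _ "-t"]) (auto simp: minus_less_iff)
qed

section \<open>Matching sign diagrams\<close>

text \<open>The set Z pairs corresponding roots over the two fields; x and y are matched if they lie in
  corresponding cells of the two subdivisions of the line.\<close>

definition matched :: "('a::linordered_field \<times> 'b::linordered_field) set \<Rightarrow> 'a \<Rightarrow> 'b \<Rightarrow> bool" where
  "matched Z x y \<longleftrightarrow> (\<forall>(z, w)\<in>Z. (x < z \<longleftrightarrow> y < w) \<and> (x = z \<longleftrightarrow> y = w))"

text \<open>The two families have the same sign diagram: \<open>Z\<close> pairs roots in increasing
  order, and matched points see equal signs. Every paired point must be a root of some nonzero
  member, because the sign of a new polynomial at that point is read off from its remainder modulo
  that member.\<close>

definition coherent :: "('a::linordered_field poly \<times> 'b::linordered_field poly) set \<Rightarrow> bool" where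
  "coherent F \<longleftrightarrow> (\<exists>Z. finite Z \<and> (\<forall>(x, y)\<in>Z. matched Z x y) \<and>
     (\<forall>(x, y)\<in>Z. \<exists>(p, q)\<in>F. p \<noteq> 0 \<and> q \<noteq> 0 \<and> poly p x = 0) \<and>
     (\<forall>x y. matched Z x y \<longrightarrow> (\<forall>(f, g)\<in>F. same_sign (poly f x) (poly g y))))"

lemma matched_iff:
  assumes "matched Z x y" "(z, w) \<in> Z"
  shows "x < z \<longleftrightarrow> y < w" "x = z \<longleftrightarrow> y = w" "z < x \<longleftrightarrow> w < y"
proof -
  show 1: "x < z \<longleftrightarrow> y < w" "x = z \<longleftrightarrow> y = w" using bspec[OF assms(1)[unfolded matched_def] assms(2)] by simp_all
  show "z < x \<longleftrightarrow> w < y" using 1 by (cases x z rule: linorder_cases; cases y w rule: linorder_cases) auto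
qed

text \<open>A witness is carried from one field to the other here. If \<open>y\<close> is no paired
  root, the partners of the roots below \<open>y\<close> all lie below the partners of those above
  it, and an ordered field is dense and without end points.\<close>

lemma matched_exists:
  fixes Z :: "('a::linordered_field \<times> 'b::linordered_field) set"
  assumes fin: "finite Z" and chain: "\<forall>(x, y)\<in>Z. matched Z x y"
  shows "\<exists>x. matched Z x y"
proof (cases "\<exists>z. (z, y) \<in> Z")
  case True
  thus ?thesis using chain by blast
next
  case False
  define L U where "L = fst ` {p\<in>Z. snd p < y}" and "U = fst ` {p\<in>Z. y < snd p}"
  have fLU: "finite L" "finite U" using fin by (simp_all add: L_def U_def)
  have LU: "l < u" if "l \<in> L" "u \<in> U" for l u
  proof -
    from that obtain w w' where "(l, w) \<in> Z" "w < y" "(u, w') \<in> Z" "y < w'" by (auto simp: L_def U_def)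
    with chain show ?thesis using matched_iff(1)[of Z l w u w'] by auto
  qed
  obtain x where x: "\<forall>l\<in>L. l < x" "\<forall>u\<in>U. x < u"
  proof (cases "L = {}")
    case True
    show ?thesis
    proof (cases "U = {}")
      case True with \<open>L = {}\<close> show ?thesis using that[of 0] by simp
    next
      case False
      have "Min U - 1 < u" if "u \<in> U" for u
        using Min_le[OF fLU(2) that] by (simp add: algebra_simps add_strict_increasing)
      with True show ?thesis using that[of "Min U - 1"] by simp
    qed
  next
    case L: False
    show ?thesis
    proof (cases "U = {}")
      case True
      have "l < Max L + 1" if "l \<in> L" for l
        using Max_ge[OF fLU(1) that] by (simp add: algebra_simps add_strict_increasing)
      with True show ?thesis using that[of "Max L + 1"] by simp
    next
      case False
      hence "Max L < Min U" using LU fLU L by simp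
      then obtain x where "Max L < x" "x < Min U" using dense by blast
      thus ?thesis using that[of x] fLU L False by auto
    qed
  qed
  have "matched Z x y"
    unfolding matched_def
  proof (clarify, intro conjI)
    fix z w assume zw: "(z, w) \<in> Z"
    hence "w \<noteq> y" using False by blast
    hence "w < y \<and> z \<in> L \<or> y < w \<and> z \<in> U" using zw by (force simp: L_def U_def)
    hence "w < y \<and> z < x \<or> y < w \<and> x < z" using x by blast
    thus "x < z \<longleftrightarrow> y < w" "x = z \<longleftrightarrow> y = w" by auto
  qed
  thus ?thesis ..
qed

text \<open>By monotonicity the signs at the two ends decide everything: either both polynomials
  keep one common sign inside, or each has exactly one root there and the sign tells on which side
  of it a point lies.\<close>

lemma increasing_pair:
  fixes f :: "'a::real_closed poly" and g :: "'b::real_closed poly"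
  assumes "a < b" "a' < b'"
    and df: "\<forall>u. a < u \<and> u < b \<longrightarrow> poly (pderiv f) u > 0"
    and dg: "\<forall>u. a' < u \<and> u < b' \<longrightarrow> poly (pderiv g) u > 0"
    and sa: "same_sign (poly f a) (poly g a')" and sb: "same_sign (poly f b) (poly g b')"
  shows "(\<forall>u w. a < u \<and> u < b \<and> a' < w \<and> w < b' \<longrightarrow> same_sign (poly f u) (poly g w)) \<or>
    (\<exists>u0 w0. a < u0 \<and> u0 < b \<and> a' < w0 \<and> w0 < b' \<and>
      (\<forall>u. a < u \<and> u < b \<longrightarrow> same_sign (poly f u) (u - u0)) \<and>
      (\<forall>w. a' < w \<and> w < b' \<longrightarrow> same_sign (poly g w) (w - w0)))"
proof -
  have fi: "poly f u < poly f v" if "a \<le> u" "u < v" "v \<le> b" for u v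
    using real_closed_increasing[OF that(2), of f] df that by force
  have gi: "poly g u < poly g v" if "a' \<le> u" "u < v" "v \<le> b'" for u v
    using real_closed_increasing[OF that(2), of g] dg that by force
  consider "poly f a \<ge> 0" | "poly f b \<le> 0" | "poly f a < 0" "poly f b > 0" by linarith
  then show ?thesis
  proof cases
    case 1
    hence "poly g a' \<ge> 0" using sa by (auto simp: same_sign_def not_less[symmetric])
    have "same_sign (poly f u) (poly g w)" if "a < u" "u < b" "a' < w" "w < b'" for u w
      using fi[of a u] gi[of a' w] that 1 \<open>poly g a' \<ge> 0\<close> by (auto simp: same_sign_def)
    thus ?thesis by blast
  next
    case 2
    hence "poly g b' \<le> 0" using sb by (auto simp: same_sign_def not_less[symmetric])
    have "same_sign (poly f u) (poly g w)" if "a < u" "u < b" "a' < w" "w < b'" for u w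
      using fi[of u b] gi[of w b'] that 2 \<open>poly g b' \<le> 0\<close> by (auto simp: same_sign_def)
    thus ?thesis by blast
  next
    case 3
    hence g: "poly g a' < 0" "poly g b' > 0" using sa sb by (auto simp: same_sign_def)
    obtain u0 where u0: "a < u0" "u0 < b" "poly f u0 = 0" using real_closed_IVT_pos[OF assms(1) 3] by blast
    obtain w0 where w0: "a' < w0" "w0 < b'" "poly g w0 = 0" using real_closed_IVT_pos[OF assms(2) g] by blast
    have "same_sign (poly f u) (u - u0)" if "a < u" "u < b" for u
      using fi[of u u0] fi[of u0 u] that u0 by (cases u u0 rule: linorder_cases) (auto simp: same_sign_def)
    moreover have "same_sign (poly g w) (w - w0)" if "a' < w" "w < b'" for w
      using gi[of w w0] gi[of w0 w] that w0 by (cases w w0 rule: linorder_cases) (auto simp: same_sign_def)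
    ultimately show ?thesis using u0 w0 by blast
  qed
qed

lemma poly_zero_on_interval:
  fixes f :: "'a::linordered_field poly"
  assumes "a < b" "\<And>x. a < x \<Longrightarrow> x < b \<Longrightarrow> poly f x = 0"
  shows "f = 0"
proof (rule ccontr)
  assume "f \<noteq> 0"
  hence "finite {x. poly f x = 0}" by (rule poly_roots_finite)
  moreover have "{a<..<b} \<subseteq> {x. poly f x = 0}" using assms by auto
  ultimately have "finite {a<..<b}" by (rule rev_finite_subset)
  thus False using infinite_Ioo[OF assms(1)] by simp
qed

text \<open>The remainder hypothesis fixes the signs of \<open>f\<close> and \<open>g\<close> at the
  points of \<open>Z\<close>. The derivative has constant sign on each cell, so each cell
  contributes at most one new pair of roots.\<close>

lemma coherent_insert:
  fixes f :: "'a::real_closed poly" and g :: "'b::real_closed poly"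
  assumes coh: "coherent F"
    and deg: "degree f = degree g" "degree f > 0" and lc: "same_sign (lead_coeff f) (lead_coeff g)"
    and der: "(pderiv f, pderiv g) \<in> F"
    and rem: "\<And>p q. (p, q) \<in> F \<Longrightarrow> p \<noteq> 0 \<Longrightarrow> degree p > 0 \<Longrightarrow>
      \<exists>c d u v r s. c > 0 \<and> d > 0 \<and> (r, s) \<in> F \<and> smult c f = p * u + r \<and> smult d g = q * v + s"
  shows "coherent (insert (f, g) F)"
proof -
  obtain Z where Z: "finite Z \<and> (\<forall>(x, y)\<in>Z. matched Z x y) \<and>
     (\<forall>(x, y)\<in>Z. \<exists>(p, q)\<in>F. p \<noteq> 0 \<and> q \<noteq> 0 \<and> poly p x = 0) \<and>
     (\<forall>x y. matched Z x y \<longrightarrow> (\<forall>(f, g)\<in>F. same_sign (poly f x) (poly g y)))"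
    using coh unfolding coherent_def ..
  have fin: "finite Z" and chain: "\<forall>(x, y)\<in>Z. matched Z x y"
    and roots: "\<forall>(x, y)\<in>Z. \<exists>(p, q)\<in>F. p \<noteq> 0 \<and> q \<noteq> 0 \<and> poly p x = 0" using Z by simp_all
  have sgnF: "same_sign (poly p x) (poly q y)" if "matched Z x y" "(p, q) \<in> F" for x y p q
    using Z that by fast
  have f0: "f \<noteq> 0" and g0: "g \<noteq> 0" using deg by auto
  have f'0: "pderiv f \<noteq> 0" "pderiv g \<noteq> 0" using deg by (auto simp: pderiv_eq_0_iff)
  \<comment> \<open>\<open>p\<close> vanishes at \<open>x\<close> and \<open>q\<close> at
    \<open>y\<close>, so positive multiples of f(x) and g(y) equal the values of \<open>r\<close>
    and \<open>s\<close>, whose signs agree already.\<close>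
  have onZ: "same_sign (poly f x) (poly g y)" if xy: "(x, y) \<in> Z" for x y
  proof -
    have cxy: "matched Z x y" using chain xy by blast
    obtain p q where pq: "(p, q) \<in> F" "p \<noteq> 0" "poly p x = 0" using roots xy by blast
    have qy: "poly q y = 0" using same_sign_zero[OF sgnF[OF cxy pq(1)]] pq(3) by blast
    have "degree p > 0" using pq(2,3) by (auto intro!: gr0I elim!: degree_eq_zeroE)
    then obtain c d u v r s where h: "c > 0" "d > 0" "(r, s) \<in> F" "smult c f = p * u + r" "smult d g = q * v + s"
      using rem[OF pq(1,2)] by blast
    have "c * poly f x = poly r x" using arg_cong[OF h(4), of "\<lambda>w. poly w x"] pq(3) by simp
    moreover have "d * poly g y = poly s y" using arg_cong[OF h(5), of "\<lambda>w. poly w y"] qy by simp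
    ultimately show ?thesis using same_sign_pos_mult[OF h(1,2)] sgnF[OF cxy h(3)] by metis
  qed
  \<comment> \<open>The end point of a cell is the nearest paired root, where \<open>onZ\<close>
    applies, or a point so far out that the leading coefficient decides.\<close>
  have left: "\<exists>a a'. a < x \<and> a' < y \<and> same_sign (poly f a) (poly g a') \<and> (\<forall>(z,w)\<in>Z. z < x \<longrightarrow> z \<le> a \<and> w \<le> a')"
    if cxy: "matched Z x y" for x y
  proof (cases "\<exists>p\<in>Z. fst p < x")
    case False
    obtain s t where "s < x" "t < y" "same_sign (poly f s) (poly g t)" using left_end_same_sign[OF deg lc] by blast
    thus ?thesis using False by (intro exI[of _ s] exI[of _ t]) auto
  next
    case True
    define L where "L = fst ` {p\<in>Z. fst p < x}"
    have "finite L" "L \<noteq> {}" using fin True by (auto simp: L_def)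
    hence "Max L \<in> L" by (rule Max_in)
    then obtain w0 where zw0: "(Max L, w0) \<in> Z" "Max L < x" by (auto simp: L_def)
    have w0y: "w0 < y" using matched_iff(3)[OF cxy zw0(1)] zw0(2) by simp
    have "z \<le> Max L \<and> w \<le> w0" if "(z, w) \<in> Z" "z < x" for z w
    proof -
      have "z \<in> L" using that by (force simp: L_def)
      hence "z \<le> Max L" using \<open>finite L\<close> by simp
      thus ?thesis using matched_iff[of Z z w "Max L" w0] chain that zw0 by (auto simp: le_less)
    qed
    thus ?thesis using zw0 w0y onZ[OF zw0(1)] by (intro exI[of _ "Max L"] exI[of _ w0]) auto
  qed
  have right: "\<exists>b b'. x < b \<and> y < b' \<and> same_sign (poly f b) (poly g b') \<and> (\<forall>(z,w)\<in>Z. x < z \<longrightarrow> b \<le> z \<and> b' \<le> w)"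
    if cxy: "matched Z x y" for x y
  proof (cases "\<exists>p\<in>Z. x < fst p")
    case False
    obtain s t where "s > x" "t > y" "same_sign (poly f s) (poly g t)" using right_end_same_sign[OF deg lc] by blast
    thus ?thesis using False by (intro exI[of _ s] exI[of _ t]) auto
  next
    case True
    define L where "L = fst ` {p\<in>Z. x < fst p}"
    have "finite L" "L \<noteq> {}" using fin True by (auto simp: L_def)
    hence "Min L \<in> L" by (rule Min_in)
    then obtain w0 where zw0: "(Min L, w0) \<in> Z" "x < Min L" by (auto simp: L_def)
    have w0y: "y < w0" using matched_iff(1)[OF cxy zw0(1)] zw0(2) by simp
    have "Min L \<le> z \<and> w0 \<le> w" if "(z, w) \<in> Z" "x < z" for z w
    proof -
      have "z \<in> L" using that by (force simp: L_def)
      hence "Min L \<le> z" using \<open>finite L\<close> by simp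
      thus ?thesis using matched_iff[of Z z w "Min L" w0] chain that zw0 by (auto simp: le_less)
    qed
    thus ?thesis using zw0 w0y onZ[OF zw0(1)] by (intro exI[of _ "Min L"] exI[of _ w0]) auto
  qed
  have cell: "\<exists>a b a' b'. a < x \<and> x < b \<and> a' < y \<and> y < b' \<and> same_sign (poly f a) (poly g a') \<and>
      same_sign (poly f b) (poly g b') \<and> (\<forall>u w. a < u \<and> u < b \<and> a' < w \<and> w < b' \<longrightarrow> matched Z u w)"
    if cxy: "matched Z x y" and nZ: "(x, y) \<notin> Z" for x y
  proof -
    obtain a a' where A: "a < x" "a' < y" "same_sign (poly f a) (poly g a')"
      "\<And>z w. (z,w)\<in>Z \<Longrightarrow> z < x \<Longrightarrow> z \<le> a \<and> w \<le> a'" using left[OF cxy] by blast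
    obtain b b' where B: "x < b" "y < b'" "same_sign (poly f b) (poly g b')"
      "\<And>z w. (z,w)\<in>Z \<Longrightarrow> x < z \<Longrightarrow> b \<le> z \<and> b' \<le> w" using right[OF cxy] by blast
    have "matched Z u w" if "a < u \<and> u < b \<and> a' < w \<and> w < b'" for u w
      unfolding matched_def
    proof (clarify, intro conjI)
      fix z v assume zv: "(z, v) \<in> Z"
      have "x \<noteq> z" using matched_iff(2)[OF cxy zv] nZ zv by auto
      hence "z \<le> a \<and> v \<le> a' \<or> b \<le> z \<and> b' \<le> v" using A(4)[OF zv] B(4)[OF zv] by (cases x z rule: linorder_cases) auto
      thus "u < z \<longleftrightarrow> w < v" "u = z \<longleftrightarrow> w = v" using that by auto
    qed
    with A B show ?thesis by (intro exI[of _ a] exI[of _ b] exI[of _ a'] exI[of _ b']) auto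
  qed
  \<comment> \<open>A zero of one derivative inside a cell would, through matching, make the other
    derivative vanish on a whole interval, hence identically.\<close>
  have dnz: "poly (pderiv f) x \<noteq> 0 \<and> poly (pderiv g) y \<noteq> 0" if cxy: "matched Z x y" and nZ: "(x, y) \<notin> Z" for x y
  proof -
    obtain a b a' b' where c: "a < x" "x < b" "a' < y" "y < b'"
      "\<And>u w. a < u \<Longrightarrow> u < b \<Longrightarrow> a' < w \<Longrightarrow> w < b' \<Longrightarrow> matched Z u w" using cell[OF cxy nZ] by metis
    have ss: "poly (pderiv f) u = 0 \<longleftrightarrow> poly (pderiv g) w = 0" if "a < u" "u < b" "a' < w" "w < b'" for u w
      using same_sign_zero[OF sgnF[OF c(5)[OF that] der]] .
    show ?thesis
    proof (intro conjI notI)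
      assume "poly (pderiv f) x = 0"
      hence "pderiv g = 0" using ss[of x] c by (intro poly_zero_on_interval[of a' b']) auto
      thus False using f'0 by simp
    next
      assume "poly (pderiv g) y = 0"
      hence "pderiv f = 0" using ss[of _ y] c by (intro poly_zero_on_interval[of a b]) auto
      thus False using f'0 by simp
    qed
  qed
  \<comment> \<open>By Rolle, two roots of \<open>f\<close> within one cell would enclose a zero of
    the derivative off \<open>Z\<close>, which \<open>dnz\<close> excludes.\<close>
  have sepf: "\<exists>(a, b)\<in>Z. x \<le> a \<and> a \<le> z" if xz: "x < z" and c: "matched Z x y" "poly f x = 0" "poly f z = 0" for x z y
  proof (rule ccontr)
    assume n: "\<not> ?thesis"
    obtain u where u: "x < u" "u < z" "poly (pderiv f) u = 0" using real_closed_Rolle[OF xz c(2,3)] by blast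
    have nn: "a < x \<or> z < a" if "(a, b) \<in> Z" for a b using n that by force
    have "matched Z u y" unfolding matched_def
    proof (clarify, intro conjI)
      fix a b assume ab: "(a, b) \<in> Z"
      show "u < a \<longleftrightarrow> y < b" "u = a \<longleftrightarrow> y = b" using nn[OF ab] matched_iff[OF c(1) ab] u xz by auto
    qed
    moreover have "(u, y) \<notin> Z" using nn[of u y] u by auto
    ultimately show False using dnz u by blast
  qed
  have sepg: "\<exists>(a, b)\<in>Z. y \<le> b \<and> b \<le> w" if yw: "y < w" and c: "matched Z x y" "poly g y = 0" "poly g w = 0" for x y w
  proof (rule ccontr)
    assume n: "\<not> ?thesis"
    obtain u where u: "y < u" "u < w" "poly (pderiv g) u = 0" using real_closed_Rolle[OF yw c(2,3)] by blast
    have nn: "b < y \<or> w < b" if "(a, b) \<in> Z" for a b using n that by force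
    have "matched Z x u" unfolding matched_def
    proof (clarify, intro conjI)
      fix a b assume ab: "(a, b) \<in> Z"
      show "x < a \<longleftrightarrow> u < b" "x = a \<longleftrightarrow> u = b" using nn[OF ab] matched_iff[OF c(1) ab] u yw by auto
    qed
    moreover have "(x, u) \<notin> Z" using nn[of x u] u by auto
    ultimately show False using dnz u by blast
  qed
  have cell_sign: "same_sign (poly f x) (poly g y) \<or> (\<exists>u0 w0. matched Z u0 w0 \<and> poly f u0 = 0 \<and> poly g w0 = 0 \<and>
     ((x < u0 \<longleftrightarrow> y < w0) \<and> (x = u0 \<longleftrightarrow> y = w0) \<longrightarrow> same_sign (poly f x) (poly g y)))"
    if cxy: "matched Z x y" and nZ: "(x, y) \<notin> Z" for x y
  proof -
    obtain a b a' b' where c: "a < x" "x < b" "a' < y" "y < b'" "same_sign (poly f a) (poly g a')" "same_sign (poly f b) (poly g b')"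
      and cc: "\<And>u w. a < u \<Longrightarrow> u < b \<Longrightarrow> a' < w \<Longrightarrow> w < b' \<Longrightarrow> matched Z u w" using cell[OF cxy nZ] by metis
    have ab: "a < b" "a' < b'" using c by auto
    have ds: "same_sign (poly (pderiv f) u) (poly (pderiv g) w)" if "a < u" "u < b" "a' < w" "w < b'" for u w
      using sgnF[OF cc[OF that] der] .
    \<comment> \<open>The sign \<open>e\<close> reduces the decreasing case to the increasing one;
      \<open>e'\<close> is the same sign in the second field.\<close>
    have main: ?thesis if pos: "poly (pderiv (smult e f)) x > 0" and e: "e = 1 \<or> e = -1" and e': "e' = (if e = 1 then 1 else -1)" for e :: 'a and e' :: 'b
    proof -
      have se: "same_sign (e * s) (e' * t) = same_sign s t" for s t using e e' by (auto simp: same_sign_uminus)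
      have ds': "same_sign (poly (pderiv (smult e f)) u) (poly (pderiv (smult e' g)) w)" if "a < u" "u < b" "a' < w" "w < b'" for u w
        using ds[OF that] by (simp add: pderiv_smult se)
      have gp: "\<forall>w. a' < w \<and> w < b' \<longrightarrow> poly (pderiv (smult e' g)) w > 0"
        using ds'[of x] c pos by (simp add: same_sign_def)
      have fp: "\<forall>u. a < u \<and> u < b \<longrightarrow> poly (pderiv (smult e f)) u > 0"
        using ds'[of _ y] gp c by (simp add: same_sign_def)
      have e0: "e \<noteq> 0" "e' \<noteq> 0" using e e' by auto
      have S: "same_sign (poly (smult e f) a) (poly (smult e' g) a')" "same_sign (poly (smult e f) b) (poly (smult e' g) b')"
        using c by (simp_all add: se)
      from increasing_pair[OF ab fp gp S] show ?thesis
      proof (elim disjE exE conjE)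
        assume "\<forall>u w. a < u \<and> u < b \<and> a' < w \<and> w < b' \<longrightarrow> same_sign (poly (smult e f) u) (poly (smult e' g) w)"
        hence "same_sign (poly (smult e f) x) (poly (smult e' g) y)" using c by blast
        thus ?thesis by (simp add: se)
      next
        fix u0 w0 assume h: "a < u0" "u0 < b" "a' < w0" "w0 < b'"
          "\<forall>u. a < u \<and> u < b \<longrightarrow> same_sign (poly (smult e f) u) (u - u0)"
          "\<forall>w. a' < w \<and> w < b' \<longrightarrow> same_sign (poly (smult e' g) w) (w - w0)"
        have "poly f u0 = 0" "poly g w0 = 0"
          using same_sign_zero[OF h(5)[rule_format, of u0]] same_sign_zero[OF h(6)[rule_format, of w0]] h e0 by simp_all
        moreover have "same_sign (poly f x) (poly g y)" if "(x < u0 \<longleftrightarrow> y < w0) \<and> (x = u0 \<longleftrightarrow> y = w0)"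
        proof -
          have "same_sign (x - u0) (y - w0)" using that by (cases x u0 rule: linorder_cases; cases y w0 rule: linorder_cases) (auto simp: same_sign_def)
          hence "same_sign (poly (smult e f) x) (poly (smult e' g) y)"
            using h(5)[rule_format, of x] h(6)[rule_format, of y] c by (simp add: same_sign_def)
          thus ?thesis by (simp add: se)
        qed
        ultimately show ?thesis using cc h(1-4) by blast
      qed
    qed
    have "poly (pderiv f) x \<noteq> 0" using dnz[OF cxy nZ] by blast
    then consider "poly (pderiv f) x > 0" | "poly (pderiv f) x < 0" by (cases "0::'a" "poly (pderiv f) x" rule: linorder_cases) auto
    thus ?thesis
    proof cases
      case 1 thus ?thesis using main[of 1 1] by simp
    next
      case 2 thus ?thesis using main[of "-1" "-1"] by (simp add: pderiv_minus)
    qed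
  qed
  \<comment> \<open>All matched pairs of common roots are added; \<open>sepf\<close> and
    \<open>sepg\<close> show that such pairs are ordered alike in both fields.\<close>
  define Z' where "Z' = Z \<union> {(x, y). matched Z x y \<and> poly f x = 0 \<and> poly g y = 0}"
  have cZ: "matched Z x y" if "(x, y) \<in> Z'" for x y using that chain by (auto simp: Z'_def)
  have chain': "matched Z' x y" if xy: "(x, y) \<in> Z'" for x y
    unfolding matched_def
  proof (clarify)
    fix z w assume zw: "(z, w) \<in> Z'"
    show "(x < z \<longleftrightarrow> y < w) \<and> (x = z \<longleftrightarrow> y = w)"
    proof (cases "(x, y) \<in> Z \<or> (z, w) \<in> Z")
      case True
      thus ?thesis using matched_iff[OF cZ[OF xy], of z w] matched_iff[OF cZ[OF zw], of x y] by auto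
    next
      case False
      hence h: "matched Z x y" "poly f x = 0" "poly g y = 0" "matched Z z w" "poly f z = 0" "poly g w = 0" using xy zw by (auto simp: Z'_def)
      have A: "y < w" if t: "x < z" "matched Z x y" "poly f x = 0" "matched Z z w" "poly f z = 0" for x y z w
      proof -
        obtain a b where "(a, b) \<in> Z" "x \<le> a" "a \<le> z" using sepf[OF t(1,2,3,5)] by blast
        thus ?thesis using matched_iff[OF t(2), of a b] matched_iff[OF t(4), of a b] t(1) by (auto simp: le_less)
      qed
      have B: "x < z" if t: "y < w" "matched Z x y" "poly g y = 0" "matched Z z w" "poly g w = 0" for x y z w
      proof -
        obtain a b where "(a, b) \<in> Z" "y \<le> b" "b \<le> w" using sepg[OF t(1,2,3,5)] by blast
        thus ?thesis using matched_iff[OF t(2), of a b] matched_iff[OF t(4), of a b] t(1) by (auto simp: le_less)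
      qed
      show ?thesis using A[of x z y w] A[of z x w y] B[of y w x z] B[of w y z x] h
        by (cases x z rule: linorder_cases; cases y w rule: linorder_cases) auto
    qed
  qed
  have inj: "inj_on fst Z'"
    by (rule inj_onI) (use chain' in \<open>fastforce simp: matched_def\<close>)
  have "fst ` Z' \<subseteq> fst ` Z \<union> {x. poly f x = 0}" by (auto simp: Z'_def)
  hence "finite (fst ` Z')" using fin poly_roots_finite[OF f0] by (meson finite_UnI finite_imageI finite_subset)
  hence fin': "finite Z'" using inj by (rule finite_imageD)
  have sub: "matched Z x y" if "matched Z' x y" for x y using that by (auto simp: matched_def Z'_def)
  have sgn': "same_sign (poly f x) (poly g y)" if c: "matched Z' x y" for x y
  proof (cases "(x, y) \<in> Z")
    case True thus ?thesis by (rule onZ)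
  next
    case False
    from cell_sign[OF sub[OF c] False] show ?thesis
    proof (elim disjE exE conjE)
      fix u0 w0 assume h: "matched Z u0 w0" "poly f u0 = 0" "poly g w0 = 0"
        "(x < u0 \<longleftrightarrow> y < w0) \<and> (x = u0 \<longleftrightarrow> y = w0) \<longrightarrow> same_sign (poly f x) (poly g y)"
      have "(u0, w0) \<in> Z'" using h by (simp add: Z'_def)
      thus ?thesis using h(4) matched_iff[OF c] by blast
    qed
  qed
  have roots': "\<forall>(x, y)\<in>Z'. \<exists>(p, q)\<in>insert (f, g) F. p \<noteq> 0 \<and> q \<noteq> 0 \<and> poly p x = 0"
    using roots f0 g0 by (fastforce simp: Z'_def)
  show ?thesis unfolding coherent_def
    by (rule exI[of _ Z']) (use fin' chain' roots' sgn' sgnF sub in blast)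
qed

lemma coherent_insert_const:
  assumes "coherent F" "degree f = 0" "degree g = 0" "same_sign (lead_coeff f) (lead_coeff g)"
  shows "coherent (insert (f, g) F)"
proof -
  obtain Z where Z: "finite Z \<and> (\<forall>(x, y)\<in>Z. matched Z x y) \<and>
     (\<forall>(x, y)\<in>Z. \<exists>(p, q)\<in>F. p \<noteq> 0 \<and> q \<noteq> 0 \<and> poly p x = 0) \<and>
     (\<forall>x y. matched Z x y \<longrightarrow> (\<forall>(f, g)\<in>F. same_sign (poly f x) (poly g y)))"
    using assms(1) unfolding coherent_def ..
  have "same_sign (poly f x) (poly g y)" for x y
    using assms(2-4) by (auto elim!: degree_eq_zeroE)
  thus ?thesis unfolding coherent_def
    by (intro exI[of _ Z]) (use Z in auto)
qed

text \<open>Members are inserted by increasing degree, and one at a time within a degree.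
  Derivatives and remainders have smaller degree and are present already; remainders are also taken
  modulo members of equal degree that were inserted earlier.\<close>

lemma coherent_family:
  fixes H :: "('a::real_closed poly \<times> 'b::real_closed poly) set"
  assumes fin: "finite H"
    and deg: "\<And>f g. (f, g) \<in> H \<Longrightarrow> degree f = degree g"
    and lc: "\<And>f g. (f, g) \<in> H \<Longrightarrow> same_sign (lead_coeff f) (lead_coeff g)"
    and der: "\<And>f g. (f, g) \<in> H \<Longrightarrow> degree f > 0 \<Longrightarrow> (pderiv f, pderiv g) \<in> H"
    and rem: "\<And>f g p q. (f, g) \<in> H \<Longrightarrow> (p, q) \<in> H \<Longrightarrow> 0 < degree p \<Longrightarrow> degree p \<le> degree f \<Longrightarrow>
      \<exists>c d u v r s. c > 0 \<and> d > 0 \<and> (r, s) \<in> H \<and> degree r < degree p \<and>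
        smult c f = p * u + r \<and> smult d g = q * v + s"
  shows "coherent H"
proof -
  have main: "coherent {h\<in>H. degree (fst h) < n}" for n
  proof (induction n)
    case 0
    show ?case unfolding coherent_def by (intro exI[of _ "{}"]) auto
  next
    case (Suc n)
    have "coherent ({h\<in>H. degree (fst h) < n} \<union> B)" if "finite B" "B \<subseteq> {h\<in>H. degree (fst h) = n}" for B
      using that
    proof (induction B rule: finite_induct)
      case empty
      show ?case using Suc by simp
    next
      case (insert h B)
      obtain f g where h: "h = (f, g)" by (cases h)
      have fg: "(f, g) \<in> H" "degree f = n" using insert.prems h by auto
      define F where "F = {h\<in>H. degree (fst h) < n} \<union> B"
      have FH: "F \<subseteq> H" "\<And>p q. (p, q) \<in> F \<Longrightarrow> degree p \<le> n" using insert.prems by (force simp: F_def)+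
      have coh: "coherent F" using insert by (simp add: F_def)
      have "coherent (insert (f, g) F)"
      proof (cases "n = 0")
        case True
        thus ?thesis using coherent_insert_const[OF coh] fg deg[OF fg(1)] lc[OF fg(1)] by simp
      next
        case False
        show ?thesis
        proof (rule coherent_insert[OF coh deg[OF fg(1)] _ lc[OF fg(1)]])
          show "0 < degree f" using False fg by simp
          show "(pderiv f, pderiv g) \<in> F"
            using der[OF fg(1)] fg(2) False by (simp add: F_def degree_pderiv)
          fix p q assume pq: "(p, q) \<in> F" "p \<noteq> 0" "0 < degree p"
          obtain c d u v r s where "c > 0" "d > 0" "(r, s) \<in> H" "degree r < degree p"
            "smult c f = p * u + r" "smult d g = q * v + s"
            using rem[OF fg(1), of p q] pq FH fg(2) by blast
          moreover from this have "(r, s) \<in> F" using FH(2)[OF pq(1)] by (simp add: F_def)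
          ultimately show "\<exists>c d u v r s. c > 0 \<and> d > 0 \<and> (r, s) \<in> F \<and> smult c f = p * u + r \<and> smult d g = q * v + s"
            by blast
        qed
      qed
      thus ?case by (simp add: F_def h)
    qed
    from this[of "{h\<in>H. degree (fst h) = n}"] fin
    have "coherent ({h\<in>H. degree (fst h) < n} \<union> {h\<in>H. degree (fst h) = n})" by simp
    also have "{h\<in>H. degree (fst h) < n} \<union> {h\<in>H. degree (fst h) = n} = {h\<in>H. degree (fst h) < Suc n}" by auto
    finally show ?case .
  qed
  have "\<exists>n. \<forall>h\<in>H. degree (fst h) < n"
    by (rule exI[of _ "Suc (Max ((\<lambda>h. degree (fst h)) ` H))"]) (use fin in \<open>auto simp: less_Suc_eq_le\<close>)
  then obtain n where "\<forall>h\<in>H. degree (fst h) < n" ..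
  hence "{h\<in>H. degree (fst h) < n} = H" by auto
  with main[of n] show ?thesis by simp
qed

section \<open>Pseudo-remainders and Muchnik's closure\<close>

lemma pseudo_division:
  fixes f p :: "'c::comm_ring_1 poly"
  assumes "degree p > 0"
  shows "\<exists>k u r. smult (lead_coeff p ^ (2 * k)) f = p * u + r \<and> degree r < degree p"
proof (induction "degree f" arbitrary: f rule: less_induct)
  case less
  show ?case
  proof (cases "degree f < degree p")
    case True
    thus ?thesis by (intro exI[of _ 0] exI[of _ 0] exI[of _ f]) simp
  next
    case False
    define m where "m = monom (lead_coeff f) (degree f - degree p)"
    define f1 where "f1 = smult (lead_coeff p) f - m * p"
    have d0: "degree (m * p) \<le> degree f"
      using degree_mult_le[of m p] degree_monom_le[of "lead_coeff f" "degree f - degree p"] False by (simp add: m_def)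
    have "degree f1 \<le> degree f" unfolding f1_def using d0 by (intro degree_diff_le) (auto intro: degree_smult_le)
    moreover have "coeff f1 (degree f) = 0"
      using False by (simp add: f1_def m_def coeff_monom_mult)
    ultimately have "degree f1 < degree f" using False assms by (metis degree_0 leading_coeff_0_iff le_neq_implies_less not_less gr0I le_zero_eq)
    from less[OF this] obtain k u r where h: "smult (lead_coeff p ^ (2 * k)) f1 = p * u + r" "degree r < degree p" by blast
    \<comment> \<open>One factor of the leading coefficient cancels the top term of
      \<open>f\<close>; the second keeps the exponent even.\<close>
    have "smult (lead_coeff p ^ (2 * Suc k)) f = smult (lead_coeff p) (smult (lead_coeff p ^ (2*k)) (f1 + m * p))"
      by (simp add: f1_def ac_simps)
    also have "\<dots> = smult (lead_coeff p) (p * u + r + smult (lead_coeff p ^ (2*k)) (m * p))"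
      by (simp add: smult_add_right h)
    also have "\<dots> = p * (smult (lead_coeff p) u + smult (lead_coeff p) (smult (lead_coeff p ^ (2*k)) m)) + smult (lead_coeff p) r"
      by (simp add: smult_add_right algebra_simps)
    finally show ?thesis using h(2) degree_smult_le[of "lead_coeff p" r]
      by (intro exI[of _ "Suc k"] exI[of _ "smult (lead_coeff p) u + smult (lead_coeff p) (smult (lead_coeff p ^ (2*k)) m)"] exI[of _ "smult (lead_coeff p) r"]) auto
  qed
qed

text \<open>The even power of the leading coefficient stays positive under every specialization that does not kill it.\<close>

definition prem :: "'c::comm_ring_1 poly \<Rightarrow> 'c poly \<Rightarrow> 'c poly" where
  "prem f p = (SOME r. \<exists>k u. smult (lead_coeff p ^ (2 * k)) f = p * u + r \<and> degree r < degree p)"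

lemma prem:
  assumes "degree p > 0"
  shows "\<exists>k u. smult (lead_coeff p ^ (2 * k)) f = p * u + prem f p" "degree (prem f p) < degree p"
proof -
  have "\<exists>r k u. smult (lead_coeff p ^ (2 * k)) f = p * u + r \<and> degree r < degree p"
    using pseudo_division[OF assms, of f] by metis
  from someI_ex[OF this] show "\<exists>k u. smult (lead_coeff p ^ (2 * k)) f = p * u + prem f p" "degree (prem f p) < degree p"
    unfolding prem_def by blast+
qed

text \<open>A specialization that kills the leading coefficient does not distinguish a polynomial
  from its truncation.\<close>

definition truncate_poly :: "'c::comm_ring_1 poly \<Rightarrow> 'c poly" where
  "truncate_poly f = f - monom (lead_coeff f) (degree f)"

lemma degree_truncate_poly: "degree f > 0 \<Longrightarrow> degree (truncate_poly f) < degree f"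
proof -
  assume "degree f > 0"
  moreover have "degree (truncate_poly f) \<le> degree f" unfolding truncate_poly_def
    by (intro degree_diff_le) (auto intro: degree_monom_le)
  moreover have "coeff (truncate_poly f) (degree f) = 0" by (simp add: truncate_poly_def)
  ultimately show ?thesis by (metis degree_0 leading_coeff_0_iff le_neq_implies_less)
qed

text \<open>The coefficient ring may have zero divisors here; after a homomorphism into a domain
  this becomes \<open>pderiv\<close>.\<close>

definition formal_deriv :: "'c::comm_ring_1 poly \<Rightarrow> 'c poly" where
  "formal_deriv f = Poly (map (\<lambda>i. of_nat (Suc i) * coeff f (Suc i)) [0..<degree f])"

lemma coeff_formal_deriv: "coeff (formal_deriv f) n = of_nat (Suc n) * coeff f (Suc n)"
  by (cases "n < degree f")
    (simp_all add: formal_deriv_def nth_default_def coeff_eq_0 del: of_nat_Suc)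

lemma degree_formal_deriv_less: "degree f > 0 \<Longrightarrow> degree (formal_deriv f) < degree f"
  using degree_le[of "degree f - 1" "formal_deriv f"]
  by (fastforce simp: coeff_formal_deriv coeff_eq_0)

definition muchnik_step :: "'c::comm_ring_1 poly set \<Rightarrow> 'c poly set" where
  "muchnik_step S = S \<union> formal_deriv ` {f\<in>S. degree f > 0} \<union> truncate_poly ` {f\<in>S. degree f > 0} \<union>
     (\<lambda>(f, p). prem f p) ` {(f, p). f \<in> S \<and> p \<in> S \<and> 0 < degree p \<and> degree p \<le> degree f}"

text \<open>An element that is new at one stage has a parent of larger degree that was new at the
  stage before. Along such a chain the degree drops each time, so nothing new appears once the
  number of stages reaches the maximal degree.\<close>

lemma finite_muchnik_closure:
  fixes F :: "'c::comm_ring_1 poly set"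
  assumes "finite F"
  shows "\<exists>G. finite G \<and> F \<subseteq> G \<and> muchnik_step G = G"
proof -
  define S where "S i = (muchnik_step ^^ i) F" for i
  have S_Suc: "S (Suc i) = muchnik_step (S i)" for i by (simp add: S_def)
  have fin: "finite (S i)" for i
  proof (induction i)
    case 0 show ?case using assms by (simp add: S_def)
  next
    case (Suc i)
    have "finite {(f, p). f \<in> S i \<and> p \<in> S i \<and> 0 < degree p \<and> degree p \<le> degree f}"
      by (rule finite_subset[of _ "S i \<times> S i"]) (use Suc in auto)
    thus ?case using Suc by (simp add: S_Suc muchnik_step_def)
  qed
  have sub: "F \<subseteq> S i" for i by (induction i) (auto simp: S_def muchnik_step_def)
  define d where "d = Max (insert 0 (degree ` F))"
  have d: "degree f \<le> d" if "f \<in> F" for f using that assms by (simp add: d_def)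
  have new: "degree z + i < d" if "z \<in> S (Suc i)" "z \<notin> S i" for z i
    using that
  proof (induction i arbitrary: z)
    case 0
    hence "z \<in> muchnik_step F" "z \<notin> F" by (auto simp: S_def)
    then obtain f where "f \<in> F" "degree z < degree f"
      by (force simp: muchnik_step_def dest: degree_formal_deriv_less degree_truncate_poly prem(2))
    thus ?case using d[of f] by simp
  next
    case (Suc i)
    have z: "z \<in> muchnik_step (S (Suc i))" "z \<notin> muchnik_step (S i)" using Suc.prems S_Suc by auto
    hence "\<exists>f. f \<in> S (Suc i) \<and> f \<notin> S i \<and> degree z < degree f"
    proof -
      from z(1) Suc.prems(2) consider
        (a) f where "f \<in> S (Suc i)" "degree f > 0" "z = formal_deriv f"
        | (b) f where "f \<in> S (Suc i)" "degree f > 0" "z = truncate_poly f"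
        | (c) f p where "f \<in> S (Suc i)" "p \<in> S (Suc i)" "0 < degree p" "degree p \<le> degree f" "z = prem f p"
        unfolding muchnik_step_def by auto
      then show ?thesis
      proof cases
        case a
        hence "f \<notin> S i" using z(2) by (auto simp: muchnik_step_def)
        with a show ?thesis using degree_formal_deriv_less by blast
      next
        case b
        hence "f \<notin> S i" using z(2) by (auto simp: muchnik_step_def)
        with b show ?thesis using degree_truncate_poly by blast
      next
        case c
        hence "\<not> (f \<in> S i \<and> p \<in> S i)" using z(2) by (auto simp: muchnik_step_def)
        with c show ?thesis using prem(2)[OF c(3), of f] by (meson less_le_trans)
      qed
    qed
    then obtain f where "f \<in> S (Suc i)" "f \<notin> S i" "degree z < degree f" by blast
    with Suc.IH[of f] show ?case by simp
  qed
  have "S (Suc d) \<subseteq> S d" using new[of _ d] by fastforce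
  moreover have "S d \<subseteq> muchnik_step (S d)" by (auto simp: muchnik_step_def)
  ultimately have "muchnik_step (S d) = S d" using S_Suc by auto
  thus ?thesis using fin sub by (intro exI[of _ "S d"]) simp
qed

section \<open>Ring homomorphisms and coefficientwise specialization\<close>

definition ring_hom_fun :: "('c::comm_ring_1 \<Rightarrow> 'd::comm_ring_1) \<Rightarrow> bool" where
  "ring_hom_fun e \<longleftrightarrow> e 1 = 1 \<and> (\<forall>x y. e (x + y) = e x + e y) \<and> (\<forall>x y. e (x * y) = e x * e y)"

context
  fixes e :: "'c::comm_ring_1 \<Rightarrow> 'd::comm_ring_1"
  assumes e: "ring_hom_fun e"
begin

lemma ring_hom_fun_one: "e 1 = 1" and ring_hom_fun_add: "e (x + y) = e x + e y"
  and ring_hom_fun_mult: "e (x * y) = e x * e y"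
  using e by (auto simp: ring_hom_fun_def)

lemma ring_hom_fun_zero: "e 0 = 0"
  using ring_hom_fun_add[of 0 0] by simp

lemma ring_hom_fun_uminus: "e (- x) = - e x"
  using ring_hom_fun_add[of x "-x"] ring_hom_fun_zero by (simp add: eq_neg_iff_add_eq_0 add.commute)

lemma ring_hom_fun_diff: "e (x - y) = e x - e y"
  using ring_hom_fun_add[of x "-y"] ring_hom_fun_uminus by simp

lemma ring_hom_fun_power: "e (x ^ n) = e x ^ n"
  by (induction n) (simp_all add: ring_hom_fun_one ring_hom_fun_mult)

lemma ring_hom_fun_sum: "e (sum f A) = (\<Sum>a\<in>A. e (f a))"
  by (induction A rule: infinite_finite_induct) (simp_all add: ring_hom_fun_zero ring_hom_fun_add)

lemma ring_hom_fun_of_nat: "e (of_nat n) = of_nat n"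
  by (induction n) (simp_all add: ring_hom_fun_zero ring_hom_fun_add ring_hom_fun_one)

lemma map_poly_hom_add: "map_poly e (p + q) = map_poly e p + map_poly e q"
  by (rule poly_eqI) (simp add: coeff_map_poly ring_hom_fun_zero ring_hom_fun_add)

lemma map_poly_hom_diff: "map_poly e (p - q) = map_poly e p - map_poly e q"
  by (rule poly_eqI) (simp add: coeff_map_poly ring_hom_fun_zero ring_hom_fun_diff)

lemma map_poly_hom_mult: "map_poly e (p * q) = map_poly e p * map_poly e q"
  by (rule poly_eqI) (simp add: coeff_map_poly coeff_mult ring_hom_fun_zero ring_hom_fun_sum ring_hom_fun_mult)

lemma map_poly_hom_smult: "map_poly e (smult c q) = smult (e c) (map_poly e q)"
  by (rule poly_eqI) (simp add: coeff_map_poly ring_hom_fun_zero ring_hom_fun_mult)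

lemma map_poly_hom_truncate:
  assumes "e (lead_coeff f) = 0"
  shows "map_poly e (truncate_poly f) = map_poly e f"
  by (rule poly_eqI) (use assms in \<open>auto simp: truncate_poly_def map_poly_hom_diff coeff_map_poly ring_hom_fun_zero ring_hom_fun_diff\<close>)

lemma degree_map_poly_hom_le: "degree (map_poly e f) \<le> degree f"
  by (rule degree_le) (auto simp: coeff_map_poly ring_hom_fun_zero coeff_eq_0)

lemma degree_map_poly_hom: "e (lead_coeff f) \<noteq> 0 \<Longrightarrow> degree (map_poly e f) = degree f"
  by (intro antisym degree_map_poly_hom_le le_degree) (simp add: coeff_map_poly ring_hom_fun_zero)

end

lemma map_poly_hom_pderiv:
  fixes e :: "'c::comm_ring_1 \<Rightarrow> 'd::idom"
  assumes "ring_hom_fun e"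
  shows "map_poly e (formal_deriv q) = pderiv (map_poly e q)"
  by (rule poly_eqI) (simp add: coeff_map_poly coeff_pderiv coeff_formal_deriv ring_hom_fun_zero[OF assms] ring_hom_fun_mult[OF assms]
    ring_hom_fun_of_nat[OF assms] del: of_nat_Suc)

text \<open>Elimination of one quantifier: \<open>C\<close> depends on \<open>F\<close> alone, and
  if two specializations agree in sign on \<open>C\<close>, every sign vector that \<open>F\<close>
  attains over the second field is attained over the first. \<open>C\<close> collects all
  coefficients of the Muchnik closure, so that the leading coefficients arising in the construction
  are controlled.\<close>

lemma sign_transfer:
  fixes F :: "'c::comm_ring_1 poly set"
  assumes "finite F"
  shows "\<exists>C. finite C \<and> (\<forall>(e1 :: 'c \<Rightarrow> 'a::real_closed) (e2 :: 'c \<Rightarrow> 'b::real_closed).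
    ring_hom_fun e1 \<longrightarrow> ring_hom_fun e2 \<longrightarrow> (\<forall>c\<in>C. same_sign (e1 c) (e2 c)) \<longrightarrow>
    (\<forall>y. \<exists>x. \<forall>f\<in>F. same_sign (poly (map_poly e1 f) x) (poly (map_poly e2 f) y)))"
proof -
  obtain G where G: "finite G" "F \<subseteq> G" "muchnik_step G = G" using finite_muchnik_closure[OF assms] by blast
  have clD: "formal_deriv f \<in> G" "truncate_poly f \<in> G" if "f \<in> G" "degree f > 0" for f
    using G(3) that by (auto simp: muchnik_step_def)
  have clP: "prem f p \<in> G" if "f \<in> G" "p \<in> G" "0 < degree p" "degree p \<le> degree f" for f p
  proof -
    have "prem f p \<in> muchnik_step G" unfolding muchnik_step_def using that by (intro UnI2 image_eqI[of _ _ "(f, p)"]) auto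
    thus ?thesis using G(3) by simp
  qed
  define C where "C = (\<Union>f\<in>G. set (coeffs f))"
  have "\<forall>y. \<exists>x. \<forall>f\<in>F. same_sign (poly (map_poly e1 f) x) (poly (map_poly e2 f) y)"
    if e1: "ring_hom_fun e1" and e2: "ring_hom_fun e2" and C: "\<forall>c\<in>C. same_sign (e1 c) (e2 c)"
    for e1 :: "'c \<Rightarrow> 'a" and e2 :: "'c \<Rightarrow> 'b"
  proof -
    have lc: "same_sign (e1 (lead_coeff f)) (e2 (lead_coeff f))" if "f \<in> G" for f
    proof (cases "f = 0")
      case True thus ?thesis by (simp add: ring_hom_fun_zero[OF e1] ring_hom_fun_zero[OF e2] same_sign_def)
    next
      case False
      hence "lead_coeff f \<in> set (coeffs f)" by (metis coeff_in_coeffs le_refl)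
      thus ?thesis using C that by (auto simp: C_def)
    qed
    \<comment> \<open>Only members whose leading coefficient survives are kept, so that degrees
      agree on both sides; the pair of zeros stands for members that are killed entirely.\<close>
    define H where "H = insert (0, 0) ((\<lambda>f. (map_poly e1 f, map_poly e2 f)) ` {f\<in>G. e1 (lead_coeff f) \<noteq> 0})"
    \<comment> \<open>If the leading coefficient dies, the truncation has the same image and smaller
      degree; the recursion ends at a survivor or at zero.\<close>
    have inH: "(map_poly e1 f, map_poly e2 f) \<in> H" if "f \<in> G" for f
      using that
    proof (induction "degree f" arbitrary: f rule: less_induct)
      case less
      show ?case
      proof (cases "e1 (lead_coeff f) = 0")
        case False thus ?thesis using less.prems by (auto simp: H_def)
      next
        case True
        hence t2: "e2 (lead_coeff f) = 0" using same_sign_zero[OF lc[OF less.prems]] by simp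
        show ?thesis
        proof (cases "degree f = 0")
          case d: True
          then obtain a where "f = [:a:]" by (rule degree_eq_zeroE)
          hence "map_poly e1 f = 0" "map_poly e2 f = 0" using True t2 by (simp_all add: map_poly_pCons ring_hom_fun_zero[OF e1] ring_hom_fun_zero[OF e2])
          thus ?thesis by (simp add: H_def)
        next
          case False
          have "(map_poly e1 (truncate_poly f), map_poly e2 (truncate_poly f)) \<in> H"
            using less.hyps[OF degree_truncate_poly clD(2)] False less.prems by simp
          thus ?thesis using map_poly_hom_truncate[OF e1 True] map_poly_hom_truncate[OF e2 t2] by simp
        qed
      qed
    qed
    have HE: "(f = 0 \<and> g = 0) \<or> (\<exists>h\<in>G. e1 (lead_coeff h) \<noteq> 0 \<and> e2 (lead_coeff h) \<noteq> 0 \<and> f = map_poly e1 h \<and> g = map_poly e2 h \<and>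
        degree f = degree h \<and> degree g = degree h)" if "(f, g) \<in> H" for f g
      using that same_sign_zero[OF lc] unfolding H_def
      by (auto simp: degree_map_poly_hom[OF e1] degree_map_poly_hom[OF e2]) 
    have "coherent H"
    proof (rule coherent_family)
      show "finite H" using G(1) by (simp add: H_def)
    next
      fix f g assume "(f, g) \<in> H"
      thus "degree f = degree g" using HE[of f g] by auto
    next
      fix f g assume "(f, g) \<in> H"
      from HE[OF this] show "same_sign (lead_coeff f) (lead_coeff g)"
      proof (elim disjE bexE conjE)
        fix h assume "h \<in> G" "f = map_poly e1 h" "g = map_poly e2 h" "degree f = degree h" "degree g = degree h"
        thus ?thesis using lc[of h] by (simp add: coeff_map_poly ring_hom_fun_zero[OF e1] ring_hom_fun_zero[OF e2])
      qed (simp add: same_sign_def)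
    next
      fix f g assume fg: "(f, g) \<in> H" "degree f > 0"
      then obtain h where "h \<in> G" "f = map_poly e1 h" "g = map_poly e2 h" "degree f = degree h" using HE[of f g] by auto
      thus "(pderiv f, pderiv g) \<in> H" using inH[OF clD(1)[of h]] fg(2)
        by (simp add: map_poly_hom_pderiv[OF e1] map_poly_hom_pderiv[OF e2])
    next
      fix f g p q assume fg: "(f, g) \<in> H" and pq: "(p, q) \<in> H" and d: "0 < degree p" "degree p \<le> degree f"
      obtain h where h: "h \<in> G" "f = map_poly e1 h" "g = map_poly e2 h" "degree f = degree h" using HE[OF fg] d by auto
      obtain m where m: "m \<in> G" "p = map_poly e1 m" "q = map_poly e2 m" "degree p = degree m"
        "e1 (lead_coeff m) \<noteq> 0" "e2 (lead_coeff m) \<noteq> 0" using HE[OF pq] d by auto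
      obtain k u where ku: "smult (lead_coeff m ^ (2 * k)) h = m * u + prem h m" using prem(1)[of m h] m d by auto
      have "degree (map_poly e1 (prem h m)) \<le> degree (prem h m)" by (rule degree_map_poly_hom_le[OF e1])
      also have "\<dots> < degree p" using prem(2)[of m h] m d by simp
      finally have dr: "degree (map_poly e1 (prem h m)) < degree p" .
      have "smult (e1 (lead_coeff m) ^ (2*k)) f = p * map_poly e1 u + map_poly e1 (prem h m)"
        using arg_cong[OF ku, of "map_poly e1"] h m
        by (simp only: map_poly_hom_smult[OF e1] map_poly_hom_add[OF e1] map_poly_hom_mult[OF e1] ring_hom_fun_power[OF e1])
      moreover have "smult (e2 (lead_coeff m) ^ (2*k)) g = q * map_poly e2 u + map_poly e2 (prem h m)"
        using arg_cong[OF ku, of "map_poly e2"] h m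
        by (simp only: map_poly_hom_smult[OF e2] map_poly_hom_add[OF e2] map_poly_hom_mult[OF e2] ring_hom_fun_power[OF e2])
      moreover have "(map_poly e1 (prem h m), map_poly e2 (prem h m)) \<in> H"
        using h m d by (intro inH clP) auto
      moreover have "e1 (lead_coeff m) ^ (2*k) > 0" "e2 (lead_coeff m) ^ (2*k) > 0"
        using m(5,6) by (simp_all add: power_mult)
      ultimately show "\<exists>c d u v r s. c > 0 \<and> d > 0 \<and> (r, s) \<in> H \<and> degree r < degree p \<and>
        smult c f = p * u + r \<and> smult d g = q * v + s" using dr by blast
    qed
    then obtain Z where Z: "finite Z \<and> (\<forall>(x, y)\<in>Z. matched Z x y) \<and>
     (\<forall>(x, y)\<in>Z. \<exists>(p, q)\<in>H. p \<noteq> 0 \<and> q \<noteq> 0 \<and> poly p x = 0) \<and>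
     (\<forall>x y. matched Z x y \<longrightarrow> (\<forall>(f, g)\<in>H. same_sign (poly f x) (poly g y)))"
      unfolding coherent_def ..
    show ?thesis
    proof
      fix y
      obtain x where "matched Z x y" using matched_exists[of Z y] Z by blast
      hence "\<forall>(f, g)\<in>H. same_sign (poly f x) (poly g y)" using Z by blast
      thus "\<exists>x. \<forall>f\<in>F. same_sign (poly (map_poly e1 f) x) (poly (map_poly e2 f) y)"
        using inH G(2) by (intro exI[of _ x]) blast
    qed
  qed
  moreover have "finite C" using G(1) by (simp add: C_def)
  ultimately show ?thesis by blast
qed

section \<open>Real closures\<close>

text \<open>The field is not fixed in advance: \<open>cone_span T\<close>, the set of differences,
  is a subfield, and the last clause puts its squares into \<open>T\<close>. Enlarging the field and
  its ordering together is then inclusion of sets, to which Zorn's lemma applies.\<close>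

definition field_cone :: "'c::field set \<Rightarrow> bool" where
  "field_cone T \<longleftrightarrow> 0 \<in> T \<and> 1 \<in> T \<and> -1 \<notin> T \<and> (\<forall>a\<in>T. \<forall>b\<in>T. a + b \<in> T) \<and> (\<forall>a\<in>T. \<forall>b\<in>T. a * b \<in> T) \<and>
     (\<forall>a\<in>T. inverse a \<in> T) \<and> (\<forall>a\<in>T. \<forall>b\<in>T. (a - b) * (a - b) \<in> T)"

definition cone_span :: "'c::field set \<Rightarrow> 'c set" where
  "cone_span T = {a - b | a b. a \<in> T \<and> b \<in> T}"

context
  fixes T :: "'c::field set"
  assumes T: "field_cone T"
begin

lemma field_cone_0: "0 \<in> T" and field_cone_1: "1 \<in> T" and field_cone_m1: "-1 \<notin> T"
  and field_cone_add: "a \<in> T \<Longrightarrow> b \<in> T \<Longrightarrow> a + b \<in> T"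
  and field_cone_mult: "a \<in> T \<Longrightarrow> b \<in> T \<Longrightarrow> a * b \<in> T"
  and field_cone_inverse: "a \<in> T \<Longrightarrow> inverse a \<in> T"
  using T by (auto simp: field_cone_def)

lemma cone_span_square: "x \<in> cone_span T \<Longrightarrow> x * x \<in> T"
  using T by (auto simp: field_cone_def cone_span_def)

lemma cone_span_I: "x \<in> T \<Longrightarrow> x \<in> cone_span T"
  unfolding cone_span_def using field_cone_0 by (intro CollectI exI[of _ x] exI[of _ 0]) simp

lemma cone_span_uminus: "x \<in> cone_span T \<Longrightarrow> - x \<in> cone_span T"
  by (auto simp: cone_span_def) (metis minus_diff_eq)

lemma cone_span_add:
  assumes "x \<in> cone_span T" "y \<in> cone_span T" shows "x + y \<in> cone_span T"
proof -
  obtain a b c d where "x = a - b" "y = c - d" "a \<in> T" "b \<in> T" "c \<in> T" "d \<in> T" using assms by (auto simp: cone_span_def)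
  thus ?thesis unfolding cone_span_def by (intro CollectI exI[of _ "a + c"] exI[of _ "b + d"]) (auto intro: field_cone_add)
qed

lemma cone_span_diff: "x \<in> cone_span T \<Longrightarrow> y \<in> cone_span T \<Longrightarrow> x - y \<in> cone_span T"
  using cone_span_add[of x "-y"] cone_span_uminus[of y] by simp

lemma cone_span_mult:
  assumes "x \<in> cone_span T" "y \<in> cone_span T" shows "x * y \<in> cone_span T"
proof -
  obtain a b c d where "x = a - b" "y = c - d" "a \<in> T" "b \<in> T" "c \<in> T" "d \<in> T" using assms by (auto simp: cone_span_def)
  thus ?thesis unfolding cone_span_def by (intro CollectI exI[of _ "a * c + b * d"] exI[of _ "a * d + b * c"])
    (auto intro!: field_cone_add field_cone_mult simp: algebra_simps)
qed

lemma cone_span_inverse: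
  assumes "x \<in> cone_span T" shows "inverse x \<in> cone_span T"
proof -
  have "inverse x = x * inverse (x * x)" by (cases "x = 0") auto
  thus ?thesis using cone_span_mult[OF assms cone_span_I[OF field_cone_inverse[OF cone_span_square[OF assms]]]] by metis
qed

lemma field_cone_antisym: "x \<in> T \<Longrightarrow> - x \<in> T \<Longrightarrow> x = 0"
  using field_cone_mult[of "-x" "inverse x"] field_cone_inverse[of x] field_cone_m1 by (cases "x = 0") auto

lemma one_plus_cone_nonzero: "x \<in> T \<Longrightarrow> 1 + x \<noteq> 0"
  using field_cone_m1 by (metis add_eq_0_iff)

end

definition maximal_cone :: "'c::field set \<Rightarrow> bool" where
  "maximal_cone M \<longleftrightarrow> field_cone M \<and> (\<forall>T. field_cone T \<longrightarrow> M \<subseteq> T \<longrightarrow> T = M)"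

lemma maximal_cone_exists:
  fixes P :: "'c::field set"
  assumes P: "field_cone P"
  shows "\<exists>M. maximal_cone M \<and> P \<subseteq> M"
proof -
  have "\<exists>M\<in>{T. field_cone T \<and> P \<subseteq> T}. \<forall>Y\<in>{T. field_cone T \<and> P \<subseteq> T}. M \<subseteq> Y \<longrightarrow> Y = M"
  proof (rule subset_Zorn_nonempty)
    show "{T. field_cone T \<and> P \<subseteq> T} \<noteq> {}" using P by blast
    fix Ch assume ne: "Ch \<noteq> {}" and ch: "subset.chain {T. field_cone T \<and> P \<subseteq> T} Ch"
    have fc: "field_cone T" "P \<subseteq> T" if "T \<in> Ch" for T using ch that by (auto simp: subset.chain_def)
    have two: "\<exists>T\<in>Ch. a \<in> T \<and> b \<in> T" if ab: "a \<in> \<Union>Ch" "b \<in> \<Union>Ch" for a b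
    proof -
      obtain A B where AB: "A \<in> Ch" "a \<in> A" "B \<in> Ch" "b \<in> B" using ab by blast
      have "A \<subseteq> B \<or> B \<subseteq> A" using ch AB by (simp add: subset_chain_def)
      thus ?thesis using AB by blast
    qed
    have U: "x \<in> \<Union>Ch" if "x \<in> T" "T \<in> Ch" for x T using that by blast
    have "field_cone (\<Union>Ch)"
      unfolding field_cone_def
    proof (intro conjI ballI)
      obtain T where T: "T \<in> Ch" using ne by blast
      show "0 \<in> \<Union>Ch" "1 \<in> \<Union>Ch" using U[OF field_cone_0[OF fc(1)[OF T]] T] U[OF field_cone_1[OF fc(1)[OF T]] T] by auto
      show "- 1 \<notin> \<Union>Ch" using fc field_cone_m1 by blast
    next
      fix a b assume "a \<in> \<Union>Ch" "b \<in> \<Union>Ch"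
      from two[OF this] obtain T where T: "T \<in> Ch" "a \<in> T" "b \<in> T" by blast
      show "a + b \<in> \<Union>Ch" using U[OF field_cone_add[OF fc(1)[OF T(1)] T(2,3)] T(1)] .
      show "a * b \<in> \<Union>Ch" using U[OF field_cone_mult[OF fc(1)[OF T(1)] T(2,3)] T(1)] .
      have "(a - b) * (a - b) \<in> T" using fc(1)[OF T(1)] T by (auto simp: field_cone_def)
      thus "(a - b) * (a - b) \<in> \<Union>Ch" using T by blast
    next
      fix a assume "a \<in> \<Union>Ch"
      then obtain T where "T \<in> Ch" "a \<in> T" by blast
      thus "inverse a \<in> \<Union>Ch" using U[OF field_cone_inverse[OF fc(1)]] by blast
    qed
    moreover have "P \<subseteq> \<Union>Ch" using ne fc(2) by blast
    ultimately show "\<Union>Ch \<in> {T. field_cone T \<and> P \<subseteq> T}" by simp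
  qed
  then obtain M where M: "M \<in> {T. field_cone T \<and> P \<subseteq> T}"
    and mx: "\<forall>Y\<in>{T. field_cone T \<and> P \<subseteq> T}. M \<subseteq> Y \<longrightarrow> Y = M" by (rule bexE)
  show ?thesis
    unfolding maximal_cone_def by (rule exI[of _ M]) (use M mx in auto)
qed

text \<open>Adjoining -x to \<open>M\<close> cannot produce -1, because x t = 1 + s would give x =
  (1 + s) / t in \<open>M\<close>. By maximality the enlarged cone is \<open>M\<close>
  itself.\<close>

lemma maximal_cone_total:
  assumes M: "maximal_cone M" and x: "x \<in> cone_span M" "x \<notin> M"
  shows "- x \<in> M"
proof -
  have fc: "field_cone M" and mx: "\<And>T. field_cone T \<Longrightarrow> M \<subseteq> T \<Longrightarrow> T = M" using M by (auto simp: maximal_cone_def)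
  note [intro] = field_cone_0[OF fc] field_cone_1[OF fc] field_cone_add[OF fc] field_cone_mult[OF fc] field_cone_inverse[OF fc]
  define T where "T = {s - x * t | s t. s \<in> M \<and> t \<in> M}"
  have TI: "s - x * t \<in> T" if "s \<in> M" "t \<in> M" for s t using that by (auto simp: T_def)
  have MT: "M \<subseteq> T" using TI[of _ 0] by auto
  have TL: "T \<subseteq> cone_span M" unfolding T_def using cone_span_diff[OF fc cone_span_I[OF fc] cone_span_mult[OF fc x(1) cone_span_I[OF fc]]] by blast
  have mult: "a * b \<in> T" if ab: "a \<in> T" "b \<in> T" for a b
  proof -
    obtain s t s' t' where h: "a = s - x * t" "b = s' - x * t'" "s \<in> M" "t \<in> M" "s' \<in> M" "t' \<in> M" using ab by (auto simp: T_def)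
    have "a * b = (s * s' + (x * x) * (t * t')) - x * (s * t' + t * s')" by (simp add: h algebra_simps)
    thus ?thesis using TI h cone_span_square[OF fc x(1)] by (metis field_cone_add[OF fc] field_cone_mult[OF fc])
  qed
  have "field_cone T"
    unfolding field_cone_def
  proof (intro conjI ballI)
    show "0 \<in> T" "1 \<in> T" using MT by auto
    show "-1 \<notin> T"
    proof
      assume "-1 \<in> T"
      then obtain s t where st: "-1 = s - x * t" "s \<in> M" "t \<in> M" by (auto simp: T_def)
      hence eq: "x * t = 1 + s" by (simp add: algebra_simps)
      have "t \<noteq> 0" using eq one_plus_cone_nonzero[OF fc st(2)] by auto
      hence "x = (1 + s) * inverse t" using eq by (simp add: field_simps)
      thus False using x(2) st by auto
    qed
  next
    fix a b assume ab: "a \<in> T" "b \<in> T"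
    then obtain s t s' t' where h: "a = s - x * t" "b = s' - x * t'" "s \<in> M" "t \<in> M" "s' \<in> M" "t' \<in> M" by (auto simp: T_def)
    have "a + b = (s + s') - x * (t + t')" by (simp add: h algebra_simps)
    moreover have "(s + s') - x * (t + t') \<in> T" using TI h by blast
    ultimately show "a + b \<in> T" by simp
    show "a * b \<in> T" using mult[OF ab] .
    show "(a - b) * (a - b) \<in> T" using cone_span_square[OF fc cone_span_diff[OF fc]] TL MT ab by blast
  next
    fix a assume a: "a \<in> T"
    have "inverse a * inverse a \<in> M" using cone_span_square[OF fc cone_span_inverse[OF fc]] TL a by blast
    hence "a * (inverse a * inverse a) \<in> T" using mult[OF a] MT by blast
    thus "inverse a \<in> T" by (cases "a = 0") (simp_all add: mult.assoc[symmetric])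
  qed
  from mx[OF this MT] have "T = M" .
  thus ?thesis using TI[of 0 1] by auto
qed

text \<open>Polynomials over the subfield \<open>cone_span M\<close> are kept as polynomials over
  the ambient field, so that they can be evaluated at elements outside the subfield.\<close>

definition cone_poly :: "'c::field set \<Rightarrow> 'c poly \<Rightarrow> bool" where
  "cone_poly M f \<longleftrightarrow> (\<forall>i. coeff f i \<in> cone_span M)"

context
  fixes M :: "'c::field set"
  assumes fc: "field_cone M"
begin

lemma cone_span_sum: "(\<And>i. i \<in> A \<Longrightarrow> g i \<in> cone_span M) \<Longrightarrow> sum g A \<in> cone_span M"
  by (induction A rule: infinite_finite_induct)
    (auto intro: cone_span_add[OF fc] cone_span_I[OF fc field_cone_0[OF fc]])

lemma cone_poly_add: "cone_poly M f \<Longrightarrow> cone_poly M g \<Longrightarrow> cone_poly M (f + g)"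
  by (auto simp: cone_poly_def intro: cone_span_add[OF fc])

lemma cone_poly_diff: "cone_poly M f \<Longrightarrow> cone_poly M g \<Longrightarrow> cone_poly M (f - g)"
  by (auto simp: cone_poly_def intro: cone_span_diff[OF fc])

lemma cone_poly_mult: "cone_poly M f \<Longrightarrow> cone_poly M g \<Longrightarrow> cone_poly M (f * g)"
  by (auto simp: cone_poly_def coeff_mult intro!: cone_span_sum cone_span_mult[OF fc])

lemma cone_poly_monom: "c \<in> cone_span M \<Longrightarrow> cone_poly M (monom c n)"
  by (auto simp: cone_poly_def intro: cone_span_I[OF fc field_cone_0[OF fc]])

lemma cone_poly_pCons: "c \<in> cone_span M \<Longrightarrow> cone_poly M p \<Longrightarrow> cone_poly M (pCons c p)"
  by (auto simp: cone_poly_def coeff_pCons split: nat.split)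

lemma cone_poly_0: "cone_poly M 0"
  by (auto simp: cone_poly_def intro: cone_span_I[OF fc field_cone_0[OF fc]])

lemma cone_poly_const: "c \<in> cone_span M \<Longrightarrow> cone_poly M [:c:]"
  by (simp add: cone_poly_pCons cone_poly_0)

lemma cone_poly_1: "cone_poly M 1"
  using cone_poly_const[OF cone_span_I[OF fc field_cone_1[OF fc]]] by (simp add: one_pCons)

lemma poly_in_cone_span: "cone_poly M f \<Longrightarrow> x \<in> cone_span M \<Longrightarrow> poly f x \<in> cone_span M"
proof (induction f)
  case 0 show ?case using cone_span_I[OF fc field_cone_0[OF fc]] by simp
next
  case (pCons c f)
  have "c \<in> cone_span M" using pCons.prems(1) by (auto simp: cone_poly_def dest: spec[of _ 0])
  moreover have "cone_poly M f" using pCons.prems(1) unfolding cone_poly_def by (metis coeff_pCons_Suc)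
  ultimately show ?case using pCons by (auto intro!: cone_span_add[OF fc] cone_span_mult[OF fc])
qed

lemma cone_poly_division:
  assumes g: "cone_poly M g" "g \<noteq> 0" and f: "cone_poly M f"
  shows "\<exists>q r. cone_poly M q \<and> cone_poly M r \<and> f = g * q + r \<and> (r = 0 \<or> degree r < degree g)"
  using f
proof (induction "degree f" arbitrary: f rule: less_induct)
  case less
  show ?case
  proof (cases "f = 0 \<or> degree f < degree g")
    case True
    thus ?thesis using less.prems cone_poly_0 by (intro exI[of _ 0] exI[of _ f]) auto
  next
    case False
    define m where "m = monom (lead_coeff f * inverse (lead_coeff g)) (degree f - degree g)"
    have m: "cone_poly M m" unfolding m_def
      using less.prems g(1) by (intro cone_poly_monom cone_span_mult[OF fc] cone_span_inverse[OF fc]) (auto simp: cone_poly_def)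
    define f1 where "f1 = f - g * m"
    have f1: "cone_poly M f1" unfolding f1_def using less.prems m g by (intro cone_poly_diff cone_poly_mult)
    show ?thesis
    proof (cases "degree f = 0")
      case True
      hence "degree g = 0" using False by simp
      then obtain a b where "f = [:a:]" "g = [:b:]" using True by (metis degree_eq_zeroE)
      hence "f = g * m" using g(2) by (simp add: m_def monom_0)
      thus ?thesis using m cone_poly_0 by (intro exI[of _ m] exI[of _ 0]) auto
    next
      case d: False
      have "degree (g * m) \<le> degree f"
        using degree_mult_le[of g m] degree_monom_le[of "lead_coeff f * inverse (lead_coeff g)" "degree f - degree g"] False unfolding m_def by linarith
      hence "degree f1 \<le> degree f" unfolding f1_def by (intro degree_diff_le) auto
      moreover have "coeff f1 (degree f) = 0"
        using False g(2) by (simp add: f1_def m_def coeff_monom_mult mult.commute[of g])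
      ultimately have "degree f1 < degree f" using d by (metis degree_0 leading_coeff_0_iff le_neq_implies_less)
      from less.hyps[OF this f1] obtain q r where h: "cone_poly M q" "cone_poly M r" "f1 = g * q + r" "r = 0 \<or> degree r < degree g" by blast
      have "f = g * (q + m) + r" using h(3) by (simp add: f1_def algebra_simps)
      thus ?thesis using h m cone_poly_add by (intro exI[of _ "q + m"] exI[of _ r]) auto
    qed
  qed
qed

end

definition cone_negative :: "'c::field set \<Rightarrow> 'c \<Rightarrow> bool" where
  "cone_negative M x \<longleftrightarrow> - x \<in> M \<and> x \<noteq> 0"

lemma cone_negative_mult:
  assumes M: "maximal_cone M" and xy: "x \<in> cone_span M" "y \<in> cone_span M" and neg: "cone_negative M (x * y)"
  shows "cone_negative M x \<or> cone_negative M y"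
proof (rule ccontr)
  have fc: "field_cone M" using M by (auto simp: maximal_cone_def)
  assume n: "\<not> ?thesis"
  have "x \<noteq> 0" "y \<noteq> 0" using neg by (auto simp: cone_negative_def)
  hence "x \<in> M" "y \<in> M" using n maximal_cone_total[OF M] xy by (auto simp: cone_negative_def)
  hence "x * y \<in> M" by (rule field_cone_mult[OF fc])
  thus False using neg field_cone_antisym[OF fc, of "x * y"] by (auto simp: cone_negative_def)
qed

text \<open>Artin--Schreier: a polynomial of minimal degree that changes sign without having a root generates
  an extension to which the order extends, since a representation of -1 as a weighted sum of squares
  modulo it would yield a cofactor of smaller degree that changes sign.\<close>

lemma maximal_cone_root:
  fixes M :: "'c::alg_closed_field set"
  assumes M: "maximal_cone M"
  shows "cone_poly M f \<Longrightarrow> a \<in> cone_span M \<Longrightarrow> b \<in> cone_span M \<Longrightarrow> cone_negative M (poly f a * poly f b) \<Longrightarrow>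
    \<exists>r\<in>cone_span M. poly f r = 0"
proof (induction "degree f" arbitrary: f rule: less_induct)
  case less
  have fc: "field_cone M" and mx: "\<And>T. field_cone T \<Longrightarrow> M \<subseteq> T \<Longrightarrow> T = M" using M by (auto simp: maximal_cone_def)
  note f = less.prems(1) and a = less.prems(2) and b = less.prems(3) and neg = less.prems(4)
  have f0: "f \<noteq> 0" using neg by (auto simp: cone_negative_def)
  have deg: "degree f > 0"
  proof (rule ccontr)
    assume "\<not> degree f > 0"
    then obtain c where c: "f = [:c:]" by (auto elim: degree_eq_zeroE)
    hence "c \<in> cone_span M" using f by (auto simp: cone_poly_def dest: spec[of _ 0])
    hence "c * c \<in> M" by (rule cone_span_square[OF fc])
    thus False using neg c field_cone_antisym[OF fc, of "c * c"] by (auto simp: cone_negative_def)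
  qed
  obtain \<alpha> where al: "poly f \<alpha> = 0" using alg_closed_imp_poly_has_root[OF deg] by blast
  show ?case
  \<comment> \<open>If \<alpha> is a root of a nonzero polynomial of smaller degree, the least such
    one divides \<open>f\<close>; both factors have smaller degree than \<open>f\<close>, and one of
    them changes sign.\<close>
  proof (cases "\<exists>g. cone_poly M g \<and> g \<noteq> 0 \<and> poly g \<alpha> = 0 \<and> degree g < degree f")
    case True
    define P where "P g \<longleftrightarrow> cone_poly M g \<and> g \<noteq> 0 \<and> poly g \<alpha> = 0" for g
    obtain g where g: "P g" and gmin: "\<And>h. P h \<Longrightarrow> degree g \<le> degree h"
      using ex_has_least_nat[of P _ degree] True unfolding P_def by blast
    have gdeg: "degree g < degree f" using True gmin unfolding P_def by (meson le_less_trans)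
    have g': "cone_poly M g" "g \<noteq> 0" "poly g \<alpha> = 0" using g by (auto simp: P_def)
    obtain q r where h: "cone_poly M q" "cone_poly M r" "f = g * q + r" "r = 0 \<or> degree r < degree g"
      using cone_poly_division[OF fc g'(1,2) f] by blast
    have "poly r \<alpha> = 0" using h(3) al g'(3) by simp
    hence "r = 0" using h(2,4) gmin[of r] by (force simp: P_def)
    hence fgq: "f = g * q" using h(3) by simp
    have "degree g > 0" using g' by (auto intro!: gr0I elim!: degree_eq_zeroE)
    hence qdeg: "degree q < degree f" using fgq f0 by (auto simp: degree_mult_eq)
    have "cone_negative M ((poly g a * poly g b) * (poly q a * poly q b))" using neg fgq by (simp add: ac_simps)
    hence "cone_negative M (poly g a * poly g b) \<or> cone_negative M (poly q a * poly q b)"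
      by (intro cone_negative_mult[OF M] cone_span_mult[OF fc] poly_in_cone_span[OF fc] a b g' h)
    hence "\<exists>r\<in>cone_span M. poly g r = 0 \<or> poly q r = 0"
      using less.hyps[OF gdeg g'(1) a b] less.hyps[OF qdeg h(1) a b] by blast
    thus ?thesis using fgq by auto
  next
    case False
    hence fmin: "g = 0" if "cone_poly M g" "poly g \<alpha> = 0" "degree g < degree f" for g using that by blast
    have reduce: "\<exists>k. cone_poly M k \<and> poly k \<alpha> = poly h \<alpha> \<and> degree k < degree f" if h: "cone_poly M h" for h
    proof -
      obtain q r where "cone_poly M q" "cone_poly M r" "h = f * q + r" "r = 0 \<or> degree r < degree f"
        using cone_poly_division[OF fc f f0 h] by blast
      thus ?thesis using al deg by (intro exI[of _ r]) auto
    qed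
    \<comment> \<open>Euclid's algorithm: f = h q + r gives r(\<alpha>) = -h(\<alpha>) q(\<alpha>),
      so an inverse for the remainder yields one for \<open>h\<close>.\<close>
    have inv0: "\<exists>k. cone_poly M k \<and> poly h \<alpha> * poly k \<alpha> = 1" if "cone_poly M h" "poly h \<alpha> \<noteq> 0" "degree h < degree f" for h
      using that
    proof (induction "degree h" arbitrary: h rule: less_induct)
      case (less h)
      have h0: "h \<noteq> 0" using less.prems by auto
      show ?case
      proof (cases "degree h = 0")
        case True
        then obtain c where c: "h = [:c:]" by (rule degree_eq_zeroE)
        hence "c \<in> cone_span M" using less.prems(1) by (auto simp: cone_poly_def dest: spec[of _ 0])
        thus ?thesis using c h0 by (intro exI[of _ "[:inverse c:]"]) (auto intro!: cone_poly_const[OF fc] cone_span_inverse[OF fc])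
      next
        case False
        obtain q r where qr: "cone_poly M q" "cone_poly M r" "f = h * q + r" "r = 0 \<or> degree r < degree h"
          using cone_poly_division[OF fc less.prems(1) h0 f] by blast
        have rd: "degree r < degree h" using qr(4) False by auto
        have ra: "poly r \<alpha> = - (poly h \<alpha> * poly q \<alpha>)" using qr(3) al by (auto simp: add_eq_0_iff)
        have "poly r \<alpha> \<noteq> 0"
        proof
          assume r0: "poly r \<alpha> = 0"
          hence "r = 0" using fmin qr(2) rd less.prems(3) by auto
          hence fq: "f = h * q" using qr(3) by simp
          have "poly q \<alpha> = 0" using r0 ra less.prems(2) by auto
          moreover have "degree q < degree f" using fq f0 False by (auto simp: degree_mult_eq)
          ultimately have "q = 0" using fmin qr(1) by blast
          thus False using fq f0 by simp
        qed
        from less.hyps[OF rd qr(2) this] rd less.prems(3) obtain k where k: "cone_poly M k" "poly r \<alpha> * poly k \<alpha> = 1" by auto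
        have "poly h \<alpha> * poly (- (q * k)) \<alpha> = 1" using k(2) ra by (simp add: ac_simps)
        moreover have "cone_poly M (- (q * k))" using cone_poly_diff[OF fc cone_poly_0[OF fc] cone_poly_mult[OF fc qr(1) k(1)]] by simp
        ultimately show ?thesis by blast
      qed
    qed
    have inv: "\<exists>k. cone_poly M k \<and> inverse (poly h \<alpha>) = poly k \<alpha>" if h: "cone_poly M h" for h
    proof (cases "poly h \<alpha> = 0")
      case True thus ?thesis using cone_poly_0[OF fc] by (intro exI[of _ 0]) auto
    next
      case False
      obtain h' where h': "cone_poly M h'" "poly h' \<alpha> = poly h \<alpha>" "degree h' < degree f" using reduce[OF h] by blast
      obtain k where "cone_poly M k" "poly h' \<alpha> * poly k \<alpha> = 1" using inv0[OF h'(1) _ h'(3)] False h'(2) by auto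
      thus ?thesis using h' False by (intro exI[of _ k]) (auto intro: inverse_unique)
    qed
    \<comment> \<open>The cone generated by \<open>M\<close> in the field obtained by adjoining
      \<alpha>: sums of squares with weights in \<open>M\<close>.\<close>
    define S where "S = {sum_list (map (\<lambda>(t, h). t * (poly h \<alpha> * poly h \<alpha>)) ps) | ps. \<forall>(t, h)\<in>set ps. t \<in> M \<and> cone_poly M h}"
    have S1: "t * (poly h \<alpha> * poly h \<alpha>) \<in> S" if "t \<in> M" "cone_poly M h" for t h
      unfolding S_def using that by (intro CollectI exI[of _ "[(t, h)]"]) auto
    have Sadd: "x + y \<in> S" if "x \<in> S" "y \<in> S" for x y
    proof -
      from that obtain ps qs where "x = sum_list (map (\<lambda>(t, h). t * (poly h \<alpha> * poly h \<alpha>)) ps)" "\<forall>(t, h)\<in>set ps. t \<in> M \<and> cone_poly M h"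
        "y = sum_list (map (\<lambda>(t, h). t * (poly h \<alpha> * poly h \<alpha>)) qs)" "\<forall>(t, h)\<in>set qs. t \<in> M \<and> cone_poly M h" unfolding S_def by blast
      thus ?thesis unfolding S_def by (intro CollectI exI[of _ "ps @ qs"]) auto
    qed
    have S0: "0 \<in> S" unfolding S_def by (intro CollectI exI[of _ "[]"]) auto
    have Sind: "Q x" if x: "x \<in> S" and Q0: "Q 0" and Qs: "\<And>t h y. t \<in> M \<Longrightarrow> cone_poly M h \<Longrightarrow> y \<in> S \<Longrightarrow> Q y \<Longrightarrow> Q (t * (poly h \<alpha> * poly h \<alpha>) + y)" for Q x
    proof -
      obtain ps where ps: "x = sum_list (map (\<lambda>(t, h). t * (poly h \<alpha> * poly h \<alpha>)) ps)" "\<forall>(t, h)\<in>set ps. t \<in> M \<and> cone_poly M h"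
        using x unfolding S_def by blast
      have "Q (sum_list (map (\<lambda>(t, h). t * (poly h \<alpha> * poly h \<alpha>)) ps))" using ps(2)
      proof (induction ps)
        case (Cons p ps)
        have "sum_list (map (\<lambda>(t, h). t * (poly h \<alpha> * poly h \<alpha>)) ps) \<in> S" using Cons.prems unfolding S_def by (intro CollectI exI[of _ ps]) auto
        thus ?case using Cons Qs by (cases p) auto
      qed (simp add: Q0)
      thus ?thesis using ps by simp
    qed
    have Smult1: "(t * (poly h \<alpha> * poly h \<alpha>)) * y \<in> S" if "t \<in> M" "cone_poly M h" "y \<in> S" for t h y
      using that(3)
    proof (rule Sind)
      show "t * (poly h \<alpha> * poly h \<alpha>) * 0 \<in> S" using S0 by simp
      fix t' h' y assume "t' \<in> M" "cone_poly M h'" "y \<in> S" "t * (poly h \<alpha> * poly h \<alpha>) * y \<in> S"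
      moreover have "(t * t') * (poly (h * h') \<alpha> * poly (h * h') \<alpha>) \<in> S"
        by (rule S1) (use that \<open>t' \<in> M\<close> \<open>cone_poly M h'\<close> in \<open>auto intro: field_cone_mult[OF fc] cone_poly_mult[OF fc]\<close>)
      ultimately have "(t * t') * (poly (h * h') \<alpha> * poly (h * h') \<alpha>) + t * (poly h \<alpha> * poly h \<alpha>) * y \<in> S" by (intro Sadd)
      also have "(t * t') * (poly (h * h') \<alpha> * poly (h * h') \<alpha>) + t * (poly h \<alpha> * poly h \<alpha>) * y =
         t * (poly h \<alpha> * poly h \<alpha>) * (t' * (poly h' \<alpha> * poly h' \<alpha>) + y)" by (simp add: algebra_simps)
      finally show "t * (poly h \<alpha> * poly h \<alpha>) * (t' * (poly h' \<alpha> * poly h' \<alpha>) + y) \<in> S" .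
    qed
    have Smult: "x * y \<in> S" if x: "x \<in> S" and y: "y \<in> S" for x y
      using x
    proof (rule Sind)
      fix t h z assume "t \<in> M" "cone_poly M h" "z \<in> S" "z * y \<in> S"
      thus "(t * (poly h \<alpha> * poly h \<alpha>) + z) * y \<in> S" using Sadd[OF Smult1[of t h y] \<open>z * y \<in> S\<close>] y by (simp add: distrib_right)
    qed (use S0 in simp)
    \<comment> \<open>Each element of \<open>S\<close> is the value at \<alpha> of a polynomial that
      is nonnegative on the whole subfield. The degree bound comes from reducing \<open>h\<close>
      modulo \<open>f\<close>; it forces the cofactor q in 1 + F = f q to have smaller degree than
      \<open>f\<close>.\<close>
    have Spoly: "\<exists>F. cone_poly M F \<and> poly F \<alpha> = x \<and> degree F \<le> 2 * (degree f - 1) \<and> (\<forall>y\<in>cone_span M. poly F y \<in> M)" if "x \<in> S" for x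
      using that
    proof (rule Sind)
      show "\<exists>F. cone_poly M F \<and> poly F \<alpha> = 0 \<and> degree F \<le> 2 * (degree f - 1) \<and> (\<forall>y\<in>cone_span M. poly F y \<in> M)"
        by (rule exI[of _ 0]) (auto intro: cone_poly_0[OF fc] field_cone_0[OF fc])
      fix t h x assume t: "t \<in> M" "cone_poly M h" and "\<exists>F. cone_poly M F \<and> poly F \<alpha> = x \<and> degree F \<le> 2 * (degree f - 1) \<and> (\<forall>y\<in>cone_span M. poly F y \<in> M)"
      then obtain F where F: "cone_poly M F" "poly F \<alpha> = x" "degree F \<le> 2 * (degree f - 1)" "\<forall>y\<in>cone_span M. poly F y \<in> M" by blast
      obtain k where k: "cone_poly M k" "poly k \<alpha> = poly h \<alpha>" "degree k < degree f" using reduce[OF t(2)] by blast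
      have "degree ([:t:] * (k * k)) \<le> 2 * (degree f - 1)"
        using degree_mult_le[of "[:t:]" "k * k"] degree_mult_le[of k k] k(3) by simp
      moreover have "cone_poly M ([:t:] * (k * k))" by (intro cone_poly_mult[OF fc] cone_poly_const[OF fc] cone_span_I[OF fc] t k)
      moreover have "poly ([:t:] * (k * k)) y \<in> M" if "y \<in> cone_span M" for y
        using field_cone_mult[OF fc t(1) cone_span_square[OF fc poly_in_cone_span[OF fc k(1) that]]] by simp
      ultimately show "\<exists>F. cone_poly M F \<and> poly F \<alpha> = t * (poly h \<alpha> * poly h \<alpha>) + x \<and> degree F \<le> 2 * (degree f - 1) \<and> (\<forall>y\<in>cone_span M. poly F y \<in> M)"
        using F k(2) by (intro exI[of _ "[:t:] * (k * k) + F"])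
          (auto intro: cone_poly_add[OF fc] degree_add_le field_cone_add[OF fc])
    qed
    have m1: "-1 \<notin> S"
    proof
      assume "-1 \<in> S"
      from Spoly[OF this] obtain F where F: "cone_poly M F" "poly F \<alpha> = -1" "degree F \<le> 2 * (degree f - 1)" "\<forall>y\<in>cone_span M. poly F y \<in> M" by blast
      define G where "G = 1 + F"
      have G: "cone_poly M G" "poly G \<alpha> = 0" using F cone_poly_add[OF fc cone_poly_1[OF fc]] by (auto simp: G_def)
      obtain q r where qr: "cone_poly M q" "cone_poly M r" "G = f * q + r" "r = 0 \<or> degree r < degree f"
        using cone_poly_division[OF fc f f0 G(1)] by blast
      have "poly r \<alpha> = 0" using qr(3) G(2) al by simp
      hence "r = 0" using qr(2,4) fmin[of r] by auto
      hence Gfq: "G = f * q" using qr(3) by simp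
      have pos: "poly G y \<in> M \<and> poly G y \<noteq> 0" if "y \<in> cone_span M" for y
        using F(4) that one_plus_cone_nonzero[OF fc, of "poly F y"] field_cone_add[OF fc field_cone_1[OF fc]] by (auto simp: G_def)
      have q0: "q \<noteq> 0" using pos[OF a] Gfq by auto
      have "degree f + degree q = degree G" using Gfq f0 q0 by (simp add: degree_mult_eq)
      also have "degree G \<le> 2 * (degree f - 1)" unfolding G_def using F(3) by (intro degree_add_le) auto
      finally have qd: "degree q < degree f" using deg by linarith
      define u v where "u = poly f a * poly f b" and "v = poly q a * poly q b"
      have uv: "u * v \<in> M" "u * v \<noteq> 0" using field_cone_mult[OF fc] pos[OF a] pos[OF b] Gfq
        by (auto simp: u_def v_def) (metis mult.assoc mult.left_commute)
      have vL: "v \<in> cone_span M" unfolding v_def by (intro cone_span_mult[OF fc] poly_in_cone_span[OF fc] qr a b)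
      have "v \<notin> M"
      proof
        assume "v \<in> M"
        moreover have "- u \<in> M" using neg by (simp add: cone_negative_def u_def)
        ultimately have "(-u) * v \<in> M" using field_cone_mult[OF fc] by blast
        thus False using uv field_cone_antisym[OF fc, of "u * v"] by simp
      qed
      hence "cone_negative M v" using maximal_cone_total[OF M vL] uv by (auto simp: cone_negative_def)
      then obtain r where "r \<in> cone_span M" "poly q r = 0" using less.hyps[OF qd qr(1) a b] by (auto simp: v_def)
      thus False using pos[of r] Gfq by simp
    qed
    have SL: "\<exists>F. cone_poly M F \<and> x = poly F \<alpha>" if "x \<in> S" for x using Spoly[OF that] by blast
    have MS: "M \<subseteq> S" using S1[of _ 1] cone_poly_1[OF fc] by auto
    have "field_cone S" unfolding field_cone_def
    proof (intro conjI ballI)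
      show "1 \<in> S" using MS field_cone_1[OF fc] by auto
      fix x assume x: "x \<in> S"
      obtain k where k: "cone_poly M k" "inverse x = poly k \<alpha>" using SL[OF x] inv by metis
      have "x * (1 * (poly k \<alpha> * poly k \<alpha>)) \<in> S" using Smult[OF x S1[OF field_cone_1[OF fc] k(1)]] .
      thus "inverse x \<in> S" using k(2)[symmetric] by (cases "x = 0") (simp_all add: mult.assoc[symmetric])
      fix y assume y: "y \<in> S"
      obtain F G where "cone_poly M F" "x = poly F \<alpha>" "cone_poly M G" "y = poly G \<alpha>" using SL[OF x] SL[OF y] by blast
      thus "(x - y) * (x - y) \<in> S" using S1[OF field_cone_1[OF fc] cone_poly_diff[OF fc, of F G]] by simp
    qed (use S0 m1 Sadd Smult in auto)
    hence SM: "S = M" using mx MS by blast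
    have Xc: "cone_poly M [:c, 1:]" if "c \<in> cone_span M" for c
      by (rule cone_poly_pCons[OF fc that cone_poly_const[OF fc cone_span_I[OF fc field_cone_1[OF fc]]]])
    have one: "1 \<in> cone_span M" "-1 \<in> cone_span M" using cone_span_I[OF fc field_cone_1[OF fc]] cone_span_uminus[OF fc] by auto
    \<comment> \<open>Since \<open>S\<close> equals \<open>M\<close>, the element \<alpha> belongs
      to the subfield already: 4 \<alpha> is a difference of two squares from
      \<open>S\<close>.\<close>
    have "1 * ((1 + \<alpha>) * (1 + \<alpha>)) \<in> S" "1 * ((-1 + \<alpha>) * (-1 + \<alpha>)) \<in> S"
      using S1[OF field_cone_1[OF fc] Xc[OF one(1)]] S1[OF field_cone_1[OF fc] Xc[OF one(2)]] by simp_all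
    hence "(1 + \<alpha>) * (1 + \<alpha>) - (-1 + \<alpha>) * (-1 + \<alpha>) \<in> cone_span M" unfolding SM by (auto simp: cone_span_def)
    also have "(1 + \<alpha>) * (1 + \<alpha>) - (-1 + \<alpha>) * (-1 + \<alpha>) = (1 + 1 + 1 + 1) * \<alpha>" by (simp add: algebra_simps)
    finally have 4: "(1 + 1 + 1 + 1) * \<alpha> \<in> cone_span M" .
    have "1 + 1 + 1 \<in> M" using field_cone_1[OF fc] field_cone_add[OF fc] by blast
    hence n4: "1 + (1 + 1 + 1) \<noteq> (0::'c)" "1 + (1 + 1 + 1) \<in> M" using one_plus_cone_nonzero[OF fc] field_cone_add[OF fc field_cone_1[OF fc]] by blast+
    have "inverse (1 + (1 + 1 + 1)) * ((1 + 1 + 1 + 1) * \<alpha>) \<in> cone_span M"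
      using cone_span_mult[OF fc cone_span_I[OF fc field_cone_inverse[OF fc n4(2)]] 4] .
    moreover have "inverse (1 + (1 + 1 + 1)) * ((1 + 1 + 1 + 1) * \<alpha>) = \<alpha>" using n4(1) by (simp add: add.assoc[symmetric] mult.assoc[symmetric] del: one_add_one)
    ultimately show ?thesis using al by auto
  qed
qed


section \<open>The real closure of an ordered field as a type\<close>

definition base_cone :: "'k::linordered_field alg_closure set" where
  "base_cone = to_ac ` {x. x \<ge> 0}"

lemma field_cone_base: "field_cone (base_cone :: 'k::linordered_field alg_closure set)"
  unfolding field_cone_def
proof (intro conjI ballI)
  show "0 \<in> (base_cone :: 'k alg_closure set)" "1 \<in> (base_cone :: 'k alg_closure set)"
    using to_ac_0[where ?'a = 'k] to_ac_1[where ?'a = 'k] unfolding base_cone_def by (metis imageI mem_Collect_eq order_refl zero_le_one)+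
  show "-1 \<notin> (base_cone :: 'k alg_closure set)"
  proof
    assume "-1 \<in> (base_cone :: 'k alg_closure set)"
    then obtain x :: 'k where "to_ac x = -1" "x \<ge> 0" by (auto simp: base_cone_def)
    hence "to_ac (x + 1) = to_ac 0" by simp
    hence "x + 1 = 0" by (simp only: to_ac_eq_iff)
    thus False using \<open>x \<ge> 0\<close> by (simp add: add_eq_0_iff)
  qed
next
  fix a b :: "'k alg_closure" assume "a \<in> base_cone" "b \<in> base_cone"
  then obtain x y where xy: "a = to_ac x" "b = to_ac y" "x \<ge> 0" "y \<ge> 0" by (auto simp: base_cone_def)
  have I: "z \<ge> 0 \<Longrightarrow> to_ac z \<in> base_cone" for z :: 'k by (auto simp: base_cone_def)
  show "a + b \<in> base_cone" "a * b \<in> base_cone" "(a - b) * (a - b) \<in> base_cone"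
    using I[of "x + y"] I[of "x * y"] I[of "(x - y) * (x - y)"] xy by simp_all
next
  fix a :: "'k alg_closure" assume "a \<in> base_cone"
  then obtain x where "a = to_ac x" "x \<ge> 0" by (auto simp: base_cone_def)
  thus "inverse a \<in> base_cone" unfolding base_cone_def by (intro image_eqI[of _ _ "inverse x"]) auto
qed

definition rc_cone :: "'k::linordered_field alg_closure set" where
  "rc_cone = (SOME M. maximal_cone M \<and> base_cone \<subseteq> M)"

lemma maximal_rc_cone: "maximal_cone rc_cone" and base_subset_rc_cone: "base_cone \<subseteq> rc_cone"
  unfolding rc_cone_def using someI_ex[OF maximal_cone_exists[OF field_cone_base]] by blast+

lemma field_cone_rc: "field_cone rc_cone"
  using maximal_rc_cone by (auto simp: maximal_cone_def)

typedef (overloaded) 'k::linordered_field real_closure = "cone_span (rc_cone :: 'k alg_closure set)"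
  using cone_span_I[OF field_cone_rc field_cone_0[OF field_cone_rc]] by blast

setup_lifting type_definition_real_closure

instantiation real_closure :: (linordered_field) field
begin
lift_definition zero_real_closure :: "'a real_closure" is 0 by (rule cone_span_I[OF field_cone_rc field_cone_0[OF field_cone_rc]])
lift_definition one_real_closure :: "'a real_closure" is 1 by (rule cone_span_I[OF field_cone_rc field_cone_1[OF field_cone_rc]])
lift_definition plus_real_closure :: "'a real_closure \<Rightarrow> 'a real_closure \<Rightarrow> 'a real_closure" is "(+)" by (rule cone_span_add[OF field_cone_rc])
lift_definition minus_real_closure :: "'a real_closure \<Rightarrow> 'a real_closure \<Rightarrow> 'a real_closure" is "(-)" by (rule cone_span_diff[OF field_cone_rc])
lift_definition times_real_closure :: "'a real_closure \<Rightarrow> 'a real_closure \<Rightarrow> 'a real_closure" is "(*)" by (rule cone_span_mult[OF field_cone_rc])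
lift_definition uminus_real_closure :: "'a real_closure \<Rightarrow> 'a real_closure" is "uminus" by (rule cone_span_uminus[OF field_cone_rc])
lift_definition inverse_real_closure :: "'a real_closure \<Rightarrow> 'a real_closure" is "inverse" by (rule cone_span_inverse[OF field_cone_rc])
definition divide_real_closure :: "'a real_closure \<Rightarrow> 'a real_closure \<Rightarrow> 'a real_closure" where "divide_real_closure x y = x * inverse y"
instance by standard (transfer; simp add: algebra_simps divide_real_closure_def; fail | simp add: divide_real_closure_def)+
end

instantiation real_closure :: (linordered_field) linordered_field
begin
lift_definition less_eq_real_closure :: "'a real_closure \<Rightarrow> 'a real_closure \<Rightarrow> bool" is "\<lambda>x y. y - x \<in> rc_cone" .
definition less_real_closure :: "'a real_closure \<Rightarrow> 'a real_closure \<Rightarrow> bool" where "less_real_closure x y \<longleftrightarrow> x \<le> y \<and> \<not> y \<le> x"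
definition abs_real_closure :: "'a real_closure \<Rightarrow> 'a real_closure" where "abs_real_closure x = (if x < 0 then - x else x)"
definition sgn_real_closure :: "'a real_closure \<Rightarrow> 'a real_closure" where "sgn_real_closure x = (if x = 0 then 0 else if 0 < x then 1 else - 1)"
instance
proof
  fix x y z :: "'a real_closure"
  note fc = field_cone_rc[where ?'a = 'a]
  show "x < y \<longleftrightarrow> x \<le> y \<and> \<not> y \<le> x" by (simp add: less_real_closure_def)
  show "x \<le> x" by transfer (simp add: field_cone_0[OF fc])
  show "x \<le> z" if "x \<le> y" "y \<le> z"
    using that by transfer (use field_cone_add[OF fc] in fastforce)
  show anti: "x = y" if "x \<le> y" "y \<le> x" for x y :: "'a real_closure"
    using that by transfer (metis field_cone_antisym[OF fc] minus_diff_eq eq_iff_diff_eq_0)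
  show "x \<le> y \<or> y \<le> x"
    by transfer (metis cone_span_diff[OF fc] maximal_cone_total[OF maximal_rc_cone] minus_diff_eq)
  show addm: "x \<le> y \<Longrightarrow> z + x \<le> z + y" by transfer simp
  have multnn: "0 \<le> x * y" if "0 \<le> x" "0 \<le> y" for x y :: "'a real_closure"
    using that by transfer (simp add: field_cone_mult[OF fc])
  show "z * x < z * y" if "x < y" "0 < z"
  proof -
    have d: "0 \<le> y - x" "0 \<le> z" using that by (simp_all add: less_real_closure_def) (transfer, simp)+
    from multnn[OF d(2) d(1)] have "z * x \<le> z * y" by (transfer, simp add: algebra_simps)
    moreover have "z * x \<noteq> z * y" using that by (auto simp: less_real_closure_def)
    ultimately show ?thesis using anti[of "z * x" "z * y"] unfolding less_real_closure_def by blast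
  qed
  show "\<bar>x\<bar> = (if x < 0 then - x else x)" by (simp add: abs_real_closure_def)
  show "sgn x = (if x = 0 then 0 else if 0 < x then 1 else - 1)" by (simp add: sgn_real_closure_def)
qed
end

text \<open>A root r outside the interval can be divided out: (a - r) (b - r) is positive, so the
  quotient still changes sign, and induction on the degree applies.\<close>

lemma sign_change_root_between:
  fixes f :: "'a::linordered_field poly"
  assumes root: "\<And>(f::'a poly) a b. a < b \<Longrightarrow> poly f a * poly f b < 0 \<Longrightarrow> \<exists>x. poly f x = 0"
  shows "a < b \<Longrightarrow> poly f a * poly f b < 0 \<Longrightarrow> \<exists>x>a. x < b \<and> poly f x = 0"
proof (induction "degree f" arbitrary: f rule: less_induct)
  case less
  obtain r where r: "poly f r = 0" using root[OF less.prems] by blast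
  show ?case
  proof (cases "a < r \<and> r < b")
    case True with r show ?thesis by blast
  next
    case False
    obtain q where q: "f = [:-r, 1:] * q" using r by (auto simp: poly_eq_0_iff_dvd)
    have f0: "f \<noteq> 0" using less.prems(2) by auto
    hence "degree q < degree f" using q by (auto simp: degree_mult_eq simp del: mult_pCons_left)
    have ne: "r \<noteq> a" "r \<noteq> b" using less.prems(2) r by auto
    have "(a - r) * (b - r) > 0" using False ne less.prems(1) by (auto simp: zero_less_mult_iff)
    moreover have "((a - r) * (b - r)) * (poly q a * poly q b) < 0" using less.prems(2) q by (simp add: algebra_simps)
    ultimately have "poly q a * poly q b < 0" by (metis mult_less_0_iff less_asym)
    from less.hyps[OF \<open>degree q < degree f\<close> less.prems(1) this] show ?thesis using q by auto
  qed
qed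

lemma Rep_real_closure_poly:
  fixes f :: "'a::linordered_field real_closure poly"
  shows "Rep_real_closure (poly f x) = poly (map_poly Rep_real_closure f) (Rep_real_closure x)"
proof (induction f)
  case 0 show ?case by (simp add: zero_real_closure.rep_eq)
next
  case (pCons c f)
  thus ?case by (simp add: map_poly_pCons zero_real_closure.rep_eq plus_real_closure.rep_eq times_real_closure.rep_eq)
qed

lemma real_closure_sign_change_root:
  fixes f :: "'a::linordered_field real_closure poly"
  assumes "poly f a * poly f b < 0"
  shows "\<exists>x. poly f x = 0"
proof -
  define F where "F = map_poly Rep_real_closure f"
  have cp: "cone_poly rc_cone F"
    using Rep_real_closure by (auto simp: F_def cone_poly_def coeff_map_poly zero_real_closure.rep_eq)
  have "poly f a * poly f b \<noteq> 0" using assms by auto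
  hence "cone_negative rc_cone (poly F (Rep_real_closure a) * poly F (Rep_real_closure b))"
    using assms unfolding cone_negative_def F_def Rep_real_closure_poly[symmetric] times_real_closure.rep_eq[symmetric]
    by (metis less_imp_le less_eq_real_closure.rep_eq diff_0 Rep_real_closure_inject zero_real_closure.rep_eq)
  from maximal_cone_root[OF maximal_rc_cone cp Rep_real_closure Rep_real_closure this]
  obtain r where r: "r \<in> cone_span rc_cone" "poly F r = 0" by blast
  then obtain x where "r = Rep_real_closure x" by (metis Rep_real_closure_cases)
  with r have "Rep_real_closure (poly f x) = Rep_real_closure 0" by (simp add: Rep_real_closure_poly F_def zero_real_closure.rep_eq)
  thus ?thesis by (auto simp: Rep_real_closure_inject)
qed

instance real_closure :: (linordered_field) real_closed
proof
  fix a b :: "'a real_closure" and f :: "nat \<Rightarrow> 'a real_closure" and n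
  define F where "F = (\<Sum>k\<le>n. monom (f k) k)"
  have F: "poly F x = (\<Sum>k\<le>n. f k * x ^ k)" for x by (simp add: F_def poly_sum poly_monom)
  assume "a < b" "(\<Sum>k\<le>n. f k * a ^ k) < 0" "(\<Sum>k\<le>n. f k * b ^ k) > 0"
  hence "poly F a * poly F b < 0" unfolding F by (rule_tac mult_neg_pos)
  from sign_change_root_between[OF real_closure_sign_change_root \<open>a < b\<close> this]
  show "\<exists>x>a. x < b \<and> (\<Sum>k\<le>n. f k * x ^ k) = 0" unfolding F .
qed

lift_definition to_rc :: "'a::linordered_field \<Rightarrow> 'a real_closure" is to_ac
proof -
  fix x :: 'a
  have "to_ac y \<in> cone_span rc_cone" if "y \<ge> 0" for y :: 'a
    using that base_subset_rc_cone by (intro cone_span_I[OF field_cone_rc]) (auto simp: base_cone_def)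
  from this[of x] this[of "-x"] show "to_ac x \<in> cone_span rc_cone"
    using cone_span_uminus[OF field_cone_rc, of "to_ac (-x)"] by (cases "x \<ge> 0") auto
qed

lemma to_rc_hom: "ring_hom_fun to_rc"
  unfolding ring_hom_fun_def by (intro conjI allI; transfer; simp)

lemma to_rc_nonneg: "0 \<le> x \<Longrightarrow> 0 \<le> to_rc x"
  by transfer (use base_subset_rc_cone in \<open>auto simp: base_cone_def\<close>)

section \<open>Prime cones and derivations\<close>

definition ring_preordering :: "'a::comm_ring_1 set \<Rightarrow> bool" where
  "ring_preordering T \<longleftrightarrow> (\<forall>a. a * a \<in> T) \<and> (\<forall>a\<in>T. \<forall>b\<in>T. a + b \<in> T) \<and> (\<forall>a\<in>T. \<forall>b\<in>T. a * b \<in> T)"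

definition supp :: "'a::comm_ring_1 set \<Rightarrow> 'a set" where
  "supp P = {a. a \<in> P \<and> - a \<in> P}"

text \<open>A point of the real spectrum, that is, a prime ideal \<open>supp P\<close> together with
  an ordering of its residue field.\<close>

definition prime_cone :: "'a::comm_ring_1 set \<Rightarrow> bool" where
  "prime_cone P \<longleftrightarrow> ring_preordering P \<and> (\<forall>a. a \<in> P \<or> - a \<in> P) \<and> -1 \<notin> P \<and>
     (\<forall>a b. a * b \<in> supp P \<longrightarrow> a \<in> supp P \<or> b \<in> supp P)"

lemma ring_preorderingD:
  assumes "ring_preordering T"
  shows "a * a \<in> T" "a \<in> T \<Longrightarrow> b \<in> T \<Longrightarrow> a + b \<in> T" "a \<in> T \<Longrightarrow> b \<in> T \<Longrightarrow> a * b \<in> T" "0 \<in> T" "1 \<in> T"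
proof -
  show "a * a \<in> T" "a \<in> T \<Longrightarrow> b \<in> T \<Longrightarrow> a + b \<in> T" "a \<in> T \<Longrightarrow> b \<in> T \<Longrightarrow> a * b \<in> T"
    using assms by (auto simp: ring_preordering_def)
  have sq: "x * x \<in> T" for x using assms by (auto simp: ring_preordering_def)
  show "0 \<in> T" "1 \<in> T" using sq[of 0] sq[of 1] by simp_all
qed

lemma ring_preordering_adjoin:
  assumes T: "ring_preordering T"
  shows "ring_preordering {s + a * t | s t. s \<in> T \<and> t \<in> T}" (is "ring_preordering ?S")
    and "T \<subseteq> {s + a * t | s t. s \<in> T \<and> t \<in> T}" and "a \<in> {s + a * t | s t. s \<in> T \<and> t \<in> T}"
proof -
  note d = ring_preorderingD[OF T]
  have I: "s + a * t \<in> ?S" if "s \<in> T" "t \<in> T" for s t using that by blast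
  show sub: "T \<subseteq> ?S"
  proof
    fix x assume "x \<in> T"
    from I[OF this d(4)] show "x \<in> ?S" by simp
  qed
  show "a \<in> ?S" using I[OF d(4,5)] by simp
  show "ring_preordering ?S" unfolding ring_preordering_def
  proof (intro conjI allI ballI)
    fix x show "x * x \<in> ?S" using sub d(1) by blast
  next
    fix x y assume "x \<in> ?S" "y \<in> ?S"
    then obtain s t s' t' where h: "x = s + a * t" "y = s' + a * t'" "s \<in> T" "t \<in> T" "s' \<in> T" "t' \<in> T" by blast
    have "(s + s') + a * (t + t') \<in> ?S" by (intro I d(2) h)
    thus "x + y \<in> ?S" using h by (simp add: algebra_simps)
    have "(s * s' + (a * a) * (t * t')) + a * (s * t' + t * s') \<in> ?S" by (intro I d(2) d(3) d(1) h)
    thus "x * y \<in> ?S" using h by (simp add: algebra_simps)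
  qed
qed

text \<open>Abstract Positivstellensatz: a preordering that is maximal among those containing no
  -d^2 with \<open>d\<close> in \<open>D\<close> is a prime cone. Its support misses
  \<open>D\<close>, since d and -d in \<open>P\<close> would give their product -d^2.\<close>

lemma prime_cone_exists:
  fixes T D :: "'a::comm_ring_1 set"
  assumes T: "ring_preordering T" and D1: "1 \<in> D" and Dm: "\<And>d e. d \<in> D \<Longrightarrow> e \<in> D \<Longrightarrow> d * e \<in> D"
    and DT: "\<And>d. d \<in> D \<Longrightarrow> - (d * d) \<notin> T"
  shows "\<exists>P. prime_cone P \<and> T \<subseteq> P \<and> D \<inter> supp P = {}"
proof -
  define \<A> where "\<A> = {P. ring_preordering P \<and> T \<subseteq> P \<and> (\<forall>d\<in>D. - (d * d) \<notin> P)}"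
  have "\<exists>M\<in>\<A>. \<forall>Y\<in>\<A>. M \<subseteq> Y \<longrightarrow> Y = M"
  proof (rule subset_Zorn_nonempty)
    show "\<A> \<noteq> {}" using T DT by (auto simp: \<A>_def)
    fix Ch assume ne: "Ch \<noteq> {}" and ch: "subset.chain \<A> Ch"
    have CA: "P \<in> \<A>" if "P \<in> Ch" for P using ch that by (auto simp: subset_chain_def)
    have two: "\<exists>A\<in>Ch. a \<in> A \<and> b \<in> A" if ab: "a \<in> \<Union>Ch" "b \<in> \<Union>Ch" for a b
    proof -
      obtain A B where AB: "A \<in> Ch" "a \<in> A" "B \<in> Ch" "b \<in> B" using ab by blast
      have "A \<subseteq> B \<or> B \<subseteq> A" using ch AB by (simp add: subset_chain_def)
      thus ?thesis using AB by blast
    qed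
    have "ring_preordering (\<Union>Ch)" unfolding ring_preordering_def
    proof (intro conjI allI ballI)
      fix a show "a * a \<in> \<Union>Ch" using ne CA by (auto simp: \<A>_def ring_preordering_def)
    next
      fix a b assume "a \<in> \<Union>Ch" "b \<in> \<Union>Ch"
      then obtain A where A: "A \<in> Ch" "a \<in> A" "b \<in> A" using two by blast
      have "ring_preordering A" using CA[OF A(1)] by (simp add: \<A>_def)
      from ring_preorderingD(2,3)[OF this A(2,3)] A(1) show "a + b \<in> \<Union>Ch" "a * b \<in> \<Union>Ch" by blast+
    qed
    moreover have "T \<subseteq> \<Union>Ch" using ne CA by (force simp: \<A>_def)
    moreover have "\<forall>d\<in>D. - (d * d) \<notin> \<Union>Ch" using CA by (force simp: \<A>_def)
    ultimately show "\<Union>Ch \<in> \<A>" by (simp add: \<A>_def)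
  qed
  then obtain P where PA: "P \<in> \<A>" and mx: "\<forall>Y\<in>\<A>. P \<subseteq> Y \<longrightarrow> Y = P" by (rule bexE)
  have P: "ring_preordering P" "T \<subseteq> P" and PD: "\<And>d. d \<in> D \<Longrightarrow> - (d * d) \<notin> P" using PA by (auto simp: \<A>_def)
  note d = ring_preorderingD[OF P(1)]
  have ext: "\<exists>e\<in>D. \<exists>s\<in>P. \<exists>t\<in>P. - (e * e) = s + a * t" if a: "a \<notin> P" for a
  proof (rule ccontr)
    assume "\<not> ?thesis"
    hence "{s + a * t | s t. s \<in> P \<and> t \<in> P} \<in> \<A>"
      using ring_preordering_adjoin[OF P(1), of a] P(2) unfolding \<A>_def by blast
    hence "{s + a * t | s t. s \<in> P \<and> t \<in> P} = P" using mx ring_preordering_adjoin(2)[OF P(1), of a] by blast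
    thus False using ring_preordering_adjoin(3)[OF P(1), of a] a by simp
  qed
  have total: "a \<in> P \<or> - a \<in> P" for a
  proof (rule ccontr)
    assume "\<not> ?thesis"
    then obtain e s t e' s' t' where h: "e \<in> D" "s \<in> P" "t \<in> P" "- (e * e) = s + a * t"
      "e' \<in> D" "s' \<in> P" "t' \<in> P" "- (e' * e') = s' + - a * t'" using ext[of a] ext[of "-a"] by blast
    \<comment> \<open>Multiplying the two relations produces a^2 t t', which lies in
      \<open>P\<close>, and isolates -(e e')^2.\<close>
    have 1: "a * t = - (e * e) - s" "a * t' = e' * e' + s'" using h(4,8) by (simp_all add: algebra_simps eq_neg_iff_add_eq_0)
    have 2: "(a * a) * (t * t') = (- (e * e) - s) * (e' * e' + s')" unfolding 1[symmetric] by (simp add: algebra_simps)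
    have "- ((e * e') * (e * e')) = e * e * s' + s * (e' * e') + s * s' + (a * a) * (t * t')" unfolding 2 by (simp add: algebra_simps)
    also have "\<dots> \<in> P" by (intro d(2) d(3) d(1) h)
    finally show False using PD[OF Dm[OF h(1,5)]] by simp
  qed
  \<comment> \<open>Applied to \<open>b\<close> and to its negative, this one-sided implication
    gives primality of the support.\<close>
  have half: "- b \<in> P" if ab: "a * b \<in> P" and a: "a \<notin> P" for a b
  proof (rule ccontr)
    assume nb: "- b \<notin> P"
    hence b: "b \<in> P" using total by blast
    obtain e s t where h: "e \<in> D" "s \<in> P" "t \<in> P" "- (e * e) = s + a * t" using ext[OF a] by blast
    obtain e' s' t' where h': "e' \<in> D" "s' \<in> P" "t' \<in> P" "- (e' * e') = s' + - b * t'" using ext[OF nb] by blast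
    have "- (e * e) * b = b * s + (a * b) * t" unfolding h(4) by (simp add: algebra_simps)
    hence 1: "- (e * e) * b \<in> P" using d(2)[OF d(3)[OF b h(2)] d(3)[OF ab h(3)]] by simp
    have "- ((e * e') * (e * e')) = (e * e) * - (e' * e')" by (simp add: algebra_simps)
    also have "\<dots> = (e * e) * s' + (- (e * e) * b) * t'" unfolding h'(4) by (simp add: algebra_simps)
    also have "\<dots> \<in> P" using d(2)[OF d(3)[OF d(1) h'(2)] d(3)[OF 1 h'(3)]] .
    finally show False using PD[OF Dm[OF h(1) h'(1)]] by simp
  qed
  have prime: "a \<in> supp P \<or> b \<in> supp P" if ab: "a * b \<in> supp P" for a b
  proof (rule ccontr)
    assume n: "\<not> ?thesis"
    have "b \<in> supp P" if "c * b \<in> supp P" "c \<notin> P" for c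
      using half[of c b] half[of c "-b"] that by (auto simp: supp_def)
    from this[of a] this[of "-a"] n ab show False by (auto simp: supp_def)
  qed
  have DS: "D \<inter> supp P = {}"
  proof (rule ccontr)
    assume "D \<inter> supp P \<noteq> {}"
    then obtain e where e: "e \<in> D" "e \<in> P" "- e \<in> P" by (auto simp: supp_def)
    from d(3)[OF e(2,3)] PD[OF e(1)] show False by simp
  qed
  have "-1 \<notin> P" using PD[OF D1] by simp
  hence "prime_cone P" using P total prime by (auto simp: prime_cone_def)
  thus ?thesis using P(2) DS by blast
qed

section \<open>Derivations on subrings and their extension\<close>

definition partial_derivation :: "'k::field set \<Rightarrow> ('k \<Rightarrow> 'k) \<Rightarrow> bool" where
  "partial_derivation L D \<longleftrightarrow> 1 \<in> L \<and> (\<forall>x\<in>L. \<forall>y\<in>L. x - y \<in> L \<and> x * y \<in> L \<and> D (x - y) = D x - D y \<and> D (x * y) = x * D y + y * D x)"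

context
  fixes L :: "'k::field_char_0 set" and D :: "'k \<Rightarrow> 'k"
  assumes pd: "partial_derivation L D"
begin

lemma pd_1: "1 \<in> L" and pd_minus: "x \<in> L \<Longrightarrow> y \<in> L \<Longrightarrow> x - y \<in> L" and pd_times: "x \<in> L \<Longrightarrow> y \<in> L \<Longrightarrow> x * y \<in> L"
  and pd_D_minus: "x \<in> L \<Longrightarrow> y \<in> L \<Longrightarrow> D (x - y) = D x - D y"
  and pd_D_times: "x \<in> L \<Longrightarrow> y \<in> L \<Longrightarrow> D (x * y) = x * D y + y * D x"
  using pd by (auto simp: partial_derivation_def)

lemma pd_0: "0 \<in> L" using pd_minus[OF pd_1 pd_1] by simp

lemma pd_D_0: "D 0 = 0" using pd_D_minus[OF pd_0 pd_0] by simp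

lemma pd_uminus: "x \<in> L \<Longrightarrow> - x \<in> L" using pd_minus[OF pd_0, of x] by simp

lemma pd_D_uminus: "x \<in> L \<Longrightarrow> D (- x) = - D x" using pd_D_minus[OF pd_0, of x] pd_D_0 by simp

lemma pd_plus: "x \<in> L \<Longrightarrow> y \<in> L \<Longrightarrow> x + y \<in> L" using pd_minus[OF _ pd_uminus, of x y] by simp

lemma pd_D_plus: "x \<in> L \<Longrightarrow> y \<in> L \<Longrightarrow> D (x + y) = D x + D y"
  using pd_D_minus[OF _ pd_uminus, of x y] pd_D_uminus[of y] by simp

lemma pd_D_1: "D 1 = 0" using pd_D_times[OF pd_1 pd_1] by simp

lemma pd_sum: "(\<And>i. i \<in> A \<Longrightarrow> f i \<in> L) \<Longrightarrow> sum f A \<in> L \<and> D (sum f A) = (\<Sum>i\<in>A. D (f i))"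
  by (induction A rule: infinite_finite_induct) (auto simp: pd_0 pd_D_0 pd_plus pd_D_plus)

lemma pd_of_nat: "of_nat n \<in> L"
  by (induction n) (auto simp: pd_0 pd_1 pd_plus)

text \<open>The only freedom is the value u at \<alpha>. If \<alpha> satisfies no relation over
  \<open>L\<close>, u = 1 is allowed. Otherwise u is dictated by a relation g of least degree, whose
  derivative does not vanish at \<alpha> by minimality and characteristic 0. Extending to the ring
  generated by \<alpha> instead of the field avoids quotients.\<close>

lemma partial_derivation_extend:
  shows "\<exists>D'. partial_derivation {poly g \<alpha> | g. \<forall>i. coeff g i \<in> L} D' \<and> (\<forall>x\<in>L. D' x = D x) \<and>
    ((\<forall>g. (\<forall>i. coeff g i \<in> L) \<longrightarrow> poly g \<alpha> = 0 \<longrightarrow> g = 0) \<longrightarrow> D' \<alpha> = 1)"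
proof -
  define Lp where "Lp g \<longleftrightarrow> (\<forall>i. coeff g i \<in> L)" for g :: "'k poly"
  have Lp_mult: "Lp (g * h)" if "Lp g" "Lp h" for g h
    using that by (auto simp: Lp_def coeff_mult intro!: conjunct1[OF pd_sum] pd_times)
  have Lp_minus: "Lp (g - h)" if "Lp g" "Lp h" for g h using that by (auto simp: Lp_def pd_minus)
  have Lp_const: "Lp [:x:]" if "x \<in> L" for x using that by (auto simp: Lp_def coeff_pCons pd_0 split: nat.split)
  have Lp_X: "Lp [:0, 1:]" by (auto simp: Lp_def coeff_pCons pd_0 pd_1 split: nat.split)
  have Lp_pderiv: "Lp (pderiv g)" if "Lp g" for g
    using that pd_of_nat by (auto simp: Lp_def coeff_pderiv intro!: pd_times simp del: of_nat_Suc)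
  \<comment> \<open>The value at g(\<alpha>) of the extension that sends \<alpha> to
    \<open>u\<close>: differentiate the coefficients, then the variable.\<close>
  define N where "N u g = poly (map_poly D g) \<alpha> + poly (pderiv g) \<alpha> * u" for u g
  have mp_minus: "map_poly D (g - h) = map_poly D g - map_poly D h" if "Lp g" "Lp h" for g h
    by (rule poly_eqI) (use that in \<open>simp add: coeff_map_poly pd_D_0 pd_D_minus Lp_def\<close>)
  have mp_mult: "map_poly D (g * h) = g * map_poly D h + h * map_poly D g" if gh: "Lp g" "Lp h" for g h
  proof (rule poly_eqI)
    fix n
    have "coeff (map_poly D (g * h)) n = D (\<Sum>i\<le>n. coeff g i * coeff h (n - i))" by (simp add: coeff_map_poly pd_D_0 coeff_mult)
    also have "\<dots> = (\<Sum>i\<le>n. D (coeff g i * coeff h (n - i)))"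
      using gh by (intro conjunct2[OF pd_sum] pd_times) (auto simp: Lp_def)
    also have "\<dots> = (\<Sum>i\<le>n. coeff g i * D (coeff h (n - i)) + D (coeff g i) * coeff h (n - i))"
      using gh by (intro sum.cong refl) (simp add: pd_D_times Lp_def)
    also have "\<dots> = coeff (g * map_poly D h + map_poly D g * h) n"
      by (simp add: coeff_mult coeff_map_poly pd_D_0 sum.distrib)
    finally show "coeff (map_poly D (g * h)) n = coeff (g * map_poly D h + h * map_poly D g) n" by (simp add: mult.commute)
  qed
  have N_minus: "N u (g - h) = N u g - N u h" if "Lp g" "Lp h" for u g h
    by (simp add: N_def mp_minus[OF that] pderiv_diff algebra_simps)
  have N_mult: "N u (g * h) = poly g \<alpha> * N u h + poly h \<alpha> * N u g" if "Lp g" "Lp h" for u g h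
    by (simp add: N_def mp_mult[OF that] pderiv_mult algebra_simps)
  have N_const: "N u [:x:] = D x" for u x by (simp add: N_def map_poly_pCons pd_D_0)
  obtain u where u0: "\<And>g. Lp g \<Longrightarrow> poly g \<alpha> = 0 \<Longrightarrow> N u g = 0"
    and u1: "(\<forall>g. Lp g \<longrightarrow> poly g \<alpha> = 0 \<longrightarrow> g = 0) \<Longrightarrow> u = 1"
  proof (cases "\<forall>g. Lp g \<longrightarrow> poly g \<alpha> = 0 \<longrightarrow> g = 0")
    case True
    hence "N 1 g = 0" if "Lp g" "poly g \<alpha> = 0" for g using that by (auto simp: N_def)
    thus ?thesis using that[of 1] by simp
  next
    case False
    define Q where "Q g \<longleftrightarrow> Lp g \<and> poly g \<alpha> = 0 \<and> g \<noteq> 0" for g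
    obtain g where g: "Q g" and gmin: "\<And>h. Q h \<Longrightarrow> degree g \<le> degree h"
      using ex_has_least_nat[of Q _ degree] False unfolding Q_def by blast
    have g': "Lp g" "poly g \<alpha> = 0" "g \<noteq> 0" using g by (auto simp: Q_def)
    have gd: "degree g > 0" using g' by (auto intro!: gr0I elim!: degree_eq_zeroE)
    have dga: "poly (pderiv g) \<alpha> \<noteq> 0"
    proof
      assume "poly (pderiv g) \<alpha> = 0"
      moreover have "pderiv g \<noteq> 0" using gd by (simp add: pderiv_eq_0_iff)
      ultimately have "Q (pderiv g)" using Lp_pderiv[OF g'(1)] by (simp add: Q_def)
      from gmin[OF this] gd show False by (simp add: degree_pderiv)
    qed
    define u where "u = - poly (map_poly D g) \<alpha> / poly (pderiv g) \<alpha>"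
    have Ng: "N u g = 0" using dga by (simp add: N_def u_def)
    \<comment> \<open>\<open>L\<close> is only a ring, so division by \<open>g\<close> is possible
      after multiplication by a nonzero element of \<open>L\<close>.\<close>
    have red: "\<exists>k r. \<exists>c\<in>L. c \<noteq> 0 \<and> Lp k \<and> Lp r \<and> smult c h = g * k + r \<and> degree r < degree g" if "Lp h" for h
      using that
    proof (induction "degree h" arbitrary: h rule: less_induct)
      case less
      show ?case
      proof (cases "degree h < degree g")
        case True
        thus ?thesis using less.prems Lp_const[OF pd_0] pd_1 by (intro exI[of _ 0] exI[of _ h] bexI[of _ 1]) auto
      next
        case False
        have lg: "lead_coeff g \<in> L" "lead_coeff g \<noteq> 0" "lead_coeff h \<in> L" using g' less.prems by (auto simp: Lp_def)
        define m where "m = monom (lead_coeff h) (degree h - degree g)"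
        have m: "Lp m" using lg by (auto simp: m_def Lp_def pd_0)
        define h1 where "h1 = [:lead_coeff g:] * h - m * g"
        have Lh1: "Lp h1" unfolding h1_def by (intro Lp_minus Lp_mult Lp_const lg m less.prems g')
        have "degree (m * g) \<le> degree h"
          using degree_mult_le[of m g] degree_monom_le[of "lead_coeff h" "degree h - degree g"] False unfolding m_def by linarith
        moreover have "degree ([:lead_coeff g:] * h) \<le> degree h" by simp
        ultimately have "degree h1 \<le> degree h" unfolding h1_def by (intro degree_diff_le)
        moreover have "coeff h1 (degree h) = 0" using False by (simp add: h1_def m_def coeff_monom_mult)
        ultimately have "degree h1 < degree h" using False gd by (metis degree_0 leading_coeff_0_iff le_neq_implies_less not_less gr0I le_zero_eq)
        from less.hyps[OF this Lh1] obtain k r c where h: "c \<in> L" "c \<noteq> 0" "Lp k" "Lp r" "smult c h1 = g * k + r" "degree r < degree g" by blast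
        have "smult (c * lead_coeff g) h = g * (k + [:c:] * m) + r" using h(5) by (simp add: h1_def algebra_simps smult_diff_right)
        moreover have "Lp (k + [:c:] * m)" using Lp_minus[OF h(3) Lp_mult[OF Lp_const[OF pd_uminus[OF h(1)]] m]] by simp
        ultimately show ?thesis using h lg pd_times by (intro exI[of _ "k + [:c:] * m"] exI[of _ r] bexI[of _ "c * lead_coeff g"]) auto
      qed
    qed
    have "N u h = 0" if h: "Lp h" "poly h \<alpha> = 0" for h
    proof -
      obtain k r c where k: "c \<in> L" "c \<noteq> 0" "Lp k" "Lp r" "smult c h = g * k + r" "degree r < degree g" using red[OF h(1)] by blast
      have "poly r \<alpha> = 0" using arg_cong[OF k(5), of "\<lambda>p. poly p \<alpha>"] h g' by simp
      hence "r = 0" using gmin[of r] k by (auto simp: Q_def not_le[symmetric])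
      hence eq: "[:c:] * h = g * k" using k(5) by simp
      have "N u ([:c:] * h) = c * N u h" using N_mult[OF Lp_const[OF k(1)] h(1)] h(2) by simp
      moreover have "N u (g * k) = 0" using N_mult[OF g'(1) k(3)] Ng g' by simp
      ultimately show ?thesis using eq k(2) by simp
    qed
    thus ?thesis using that[of u] False by blast
  qed
  define D' where "D' x = N u (SOME g. Lp g \<and> poly g \<alpha> = x)" for x
  have D': "D' (poly g \<alpha>) = N u g" if g: "Lp g" for g
  proof -
    define h where "h = (SOME h. Lp h \<and> poly h \<alpha> = poly g \<alpha>)"
    have h: "Lp h" "poly h \<alpha> = poly g \<alpha>" using someI[of "\<lambda>h. Lp h \<and> poly h \<alpha> = poly g \<alpha>", OF conjI[OF g refl]] by (simp_all add: h_def)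
    have "N u (h - g) = 0" using u0[OF Lp_minus[OF h(1) g]] h(2) by simp
    thus ?thesis using N_minus[OF h(1) g] by (simp add: D'_def h_def)
  qed
  have "partial_derivation {poly g \<alpha> | g. Lp g} D'" unfolding partial_derivation_def
  proof (intro conjI ballI)
    show "1 \<in> {poly g \<alpha> | g. Lp g}" using Lp_const[OF pd_1] by (intro CollectI exI[of _ "[:1:]"]) simp
    fix x y assume "x \<in> {poly g \<alpha> | g. Lp g}" "y \<in> {poly g \<alpha> | g. Lp g}"
    then obtain g h where gh: "x = poly g \<alpha>" "Lp g" "y = poly h \<alpha>" "Lp h" by blast
    have e: "x - y = poly (g - h) \<alpha>" "x * y = poly (g * h) \<alpha>" using gh by simp_all
    show "x - y \<in> {poly g \<alpha> | g. Lp g}" "x * y \<in> {poly g \<alpha> | g. Lp g}" unfolding e using Lp_minus Lp_mult gh by blast+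
    show "D' (x - y) = D' x - D' y" unfolding e D'[OF Lp_minus[OF gh(2,4)]] using gh D' N_minus by simp
    show "D' (x * y) = x * D' y + y * D' x" unfolding e D'[OF Lp_mult[OF gh(2,4)]] using gh D' N_mult by simp
  qed
  moreover have "D' x = D x" if "x \<in> L" for x using D'[OF Lp_const[OF that]] N_const by simp
  moreover have "D' \<alpha> = u" using D'[OF Lp_X] by (simp add: N_def map_poly_pCons pd_D_0 pd_D_1 pderiv_pCons)
  ultimately show ?thesis using u1 unfolding Lp_def by blast
qed

end

text \<open>The zero derivation on the constants extends to \<open>t\<close> with value 1 since
  \<open>t\<close> is transcendental, and then to the elements of \<open>V\<close> one after the
  other.\<close>

lemma derivation_transcendental:
  fixes \<iota> :: "'r::field_char_0 \<Rightarrow> 'k::field_char_0"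
  assumes hom: "ring_hom_fun \<iota>" and tr: "\<And>\<pi>. \<pi> \<noteq> 0 \<Longrightarrow> poly (map_poly \<iota> \<pi>) t \<noteq> 0" and fin: "finite V"
  shows "\<exists>L D. partial_derivation L D \<and> range \<iota> \<subseteq> L \<and> (\<forall>c. D (\<iota> c) = 0) \<and> t \<in> L \<and> D t = 1 \<and> V \<subseteq> L"
  using fin
proof (induction V rule: finite_induct)
  case empty
  have pd0: "partial_derivation (range \<iota>) (\<lambda>_. 0)"
    unfolding partial_derivation_def
    by (auto simp: ring_hom_fun_diff[OF hom, symmetric] ring_hom_fun_mult[OF hom, symmetric] intro: range_eqI[of _ _ 1] simp: ring_hom_fun_one[OF hom])
  have inj: "\<iota> c = 0 \<longleftrightarrow> c = 0" for c
    using tr[of "[:c:]"] by (cases "c = 0") (auto simp: map_poly_pCons ring_hom_fun_zero[OF hom])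
  have "g = 0" if g: "\<forall>i. coeff g i \<in> range \<iota>" "poly g t = 0" for g
  proof -
    define bk where "bk y = (SOME x. \<iota> x = y)" for y
    have bk: "\<iota> (bk y) = y" if "y \<in> range \<iota>" for y
    proof -
      have "\<exists>x. \<iota> x = y" using that by auto
      from someI_ex[OF this] show ?thesis by (simp add: bk_def)
    qed
    have bk0: "bk 0 = 0" using bk[of 0] inj ring_hom_fun_zero[OF hom] by (metis rangeI)
    have "map_poly \<iota> (map_poly bk g) = g" by (rule poly_eqI) (use g(1) bk in \<open>simp add: coeff_map_poly bk0 ring_hom_fun_zero[OF hom]\<close>)
    hence "map_poly bk g = 0" using tr[of "map_poly bk g"] g(2) by auto
    thus ?thesis using \<open>map_poly \<iota> (map_poly bk g) = g\<close> by simp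
  qed
  with partial_derivation_extend[OF pd0, of t] obtain D where D: "partial_derivation {poly g t | g. \<forall>i. coeff g i \<in> range \<iota>} D"
    "\<forall>x\<in>range \<iota>. D x = 0" "D t = 1" by blast
  have "range \<iota> \<subseteq> {poly g t | g. \<forall>i. coeff g i \<in> range \<iota>}"
  proof
    fix x assume "x \<in> range \<iota>"
    thus "x \<in> {poly g t | g. \<forall>i. coeff g i \<in> range \<iota>}"
      using ring_hom_fun_zero[OF hom] by (intro CollectI exI[of _ "[:x:]"]) (auto simp: coeff_pCons split: nat.split intro: range_eqI[of _ _ 0])
  qed
  moreover have "t \<in> {poly g t | g. \<forall>i. coeff g i \<in> range \<iota>}"
    using ring_hom_fun_zero[OF hom] ring_hom_fun_one[OF hom]
    by (intro CollectI exI[of _ "[:0, 1:]"]) (auto simp: coeff_pCons split: nat.split intro: range_eqI[of _ _ 0] range_eqI[of _ _ 1])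
  ultimately show ?case using D by blast
next
  case (insert x V)
  then obtain L D where LD: "partial_derivation L D" "range \<iota> \<subseteq> L" "\<forall>c. D (\<iota> c) = 0" "t \<in> L" "D t = 1" "V \<subseteq> L" by blast
  from partial_derivation_extend[OF LD(1), of x] obtain D' where D': "partial_derivation {poly g x | g. \<forall>i. coeff g i \<in> L} D'"
    "\<forall>x\<in>L. D' x = D x" by blast
  have sub: "L \<subseteq> {poly g x | g. \<forall>i. coeff g i \<in> L}"
  proof
    fix y assume "y \<in> L"
    thus "y \<in> {poly g x | g. \<forall>i. coeff g i \<in> L}"
      by (intro CollectI exI[of _ "[:y:]"]) (auto simp: coeff_pCons pd_0[OF LD(1)] split: nat.split)
  qed
  have "x \<in> {poly g x | g. \<forall>i. coeff g i \<in> L}"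
    by (intro CollectI exI[of _ "[:0, 1:]"]) (auto simp: coeff_pCons pd_0[OF LD(1)] pd_1[OF LD(1)] split: nat.split)
  moreover have "D' (\<iota> c) = 0" for c using D'(2) LD(2,3) by (metis rangeI subsetD)
  ultimately show ?case using LD D' sub by (intro exI[of _ "{poly g x | g. \<forall>i. coeff g i \<in> L}"] exI[of _ D']) auto
qed

section \<open>Univariate real polynomials\<close>

lemma nonneg_poly_lead_coeff:
  fixes p :: "real poly"
  assumes "\<And>t. poly p t \<ge> 0" "degree p > 0"
  shows "lead_coeff p > 0"
proof (rule ccontr)
  assume "\<not> lead_coeff p > 0"
  moreover have "lead_coeff p \<noteq> 0" using assms(2) by auto
  ultimately have "lead_coeff p < 0" by linarith
  hence "lead_coeff (-p) > 0" by simp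
  with poly_tends_up[of "-p" 1] assms(2) obtain m where "\<forall>x\<ge>m. poly (-p) x \<ge> 1" by auto
  hence "poly p m \<le> -1" by auto
  thus False using assms(1)[of m] by simp
qed

lemma nonneg_poly_attains_min:
  fixes p :: "real poly"
  assumes nn: "\<And>t. poly p t \<ge> 0"
  shows "\<exists>r. \<forall>t. poly p r \<le> poly p t"
proof (cases "degree p = 0")
  case True
  thus ?thesis by (auto elim!: degree_eq_zeroE)
next
  case False
  define q where "q = pcompose p [:0, -1:]"
  have q: "poly q t = poly p (- t)" for t by (simp add: q_def poly_pcompose)
  have dq: "degree q = degree p" by (simp add: q_def degree_pcompose)
  obtain m where m: "\<forall>x\<ge>m. poly p x \<ge> poly p 0"
    using poly_tends_up[of p "poly p 0"] nonneg_poly_lead_coeff[OF nn] False by auto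
  obtain m' where m': "\<forall>x\<ge>m'. poly q x \<ge> poly p 0"
    using poly_tends_up[of q "poly p 0"] nonneg_poly_lead_coeff[of q] nn dq False q by auto
  define R where "R = max 0 (max m m')"
  obtain r where r: "r \<in> {-R..R}" "\<forall>t\<in>{-R..R}. poly p r \<le> poly p t"
    using continuous_attains_inf[of "{-R..R}" "poly p"] by (force simp: R_def intro!: continuous_intros)
  have "poly p r \<le> poly p t" for t
  proof (cases "t \<in> {-R..R}")
    case True thus ?thesis using r by blast
  next
    case False
    have 0: "poly p r \<le> poly p 0" using r by (simp add: R_def)
    have "t \<ge> m \<or> - t \<ge> m'" using False by (auto simp: R_def)
    hence "poly p 0 \<le> poly p t" using m m' q[of "-t"] by auto
    with 0 show ?thesis by simp
  qed
  thus ?thesis by blast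
qed

text \<open>Subtracting the minimum leaves a double root at the minimizer, and the quotient by (X -
  r)^2 is nonnegative of smaller degree. The bound on the degrees of the squares later keeps the
  relaxation order independent of \<gamma>.\<close>

lemma nonneg_poly_sum_squares:
  fixes p :: "real poly"
  assumes "\<And>t. poly p t \<ge> 0"
  shows "\<exists>qs. p = (\<Sum>q\<leftarrow>qs. q * q) \<and> (\<forall>q\<in>set qs. 2 * degree q \<le> degree p)"
  using assms
proof (induction "degree p" arbitrary: p rule: less_induct)
  case less
  obtain r where r: "\<And>t. poly p r \<le> poly p t" using nonneg_poly_attains_min[OF less.prems] by blast
  define c where "c = poly p r"
  have c0: "c \<ge> 0" using less.prems by (simp add: c_def)
  show ?case
  proof (cases "degree p = 0")
    case True
    then obtain a where a: "p = [:a:]" by (rule degree_eq_zeroE)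
    hence "a \<ge> 0" using less.prems[of 0] by simp
    thus ?thesis using a by (intro exI[of _ "[[:sqrt a:]]"]) auto
  next
    case False
    define p0 where "p0 = p - [:c:]"
    have p0: "poly p0 t \<ge> 0" "poly p0 r = 0" for t using r[of t] by (auto simp: p0_def c_def)
    have dp0: "degree p0 = degree p" using False unfolding p0_def by (simp add: degree_add_eq_left diff_conv_add_uminus del: add_uminus_conv_diff)
    have p00: "p0 \<noteq> 0" using dp0 False by auto
    obtain p1 where p1: "p0 = [:-r, 1:] * p1" using p0(2) by (auto simp: poly_eq_0_iff_dvd)
    have p1s: "(t - r) * poly p1 t \<ge> 0" for t using p0(1)[of t] p1 by (simp add: algebra_simps)
    have cont: "isCont (poly q) r" for q :: "real poly" by (rule poly_isCont)
    \<comment> \<open>\<open>p1\<close> is nonnegative to the right of \<open>r\<close> and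
      nonpositive to the left.\<close>
    have "poly p1 r = 0"
    proof (rule ccontr)
      assume nz: "poly p1 r \<noteq> 0"
      have "eventually (\<lambda>t. dist (poly p1 t) (poly p1 r) < \<bar>poly p1 r\<bar>) (at r)"
        using cont[of p1] nz unfolding isCont_def by (intro tendstoD) auto
      then obtain e where e: "e > 0" "\<And>t. t \<noteq> r \<Longrightarrow> \<bar>t - r\<bar> < e \<Longrightarrow> \<bar>poly p1 t - poly p1 r\<bar> < \<bar>poly p1 r\<bar>"
        unfolding eventually_at dist_real_def by blast
      have "poly p1 (r + e/2) \<ge> 0" "poly p1 (r - e/2) \<le> 0" using p1s[of "r + e/2"] p1s[of "r - e/2"] e(1)
        by (auto simp: zero_le_mult_iff mult_le_0_iff)
      thus False using e(2)[of "r + e/2"] e(2)[of "r - e/2"] e(1) nz by auto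
    qed
    then obtain p2 where p2: "p1 = [:-r, 1:] * p2" by (auto simp: poly_eq_0_iff_dvd)
    have eq: "p0 = [:-r, 1:] * [:-r, 1:] * p2" using p1 p2 by (simp only: mult.assoc)
    have p2n: "poly p2 t \<ge> 0" if "t \<noteq> r" for t
    proof -
      have "((t - r) * (t - r)) * poly p2 t \<ge> 0" using p0(1)[of t] eq by (simp add: algebra_simps)
      moreover have "(t - r) * (t - r) > 0" using that by (cases t r rule: linorder_cases) (auto simp: zero_less_mult_iff)
      ultimately show ?thesis by (simp add: zero_le_mult_iff)
    qed
    have p2r: "poly p2 r \<ge> 0"
    proof (rule tendsto_lowerbound)
      show "(poly p2 \<longlongrightarrow> poly p2 r) (at r)" using cont[of p2] by (simp add: isCont_def)
      show "\<forall>\<^sub>F t in at r. 0 \<le> poly p2 t" using p2n by (auto simp: eventually_at_filter)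
    qed simp
    have p2nn: "poly p2 t \<ge> 0" for t using p2n[of t] p2r by (cases "t = r") auto
    have p20: "p2 \<noteq> 0" using eq p00 by auto
    have dd: "degree p = 2 + degree p2" unfolding dp0[symmetric] eq using p20 by (subst degree_mult_eq; simp)+
    from less.hyps[of p2] p2nn dd obtain qs where qs: "p2 = (\<Sum>q\<leftarrow>qs. q * q)" "\<forall>q\<in>set qs. 2 * degree q \<le> degree p2" by auto
    have "p = [:c:] + [:-r, 1:] * [:-r, 1:] * p2" using eq by (simp add: p0_def algebra_simps)
    also have "[:-r, 1:] * [:-r, 1:] * p2 = (\<Sum>q\<leftarrow>map (\<lambda>q. [:-r, 1:] * q) qs. q * q)"
      unfolding qs(1) sum_list_const_mult[symmetric] by (simp add: o_def mult_ac del: mult_pCons_left mult_pCons_right)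
    also have "[:c:] = [:sqrt c:] * [:sqrt c:]" using c0 by simp
    finally have "p = (\<Sum>q\<leftarrow>[:sqrt c:] # map (\<lambda>q. [:-r, 1:] * q) qs. q * q)" by simp
    moreover have "2 * degree q \<le> degree p" if "q \<in> set ([:sqrt c:] # map (\<lambda>q. [:-r, 1:] * q) qs)" for q
    proof -
      from that consider "q = [:sqrt c:]" | q' where "q' \<in> set qs" "q = [:-r, 1:] * q'" by auto
      thus ?thesis
      proof cases
        case 2
        have "degree q \<le> 1 + degree q'" unfolding 2(2) using degree_mult_le[of "[:-r, 1:]" q'] by simp
        thus ?thesis using qs(2) 2(1) dd by fastforce
      qed simp
    qed
    ultimately show ?thesis by blast
  qed
qed

text \<open>The constant is the minimum. It stays positive in an ordered extension of the reals, so
  the certificate excludes roots there as well.\<close>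

lemma positive_poly_certificate:
  fixes p :: "real poly"
  assumes "\<And>t. poly p t > 0"
  shows "\<exists>c>0. \<exists>qs. p = [:c:] + (\<Sum>q\<leftarrow>qs. q * q)"
proof -
  obtain r where r: "\<And>t. poly p r \<le> poly p t" using nonneg_poly_attains_min[of p] assms less_imp_le by metis
  have "poly (p - [:poly p r:]) t \<ge> 0" for t using r[of t] by simp
  then obtain qs where qs: "p - [:poly p r:] = (\<Sum>q\<leftarrow>qs. q * q)" using nonneg_poly_sum_squares[of "p - [:poly p r:]"] by blast
  have "p = [:poly p r:] + (p - [:poly p r:])" by simp
  thus ?thesis using assms[of r] qs by metis
qed

text \<open>Real roots are divided out first. A polynomial without real roots has constant sign; up
  to sign it is a positive constant plus squares and cannot vanish in an ordered field.\<close>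

lemma algebraic_over_reals_is_real:
  fixes \<iota> :: "real \<Rightarrow> 'k::linordered_field"
  assumes hom: "ring_hom_fun \<iota>" and pos: "\<And>c. c > 0 \<Longrightarrow> \<iota> c > 0"
  shows "\<pi> \<noteq> 0 \<Longrightarrow> poly (map_poly \<iota> \<pi>) t = 0 \<Longrightarrow> \<exists>v. t = \<iota> v"
proof (induction "degree \<pi>" arbitrary: \<pi> rule: less_induct)
  case less
  note h0 = ring_hom_fun_zero[OF hom]
  show ?case
  proof (cases "\<exists>v. poly \<pi> v = 0")
    case True
    then obtain v \<pi>1 where v: "\<pi> = [:-v, 1:] * \<pi>1" by (auto simp: poly_eq_0_iff_dvd)
    have "\<pi>1 \<noteq> 0" using v less.prems(1) by auto
    hence d: "degree \<pi>1 < degree \<pi>" unfolding v by (subst degree_mult_eq) simp_all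
    have "poly (map_poly \<iota> \<pi>) t = (t - \<iota> v) * poly (map_poly \<iota> \<pi>1) t"
      unfolding v map_poly_hom_mult[OF hom]
      by (simp add: map_poly_pCons h0 ring_hom_fun_uminus[OF hom] ring_hom_fun_one[OF hom] algebra_simps)
    hence "t = \<iota> v \<or> poly (map_poly \<iota> \<pi>1) t = 0" using less.prems(2) by auto
    thus ?thesis using less.hyps[OF d \<open>\<pi>1 \<noteq> 0\<close>] by blast
  next
    case False
    have main: False if "\<And>s. poly p s > 0" "poly (map_poly \<iota> p) t = 0" for p
    proof -
      obtain c qs where c: "c > 0" "p = [:c:] + (\<Sum>q\<leftarrow>qs. q * q)" using positive_poly_certificate[of p] \<open>\<And>s. poly p s > 0\<close> by blast
      have "poly (map_poly \<iota> (\<Sum>q\<leftarrow>qs. q * q)) t \<ge> 0"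
        by (induction qs) (simp_all add: map_poly_hom_add[OF hom] map_poly_hom_mult[OF hom])
      hence "poly (map_poly \<iota> p) t \<ge> \<iota> c" unfolding c(2) map_poly_hom_add[OF hom] by (simp add: map_poly_pCons h0)
      thus False using pos[OF c(1)] that(2) by simp
    qed
    have "(\<forall>s. poly \<pi> s > 0) \<or> (\<forall>s. poly (- \<pi>) s > 0)"
    proof (rule ccontr)
      assume "\<not> ?thesis"
      then obtain a b where "poly \<pi> a \<le> 0" "poly \<pi> b \<ge> 0" by (force simp: not_less)
      hence ab: "poly \<pi> a < 0" "poly \<pi> b > 0" using False by (metis less_le)+
      hence "a \<noteq> b" by auto
      thus False using poly_IVT_pos[of a b \<pi>] poly_IVT_neg[of b a \<pi>] ab False by (cases "a < b") auto
    qed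
    moreover have "poly (map_poly \<iota> (- \<pi>)) t = 0"
      using map_poly_hom_diff[OF hom, of 0 \<pi>] less.prems(2) by simp
    ultimately show ?thesis using main[of \<pi>] main[of "-\<pi>"] less.prems(2) by blast
  qed
qed

instance real :: real_closed
proof
  fix a b :: real and f :: "nat \<Rightarrow> real" and n
  define F where "F = (\<Sum>k\<le>n. monom (f k) k)"
  have F: "poly F x = (\<Sum>k\<le>n. f k * x ^ k)" for x by (simp add: F_def poly_sum poly_monom)
  assume "a < b" "(\<Sum>k\<le>n. f k * a ^ k) < 0" "(\<Sum>k\<le>n. f k * b ^ k) > 0"
  thus "\<exists>x>a. x < b \<and> (\<Sum>k\<le>n. f k * x ^ k) = 0" using poly_IVT_pos[of a b F] by (simp add: F)
qed

text \<open>Put s = \<gamma> - t > 0 and let d be the least v - \<gamma>. All factors v - t are at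
  least d + s, so the product is at least (d + s) d^n, and (d + s)^2 \<ge> 4 d s leads to the value
  of \<open>C\<close>. Without any factor the square would not grow as t tends to minus
  infinity.\<close>

lemma linear_plus_square_nonneg:
  fixes \<gamma> :: real
  assumes "vs \<noteq> []" "\<forall>v\<in>set vs. \<gamma> < v"
  shows "\<exists>C\<ge>0. \<forall>t. t - \<gamma> + C * (\<Prod>v\<leftarrow>vs. t - v)\<^sup>2 \<ge> 0"
proof -
  define d where "d = Min ((\<lambda>v. v - \<gamma>) ` set vs)"
  have d: "d > 0" "\<And>v. v \<in> set vs \<Longrightarrow> d \<le> v - \<gamma>" using assms by (auto simp: d_def)
  have prod: "(d + s) ^ length us \<le> (\<Prod>v\<leftarrow>us. v - (\<gamma> - s))" if "s \<ge> 0" "set us \<subseteq> set vs" for s us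
    using that(2)
  proof (induction us)
    case (Cons v us)
    have "(d + s) * (d + s) ^ length us \<le> (v - (\<gamma> - s)) * (\<Prod>v\<leftarrow>us. v - (\<gamma> - s))"
      using d(1) d(2)[of v] that(1) Cons by (intro mult_mono) auto
    thus ?case by simp
  qed simp
  have sq: "(\<Prod>v\<leftarrow>us. t - v)\<^sup>2 = (\<Prod>v\<leftarrow>us. v - t)\<^sup>2" for us and t :: real
    by (induction us) (simp_all add: power_mult_distrib power2_commute)
  obtain n where n: "length vs = Suc n" using assms(1) by (cases vs) auto
  define C where "C = 1 / (4 * d * (d ^ n)\<^sup>2)"
  have "t - \<gamma> + C * (\<Prod>v\<leftarrow>vs. t - v)\<^sup>2 \<ge> 0" for t
  proof (cases "t \<ge> \<gamma>")
    case True thus ?thesis using d by (simp add: C_def)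
  next
    case False
    define s where "s = \<gamma> - t"
    have s: "s > 0" using False by (simp add: s_def)
    have "(d + s) * d ^ n \<le> (d + s) ^ Suc n" using d s by (simp add: power_mono)
    also have "\<dots> \<le> (\<Prod>v\<leftarrow>vs. v - t)" using prod[of s vs] s n by (simp add: s_def)
    finally have "((d + s) * d ^ n)\<^sup>2 \<le> (\<Prod>v\<leftarrow>vs. v - t)\<^sup>2" using d s by (intro power_mono) auto
    hence "C * ((d + s) * d ^ n)\<^sup>2 \<le> C * (\<Prod>v\<leftarrow>vs. t - v)\<^sup>2" using d unfolding sq by (intro mult_left_mono) (auto simp: C_def)
    moreover have "C * ((d + s) * d ^ n)\<^sup>2 = (d + s)\<^sup>2 / (4 * d)" using d by (simp add: C_def power_mult_distrib)
    moreover have "s \<le> (d + s)\<^sup>2 / (4 * d)"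
    proof -
      have "4 * d * s \<le> (d + s)\<^sup>2" using zero_le_power2[of "d - s"] by (simp add: power2_eq_square algebra_simps)
      thus ?thesis using d by (simp add: field_simps)
    qed
    ultimately show ?thesis by (simp add: s_def)
  qed
  moreover have "C \<ge> 0" using d by (simp add: C_def)
  ultimately show ?thesis by blast
qed

section \<open>Multivariate polynomials\<close>

abbreviation (input) lk where "lk \<equiv> Poly_Mapping.lookup"

text \<open>Evaluation at points over an arbitrary ring, the real coefficients being mapped by
  \<iota>; points over the real closure of a residue field are needed.\<close>

definition mpoly_eval :: "(real \<Rightarrow> 'k::comm_ring_1) \<Rightarrow> ('v::finite \<Rightarrow> 'k) \<Rightarrow> 'v mpoly \<Rightarrow> 'k" where
  "mpoly_eval \<iota> x p = (\<Sum>a\<in>Poly_Mapping.keys p. \<iota> (lk p a) * (\<Prod>v\<in>UNIV. x v ^ lk a v))"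

definition mvar :: "'v::finite \<Rightarrow> 'v mpoly" where
  "mvar v = Poly_Mapping.single (Poly_Mapping.single v 1) 1"

lemma mpoly_sum_single:
  fixes p :: "'v::finite mpoly"
  assumes "finite S" "Poly_Mapping.keys p \<subseteq> S"
  shows "p = (\<Sum>a\<in>S. Poly_Mapping.single a (lk p a))"
proof (rule poly_mapping_eqI)
  fix b
  have "lk (\<Sum>a\<in>S. Poly_Mapping.single a (lk p a)) b = (\<Sum>a\<in>S. if a = b then lk p b else 0)"
    by (simp add: lookup_sum lookup_single when_def) (intro sum.cong, auto)
  also have "\<dots> = lk p b" using assms by (auto simp: sum.delta in_keys_iff)
  finally show "lk p b = lk (\<Sum>a\<in>S. Poly_Mapping.single a (lk p a)) b" by simp
qed

lemma mpoly_additive_induct: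
  fixes p :: "'v::finite mpoly"
  assumes "\<And>a c. P (Poly_Mapping.single a c)" "\<And>p q. P p \<Longrightarrow> P q \<Longrightarrow> P (p + q)"
  shows "P p"
proof -
  have "P (\<Sum>a\<in>S. Poly_Mapping.single a (lk p a))" if "finite S" for S
    using that
  proof (induction S rule: finite_induct)
    case empty
    show ?case using assms(1)[of 0 0] by simp
  qed (use assms in simp)
  from this[of "Poly_Mapping.keys p"] show ?thesis using mpoly_sum_single[of "Poly_Mapping.keys p" p] by simp
qed

lemma mconst_add: "mconst (a + b) = mconst a + mconst b" by (simp add: mconst_def single_add)
lemma mconst_mult: "mconst (a * b) = mconst a * mconst b" by (simp add: mconst_def mult_single)
lemma mconst_1: "mconst 1 = 1" by (simp add: mconst_def)
lemma mconst_hom: "ring_hom_fun mconst" by (simp add: ring_hom_fun_def mconst_1 mconst_add mconst_mult)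
lemma mconst_0: "mconst 0 = 0" by (simp add: mconst_def)

lemma single_conv_mvar:
  "Poly_Mapping.single a c = mconst c * (\<Prod>v\<in>(UNIV::'v::finite set). mvar v ^ lk a v)"
proof -
  have pw: "mvar v ^ n = Poly_Mapping.single (Poly_Mapping.single v n) 1" for v :: 'v and n
    by (induction n) (simp_all add: mvar_def mult_single single_add[symmetric])
  have pr: "(\<Prod>v\<in>S. Poly_Mapping.single (g v) (1::real)) = Poly_Mapping.single (\<Sum>v\<in>S. g v) 1" if "finite S" for S and g :: "'v \<Rightarrow> 'v \<Rightarrow>\<^sub>0 nat"
    using that by (induction S rule: finite_induct) (simp_all add: mult_single)
  have "(\<Sum>v\<in>UNIV. Poly_Mapping.single v (lk a v)) = a"
    by (rule poly_mapping_eqI) (simp add: lookup_sum lookup_single when_def)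
  thus ?thesis by (simp add: pw pr mconst_def mult_single)
qed

lemma mpoly_induct [case_names const var add mult]:
  fixes p :: "'v::finite mpoly"
  assumes c: "\<And>c. P (mconst c)" and v: "\<And>v. P (mvar v)" and add: "\<And>p q. P p \<Longrightarrow> P q \<Longrightarrow> P (p + q)"
    and mult: "\<And>p q. P p \<Longrightarrow> P q \<Longrightarrow> P (p * q)"
  shows "P p"
proof (rule mpoly_additive_induct)
  fix a c
  have pw: "P (mvar v ^ n)" for v n by (induction n) (use c[of 1] v mult in \<open>simp_all add: mconst_1\<close>)
  have "P (\<Prod>v\<in>S. mvar v ^ lk a v)" for S
    by (induction S rule: infinite_finite_induct) (use c[of 1] pw mult in \<open>simp_all add: mconst_1\<close>)
  thus "P (Poly_Mapping.single a c)" unfolding single_conv_mvar using c mult by blast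
qed (rule add)

context
  fixes \<iota> :: "real \<Rightarrow> 'k::comm_ring_1" and x :: "'v::finite \<Rightarrow> 'k"
  assumes hom: "ring_hom_fun \<iota>"
begin

lemma mpoly_eval_superset: "finite S \<Longrightarrow> Poly_Mapping.keys p \<subseteq> S \<Longrightarrow> mpoly_eval \<iota> x p = (\<Sum>a\<in>S. \<iota> (lk p a) * (\<Prod>v\<in>UNIV. x v ^ lk a v))"
  unfolding mpoly_eval_def by (intro sum.mono_neutral_left) (auto simp: in_keys_iff ring_hom_fun_zero[OF hom])

lemma mpoly_eval_add: "mpoly_eval \<iota> x (p + q) = mpoly_eval \<iota> x p + mpoly_eval \<iota> x q"
proof -
  have S: "finite (Poly_Mapping.keys p \<union> Poly_Mapping.keys q)" "Poly_Mapping.keys (p + q) \<subseteq> Poly_Mapping.keys p \<union> Poly_Mapping.keys q" by (simp_all add: keys_add)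
  show ?thesis
    using mpoly_eval_superset[OF S] mpoly_eval_superset[OF S(1), of p] mpoly_eval_superset[OF S(1), of q]
    by (simp add: lookup_add ring_hom_fun_add[OF hom] sum.distrib[symmetric] algebra_simps)
qed

lemma mpoly_eval_single: "mpoly_eval \<iota> x (Poly_Mapping.single a c) = \<iota> c * (\<Prod>v\<in>UNIV. x v ^ lk a v)"
  using mpoly_eval_superset[of "{a}" "Poly_Mapping.single a c"] by (simp add: lookup_single)

lemma mpoly_eval_mult: "mpoly_eval \<iota> x (p * q) = mpoly_eval \<iota> x p * mpoly_eval \<iota> x q"
proof (induction p rule: mpoly_additive_induct)
  case (1 a c)
  show ?case
  proof (induction q rule: mpoly_additive_induct)
    case (1 b d)
    show ?case by (simp add: mult_single mpoly_eval_single ring_hom_fun_mult[OF hom] lookup_add power_add prod.distrib ac_simps)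
  qed (simp add: distrib_left mpoly_eval_add)
qed (simp add: distrib_right mpoly_eval_add)

lemma mpoly_eval_mconst: "mpoly_eval \<iota> x (mconst c) = \<iota> c" by (simp add: mconst_def mpoly_eval_single)

lemma mpoly_eval_mvar: "mpoly_eval \<iota> x (mvar v) = x v"
proof -
  have "(\<Prod>w\<in>UNIV. x w ^ lk (Poly_Mapping.single v 1) w) = (\<Prod>w\<in>UNIV. if w = v then x v else 1)"
    by (intro prod.cong) (auto simp: lookup_single when_def)
  thus ?thesis by (simp add: mvar_def mpoly_eval_single ring_hom_fun_one[OF hom])
qed

lemma mpoly_eval_hom: "ring_hom_fun (mpoly_eval \<iota> x)"
  using mpoly_eval_mconst[of 1] by (simp add: ring_hom_fun_def mconst_1 ring_hom_fun_one[OF hom] mpoly_eval_add mpoly_eval_mult)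

end

lemma id_hom: "ring_hom_fun (\<lambda>x::'a::comm_ring_1. x)" by (simp add: ring_hom_fun_def)

lemma meval_conv_mpoly_eval: "meval p x = mpoly_eval (\<lambda>x. x) (\<lambda>v. x $ v) p"
  by (simp add: meval_def mpoly_eval_def)

lemma meval_hom: "ring_hom_fun (\<lambda>p. meval p x)"
  using mpoly_eval_hom[OF id_hom, of "\<lambda>v. x $ v"] by (simp add: meval_conv_mpoly_eval)

lemmas meval_simps = ring_hom_fun_one[OF meval_hom] ring_hom_fun_add[OF meval_hom] ring_hom_fun_mult[OF meval_hom]
  ring_hom_fun_zero[OF meval_hom] ring_hom_fun_uminus[OF meval_hom] ring_hom_fun_diff[OF meval_hom]
  ring_hom_fun_power[OF meval_hom] ring_hom_fun_sum[OF meval_hom]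

lemma meval_mconst: "meval (mconst c) x = c" by (simp add: meval_conv_mpoly_eval mpoly_eval_mconst[OF id_hom])
lemma meval_mvar: "meval (mvar v) x = x $ v" by (simp add: meval_conv_mpoly_eval mpoly_eval_mvar[OF id_hom])

text \<open>A homomorphism is the same as a point over the target ring. In this way the residue map
  becomes a point over a real closed field.\<close>

lemma hom_eq_mpoly_eval:
  fixes e :: "'v::finite mpoly \<Rightarrow> 'k::comm_ring_1"
  assumes e: "ring_hom_fun e"
  shows "e p = mpoly_eval (\<lambda>c. e (mconst c)) (\<lambda>v. e (mvar v)) p"
proof -
  have hc: "ring_hom_fun (\<lambda>c. e (mconst c))"
    using e mconst_1 mconst_add mconst_mult unfolding ring_hom_fun_def by metis
  show ?thesis
    by (induction p rule: mpoly_induct)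
      (simp_all add: mpoly_eval_mconst[OF hc] mpoly_eval_mvar[OF hc] mpoly_eval_add[OF hc] mpoly_eval_mult[OF hc] ring_hom_fun_add[OF e] ring_hom_fun_mult[OF e])
qed

lemma mpderiv_superset:
  assumes "finite S" "Poly_Mapping.keys p \<subseteq> S"
  shows "mpderiv v p = (\<Sum>a\<in>S. Poly_Mapping.single (a - Poly_Mapping.single v 1) (lk p a * real (lk a v)))"
  unfolding mpderiv_def using assms by (intro sum.mono_neutral_left) (auto simp: in_keys_iff)

lemma mpderiv_add: "mpderiv v (p + q) = mpderiv v p + mpderiv v q"
proof -
  have S: "finite (Poly_Mapping.keys p \<union> Poly_Mapping.keys q)" "Poly_Mapping.keys (p + q) \<subseteq> Poly_Mapping.keys p \<union> Poly_Mapping.keys q" by (simp_all add: keys_add)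
  show ?thesis
    using mpderiv_superset[OF S] mpderiv_superset[OF S(1), of p] mpderiv_superset[OF S(1), of q]
    by (simp add: lookup_add sum.distrib[symmetric] single_add[symmetric] algebra_simps)
qed

lemma mpderiv_single: "mpderiv v (Poly_Mapping.single a c) = Poly_Mapping.single (a - Poly_Mapping.single v 1) (c * real (lk a v))"
  using mpderiv_superset[of "{a}" "Poly_Mapping.single a c"] by (simp add: lookup_single)

lemma mpderiv_mult: "mpderiv v (p * q) = p * mpderiv v q + q * mpderiv v p"
proof (induction p rule: mpoly_additive_induct)
  case (1 a c)
  show ?case
  proof (induction q rule: mpoly_additive_induct)
    case (1 b d)
    let ?e = "Poly_Mapping.single v (1::nat)"
    \<comment> \<open>Subtraction of exponents is truncated. The two monomials differ only where the
      exponent of \<open>v\<close> is 0, and there the coefficient vanishes.\<close>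
    have ab: "Poly_Mapping.single (a + (b - ?e)) (c * (d * real (lk b v))) = Poly_Mapping.single (a + b - ?e) (c * (d * real (lk b v)))" for a b and c d :: real
    proof (cases "lk b v = 0")
      case False
      have "a + (b - ?e) = a + b - ?e" by (rule poly_mapping_eqI) (use False in \<open>auto simp: lookup_add lookup_minus lookup_single when_def\<close>)
      thus ?thesis by simp
    qed simp
    show ?case
      using ab[of a b c d] ab[of b a d c]
      by (simp add: mpderiv_single mult_single lookup_add add.commute[of b a] single_add[symmetric] algebra_simps)
  qed (simp add: distrib_left distrib_right mpderiv_add algebra_simps)
qed (simp add: distrib_left distrib_right mpderiv_add algebra_simps)

lemma mpderiv_mconst: "mpderiv v (mconst c) = 0" by (simp add: mconst_def mpderiv_single)

lemma mpderiv_mvar: "mpderiv v (mvar w) = (if v = w then 1 else 0)"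
  by (auto simp: mvar_def mpderiv_single lookup_single)

lemma meval_has_derivative:
  "((\<lambda>x. meval p x) has_derivative (\<lambda>h. \<Sum>v\<in>UNIV. meval (mpderiv v p) x * h $ v)) (at x)"
proof (induction p rule: mpoly_induct)
  case (const c)
  show ?case by (simp add: meval_mconst mpderiv_mconst meval_simps)
next
  case (var w)
  have "(\<Sum>v\<in>UNIV. meval (mpderiv v (mvar w)) x * h $ v) = h $ w" for h
  proof -
    have "(\<Sum>v\<in>UNIV. meval (mpderiv v (mvar w)) x * h $ v) = (\<Sum>v\<in>UNIV. if v = w then h $ w else 0)"
      by (intro sum.cong) (auto simp: mpderiv_mvar meval_simps)
    thus ?thesis by simp
  qed
  thus ?case by (simp add: meval_mvar bounded_linear_imp_has_derivative bounded_linear_vec_nth)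
next
  case (add p q)
  from has_derivative_add[OF add] show ?case
    by (simp add: meval_simps mpderiv_add sum.distrib distrib_right)
next
  case (mult p q)
  have 1: "meval (p * q) = (\<lambda>x. meval p x * meval q x)" by (rule ext) (simp add: meval_simps)
  have 2: "(\<lambda>h. \<Sum>v\<in>UNIV. meval (mpderiv v (p * q)) x * h $ v) =
    (\<lambda>h. meval p x * (\<Sum>v\<in>UNIV. meval (mpderiv v q) x * h $ v) + (\<Sum>v\<in>UNIV. meval (mpderiv v p) x * h $ v) * meval q x)"
    by (simp add: fun_eq_iff meval_simps mpderiv_mult sum.distrib distrib_right sum_distrib_left sum_distrib_right algebra_simps)
  show ?case unfolding 1 2 by (rule has_derivative_mult[OF mult])
qed

lemma continuous_on_meval: "continuous_on S (meval p)"
  using has_derivative_continuous[OF meval_has_derivative[of p]] by (auto intro: continuous_at_imp_continuous_on)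

lemma mdeg_le_iff: "mdeg p \<le> d \<longleftrightarrow> (\<forall>a\<in>Poly_Mapping.keys p. mdeg_mono a \<le> d)"
  by (simp add: mdeg_def)

lemma mdeg_mono_add: "mdeg_mono (a + b) = mdeg_mono a + mdeg_mono b"
  by (simp add: mdeg_mono_def lookup_add sum.distrib)

lemma mdeg_add: "mdeg (p + q) \<le> max (mdeg p) (mdeg q)"
  unfolding mdeg_le_iff using keys_add[of p q] mdeg_le_iff[of p "mdeg p"] mdeg_le_iff[of q "mdeg q"] by (auto simp: le_max_iff_disj)

lemma mdeg_mult: "mdeg (p * q) \<le> mdeg p + mdeg q"
  unfolding mdeg_le_iff
proof
  fix k assume "k \<in> Poly_Mapping.keys (p * q)"
  then obtain a b where "a \<in> Poly_Mapping.keys p" "b \<in> Poly_Mapping.keys q" "k = a + b" using keys_mult[of p q] by blast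
  thus "mdeg_mono k \<le> mdeg p + mdeg q"
    using mdeg_le_iff[of p "mdeg p"] mdeg_le_iff[of q "mdeg q"] by (auto simp: mdeg_mono_add intro!: add_mono)
qed

lemma mdeg_mconst: "mdeg (mconst c) = 0"
proof -
  have "mdeg (mconst c) \<le> 0" unfolding mdeg_le_iff by (auto simp: mconst_def mdeg_mono_def)
  thus ?thesis by simp
qed

section \<open>The residue field of a prime cone\<close>

lemma supp_prime_cone:
  assumes P: "prime_cone P"
  shows "0 \<in> supp P" "a \<in> supp P \<Longrightarrow> b \<in> supp P \<Longrightarrow> a + b \<in> supp P" "a \<in> supp P \<Longrightarrow> - a \<in> supp P"
    "a \<in> supp P \<Longrightarrow> a * c \<in> supp P" "a \<in> supp P \<Longrightarrow> c * a \<in> supp P"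
proof -
  have pre: "ring_preordering P" and tot: "\<And>a. a \<in> P \<or> - a \<in> P" using P by (auto simp: prime_cone_def)
  note d = ring_preorderingD[OF pre]
  show "0 \<in> supp P" using d(4) by (simp add: supp_def)
  show "a \<in> supp P \<Longrightarrow> b \<in> supp P \<Longrightarrow> a + b \<in> supp P" using d(2)[of a b] d(2)[of "-a" "-b"] by (simp add: supp_def)
  show "a \<in> supp P \<Longrightarrow> - a \<in> supp P" by (simp add: supp_def)
  have m: "a * c \<in> supp P" if "a \<in> supp P" for c
    using tot[of c] d(3)[of a c] d(3)[of "-a" c] d(3)[of a "-c"] d(3)[of "-a" "-c"] that by (auto simp: supp_def)
  show "a \<in> supp P \<Longrightarrow> a * c \<in> supp P" "a \<in> supp P \<Longrightarrow> c * a \<in> supp P" using m[of c] by (simp_all add: mult.commute)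
qed

lemma prime_cone_eval: "prime_cone {p. meval p x \<ge> 0}"
proof -
  have S: "supp {p. meval p x \<ge> 0} = {p. meval p x = 0}" by (auto simp: supp_def meval_simps)
  show ?thesis unfolding prime_cone_def S by (auto simp: ring_preordering_def meval_simps)
qed

text \<open>The Artin--Lang property of \<open>P\<close>. An equation is expressed by a polynomial
  and its negative, both in \<open>P\<close>.\<close>

definition has_real_points :: "'v::finite mpoly set \<Rightarrow> bool" where
  "has_real_points P \<longleftrightarrow> (\<forall>F. finite F \<longrightarrow> (\<exists>x. \<forall>f\<in>F. f \<in> P \<longrightarrow> meval f x \<ge> 0))"

text \<open>Either \<open>f\<close> is constant modulo the support, or some \<open>w\<close> is
  tangent to the variety of the support while \<open>f\<close> has nonzero derivative along it. The
  components of \<open>w\<close> are polynomials, so the statement does not mention the residue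
  field.\<close>

definition has_tangents :: "'v::finite mpoly set \<Rightarrow> bool" where
  "has_tangents P \<longleftrightarrow> (\<forall>f. (\<exists>v. f - mconst v \<in> supp P) \<or>
     (\<exists>w. (\<forall>g\<in>supp P. (\<Sum>v\<in>UNIV. mpderiv v g * w v) \<in> supp P) \<and> (\<Sum>v\<in>UNIV. mpderiv v f * w v) \<notin> supp P))"

text \<open>Types cannot depend on a prime cone, so the residue field of an arbitrary cone is not available as a type.
  Instead we fix one cone that violates the two properties to be proved, if there is any, and
  show that its residue field leads to a contradiction.\<close>

definition exceptional_cone :: "'v::finite mpoly set" where
  "exceptional_cone = (if \<exists>P :: 'v mpoly set. prime_cone P \<and> \<not> (has_real_points P \<and> has_tangents P)
     then SOME P. prime_cone P \<and> \<not> (has_real_points P \<and> has_tangents P) else {p. meval p 0 \<ge> 0})"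

lemma prime_exceptional_cone: "prime_cone exceptional_cone"
proof (cases "\<exists>P :: 'a mpoly set. prime_cone P \<and> \<not> (has_real_points P \<and> has_tangents P)")
  case True
  from someI_ex[OF this] True show ?thesis by (simp add: exceptional_cone_def)
next
  case False
  thus ?thesis using prime_cone_eval[of 0] by (simp only: exceptional_cone_def if_False)
qed

lemma exceptional_cone_suffices:
  assumes "has_real_points (exceptional_cone :: 'v::finite mpoly set)" "has_tangents (exceptional_cone :: 'v mpoly set)" "prime_cone (P :: 'v mpoly set)"
  shows "has_real_points P" "has_tangents P"
proof -
  have "\<not> (\<exists>P :: 'v mpoly set. prime_cone P \<and> \<not> (has_real_points P \<and> has_tangents P))"
  proof
    assume ex: "\<exists>P :: 'v mpoly set. prime_cone P \<and> \<not> (has_real_points P \<and> has_tangents P)"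
    from someI_ex[OF this] assms(1,2) show False unfolding exceptional_cone_def if_P[OF ex] by blast
  qed
  thus "has_real_points P" "has_tangents P" using assms(3) by blast+
qed

lemmas exceptional_supp = supp_prime_cone[OF prime_exceptional_cone]

lemma exceptional_preordering: "ring_preordering exceptional_cone" and exceptional_total: "a \<in> exceptional_cone \<or> - a \<in> exceptional_cone"
  and exceptional_m1: "-1 \<notin> exceptional_cone" and exceptional_prime: "a * b \<in> supp exceptional_cone \<Longrightarrow> a \<in> supp exceptional_cone \<or> b \<in> supp exceptional_cone"
  using prime_exceptional_cone unfolding prime_cone_def by blast+

lemmas exceptional_pre = ring_preorderingD[OF exceptional_preordering]

quotient_type (overloaded) 'v residue_ring = "'v::finite mpoly" / "\<lambda>a b. a - b \<in> supp exceptional_cone"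
  morphisms residue_rep residue_class
proof (rule equivpI)
  show "reflp (\<lambda>a b::'v mpoly. a - b \<in> supp exceptional_cone)" by (rule reflpI) (simp add: exceptional_supp)
  show "symp (\<lambda>a b::'v mpoly. a - b \<in> supp exceptional_cone)"
  proof (rule sympI)
    fix a b :: "'v mpoly" assume "a - b \<in> supp exceptional_cone"
    from exceptional_supp(3)[OF this] show "b - a \<in> supp exceptional_cone" by simp
  qed
  show "transp (\<lambda>a b::'v mpoly. a - b \<in> supp exceptional_cone)"
  proof (rule transpI)
    fix a b c :: "'v mpoly" assume "a - b \<in> supp exceptional_cone" "b - c \<in> supp exceptional_cone"
    from exceptional_supp(2)[OF this] show "a - c \<in> supp exceptional_cone" by simp
  qed
qed

instantiation residue_ring :: (finite) comm_ring_1
begin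
lift_definition zero_residue_ring :: "'a residue_ring" is 0 .
lift_definition one_residue_ring :: "'a residue_ring" is 1 .
lift_definition plus_residue_ring :: "'a residue_ring \<Rightarrow> 'a residue_ring \<Rightarrow> 'a residue_ring" is "(+)"
proof -
  fix a b c d :: "'a mpoly" assume "a - b \<in> supp exceptional_cone" "c - d \<in> supp exceptional_cone"
  from exceptional_supp(2)[OF this] show "a + c - (b + d) \<in> supp exceptional_cone" by (simp add: algebra_simps)
qed
lift_definition uminus_residue_ring :: "'a residue_ring \<Rightarrow> 'a residue_ring" is uminus
proof -
  fix a b :: "'a mpoly" assume "a - b \<in> supp exceptional_cone"
  from exceptional_supp(3)[OF this] show "- a - - b \<in> supp exceptional_cone" by (simp add: algebra_simps)
qed
lift_definition minus_residue_ring :: "'a residue_ring \<Rightarrow> 'a residue_ring \<Rightarrow> 'a residue_ring" is "(-)"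
proof -
  fix a b c d :: "'a mpoly" assume "a - b \<in> supp exceptional_cone" "c - d \<in> supp exceptional_cone"
  hence "(a - b) + - (c - d) \<in> supp exceptional_cone" by (intro exceptional_supp(2,3))
  thus "a - c - (b - d) \<in> supp exceptional_cone" by (simp add: algebra_simps)
qed
lift_definition times_residue_ring :: "'a residue_ring \<Rightarrow> 'a residue_ring \<Rightarrow> 'a residue_ring" is "(*)"
proof -
  fix a b c d :: "'a mpoly" assume "a - b \<in> supp exceptional_cone" "c - d \<in> supp exceptional_cone"
  hence "a * (c - d) + (a - b) * d \<in> supp exceptional_cone" by (intro exceptional_supp)
  thus "a * c - b * d \<in> supp exceptional_cone" by (simp add: algebra_simps)
qed
instance
proof
  fix a b c :: "'a residue_ring"
  note z = exceptional_supp(1)[where ?'a = 'a]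
  show "a * b * c = a * (b * c)" "a * b = b * a" "1 * a = a" "a + b + c = a + (b + c)" "a + b = b + a" "0 + a = a"
    "- a + a = 0" "a - b = a + - b" "(a + b) * c = a * c + b * c"
    by (transfer; simp add: z algebra_simps)+
  show "(0::'a residue_ring) \<noteq> 1"
  proof (transfer, rule notI)
    assume "(0::'a mpoly) - 1 \<in> supp exceptional_cone"
    thus False using exceptional_m1 by (auto simp: supp_def)
  qed
qed
end

instance residue_ring :: (finite) idom
proof
  fix a b :: "'a residue_ring" assume "a \<noteq> 0" "b \<noteq> 0"
  thus "a * b \<noteq> 0" by transfer (use exceptional_prime in auto)
qed

instantiation residue_ring :: (finite) linordered_idom
begin
lift_definition less_eq_residue_ring :: "'a residue_ring \<Rightarrow> 'a residue_ring \<Rightarrow> bool" is "\<lambda>a b. b - a \<in> exceptional_cone"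
proof -
  have *: "d - c \<in> exceptional_cone" if "a - c \<in> supp exceptional_cone" "b - d \<in> supp exceptional_cone" "b - a \<in> exceptional_cone" for a b c d :: "'a mpoly"
  proof -
    have "(b - a) + ((a - c) + - (b - d)) \<in> exceptional_cone" using that by (intro exceptional_pre(2)) (auto simp: supp_def)
    thus ?thesis by (simp add: algebra_simps)
  qed
  fix a b c d :: "'a mpoly" assume "a - b \<in> supp exceptional_cone" "c - d \<in> supp exceptional_cone"
  thus "(c - a \<in> exceptional_cone) = (d - b \<in> exceptional_cone)"
    using *[of a b c d] *[of b a d c] exceptional_supp(3)[of "a - b"] exceptional_supp(3)[of "c - d"] by auto
qed
definition less_residue_ring :: "'a residue_ring \<Rightarrow> 'a residue_ring \<Rightarrow> bool" where "less_residue_ring x y \<longleftrightarrow> x \<le> y \<and> \<not> y \<le> x"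
definition abs_residue_ring :: "'a residue_ring \<Rightarrow> 'a residue_ring" where "abs_residue_ring x = (if x < 0 then - x else x)"
definition sgn_residue_ring :: "'a residue_ring \<Rightarrow> 'a residue_ring" where "sgn_residue_ring x = (if x = 0 then 0 else if 0 < x then 1 else - 1)"
instance
proof
  fix x y z :: "'a residue_ring"
  show "x < y \<longleftrightarrow> x \<le> y \<and> \<not> y \<le> x" by (simp add: less_residue_ring_def)
  show "x \<le> x" by transfer (simp add: exceptional_pre)
  show "x \<le> z" if "x \<le> y" "y \<le> z"
    using that by transfer (use exceptional_pre(2) in fastforce)
  show anti: "x = y" if "x \<le> y" "y \<le> x" for x y :: "'a residue_ring"
    using that by transfer (simp add: supp_def)
  show "x \<le> y \<or> y \<le> x"
  proof (transfer)
    fix x y :: "'a mpoly"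
    show "y - x \<in> exceptional_cone \<or> x - y \<in> exceptional_cone" using exceptional_total[of "y - x"] by simp
  qed
  show addm: "x \<le> y \<Longrightarrow> z + x \<le> z + y" by transfer simp
  have multnn: "0 \<le> x * y" if "0 \<le> x" "0 \<le> y" for x y :: "'a residue_ring"
    using that by transfer (simp add: exceptional_pre)
  show "z * x < z * y" if "x < y" "0 < z"
  proof -
    have d: "0 \<le> y - x" "0 \<le> z" using that by (simp_all add: less_residue_ring_def) (transfer, simp)+
    from multnn[OF d(2) d(1)] have "z * x \<le> z * y" by (transfer, simp add: algebra_simps)
    moreover have "z * x \<noteq> z * y" using that by (auto simp: less_residue_ring_def)
    ultimately show ?thesis using anti[of "z * x" "z * y"] unfolding less_residue_ring_def by blast
  qed
  show "\<bar>x\<bar> = (if x < 0 then - x else x)" by (simp add: abs_residue_ring_def)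
  show "sgn x = (if x = 0 then 0 else if 0 < x then 1 else - 1)" by (simp add: sgn_residue_ring_def)
qed
end

definition residue :: "'v::finite mpoly \<Rightarrow> 'v residue_ring fract" where
  "residue p = Fract (residue_class p) 1"


lemma residue_hom: "ring_hom_fun residue"
proof -
  have a: "residue_class (p + q) = residue_class p + residue_class q" for p q :: "'a mpoly" by (rule plus_residue_ring.abs_eq[symmetric])
  have m: "residue_class (p * q) = residue_class p * residue_class q" for p q :: "'a mpoly" by (rule times_residue_ring.abs_eq[symmetric])
  have o: "residue_class (1 :: 'a mpoly) = 1" by (rule one_residue_ring.abs_eq[symmetric])
  show ?thesis unfolding ring_hom_fun_def residue_def a m o by (simp add: One_fract_def)
qed

lemma residue_nonneg_iff: "residue p \<ge> 0 \<longleftrightarrow> p \<in> exceptional_cone"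
proof -
  have "residue p \<ge> 0 \<longleftrightarrow> residue_class p \<ge> 0" by (simp add: residue_def Zero_fract_def)
  also have "\<dots> \<longleftrightarrow> p \<in> exceptional_cone" unfolding zero_residue_ring.abs_eq less_eq_residue_ring.abs_eq by simp
  finally show ?thesis .
qed

lemma residue_eq_0_iff: "residue p = 0 \<longleftrightarrow> p \<in> supp exceptional_cone"
  using residue_nonneg_iff[of p] residue_nonneg_iff[of "-p"] ring_hom_fun_uminus[OF residue_hom, of p] by (auto simp: supp_def)

lemma residue_fraction: "\<exists>a b. residue b \<noteq> 0 \<and> residue a = residue b * y"
proof (cases y)
  case (Fract u w)
  obtain a b where ab: "u = residue_class a" "w = residue_class b"
    using Quotient3_abs_rep[OF Quotient3_residue_ring] by metis
  have "residue b \<noteq> 0" using Fract ab by (simp add: residue_def Zero_fract_def eq_fract)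
  moreover have "residue a = residue b * y" using Fract ab by (simp add: residue_def eq_fract)
  ultimately show ?thesis by blast
qed

lemma common_denominator:
  assumes "finite S"
  shows "\<exists>b. residue b \<noteq> 0 \<and> (\<forall>s\<in>S. \<exists>a. residue a = residue b * y s)"
  using assms
proof (induction S rule: finite_induct)
  case empty
  show ?case by (rule exI[of _ 1]) (simp add: ring_hom_fun_one[OF residue_hom])
next
  case (insert s S)
  then obtain b where b: "residue b \<noteq> 0" "\<forall>s\<in>S. \<exists>a. residue a = residue b * y s" by blast
  obtain a' b' where ab': "residue b' \<noteq> 0" "residue a' = residue b' * y s" using residue_fraction by blast
  have "\<exists>a. residue a = residue (b * b') * y r" if r: "r \<in> insert s S" for r
  proof (cases "r = s")
    case True
    thus ?thesis using ab' by (intro exI[of _ "b * a'"]) (simp add: ring_hom_fun_mult[OF residue_hom])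
  next
    case False
    then obtain a where "residue a = residue b * y r" using b r by blast
    thus ?thesis by (intro exI[of _ "b' * a"]) (simp add: ring_hom_fun_mult[OF residue_hom])
  qed
  thus ?case using b ab' by (intro exI[of _ "b * b'"]) (simp add: ring_hom_fun_mult[OF residue_hom])
qed

lemma real_constants_hom: "ring_hom_fun (\<lambda>c. residue (mconst c))"
  using residue_hom mconst_1 mconst_add mconst_mult unfolding ring_hom_fun_def by metis

text \<open>Nonnegative reals are squares, so every homomorphism into an ordered field respects the
  order.\<close>

lemma hom_real_nonneg:
  fixes \<iota> :: "real \<Rightarrow> 'k::linordered_field"
  assumes "ring_hom_fun \<iota>" "c \<ge> 0" shows "\<iota> c \<ge> 0"
proof -
  have "\<iota> c = \<iota> (sqrt c) * \<iota> (sqrt c)" using assms by (simp add: ring_hom_fun_mult[OF assms(1), symmetric])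
  thus ?thesis by simp
qed

lemma hom_real_pos:
  fixes \<iota> :: "real \<Rightarrow> 'k::linordered_field"
  assumes "ring_hom_fun \<iota>" "c > 0" shows "\<iota> c > 0"
proof -
  have "\<iota> c * \<iota> (1 / c) = 1" using assms by (simp add: ring_hom_fun_mult[OF assms(1), symmetric] ring_hom_fun_one[OF assms(1)])
  hence "\<iota> c \<noteq> 0" by auto
  thus ?thesis using hom_real_nonneg[OF assms(1), of c] assms(2) by simp
qed

lemma hom_real_same_sign:
  fixes \<iota> :: "real \<Rightarrow> 'k::linordered_field"
  assumes "ring_hom_fun \<iota>" shows "same_sign c (\<iota> c)"
  using hom_real_pos[OF assms, of c] hom_real_pos[OF assms, of "-c"] ring_hom_fun_zero[OF assms] ring_hom_fun_uminus[OF assms, of c]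
  by (cases c "0::real" rule: linorder_cases) (auto simp: same_sign_def)

text \<open>If \<open>f\<close> is algebraic over the reals in the residue field, it is a real
  constant there. Otherwise a derivation with value 1 at \<open>f\<close> exists; its values at the
  variables, multiplied by a common denominator, give \<open>w\<close>.\<close>

lemma exceptional_cone_has_tangents: "has_tangents (exceptional_cone :: 'v::finite mpoly set)"
  unfolding has_tangents_def
proof (intro allI)
  fix f :: "'v mpoly"
  let ?\<iota> = "\<lambda>c. residue (mconst c) :: 'v residue_ring fract"
  note hom = real_constants_hom[where ?'a = 'v] and rh = residue_hom[where ?'a = 'v]
  show "(\<exists>v. f - mconst v \<in> supp exceptional_cone) \<or> (\<exists>w. (\<forall>g\<in>supp exceptional_cone. (\<Sum>v\<in>UNIV. mpderiv v g * w v) \<in> supp exceptional_cone) \<and>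
     (\<Sum>v\<in>UNIV. mpderiv v f * w v) \<notin> supp exceptional_cone)"
  proof (cases "\<exists>\<pi>. \<pi> \<noteq> 0 \<and> poly (map_poly ?\<iota> \<pi>) (residue f) = 0")
    case True
    then obtain v where "residue f = ?\<iota> v" using algebraic_over_reals_is_real[OF hom hom_real_pos[OF hom]] by blast
    hence "residue (f - mconst v) = 0" by (simp add: ring_hom_fun_diff[OF rh])
    thus ?thesis by (auto simp: residue_eq_0_iff)
  next
    case False
    have "\<exists>L D. partial_derivation L D \<and> range ?\<iota> \<subseteq> L \<and> (\<forall>c. D (?\<iota> c) = 0) \<and> residue f \<in> L \<and> D (residue f) = 1 \<and>
      range (\<lambda>v. residue (mvar v)) \<subseteq> L"
      by (rule derivation_transcendental[OF hom]) (use False in blast, simp)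
    then obtain L D where pd: "partial_derivation L D" and LD: "range ?\<iota> \<subseteq> L" "\<And>c. D (?\<iota> c) = 0" "D (residue f) = 1"
      "range (\<lambda>v. residue (mvar v)) \<subseteq> L" by (elim exE conjE) blast
    \<comment> \<open>The chain rule: \<open>L\<close> contains the constants and the variables, and
      \<open>D\<close> kills the constants.\<close>
    have D: "residue g \<in> L \<and> D (residue g) = (\<Sum>v\<in>UNIV. residue (mpderiv v g) * D (residue (mvar v)))" for g
    proof (induction g rule: mpoly_induct)
      case (const c)
      show ?case using LD by (auto simp: mpderiv_mconst ring_hom_fun_zero[OF rh])
    next
      case (var u)
      have "(\<Sum>v\<in>UNIV. residue (mpderiv v (mvar u)) * D (residue (mvar v))) = (\<Sum>v\<in>UNIV. if v = u then D (residue (mvar u)) else 0)"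
        by (intro sum.cong) (auto simp: mpderiv_mvar ring_hom_fun_zero[OF rh] ring_hom_fun_one[OF rh])
      thus ?case using LD(4) by auto
    next
      case (add p q)
      thus ?case by (simp add: ring_hom_fun_add[OF rh] mpderiv_add pd_plus[OF pd] pd_D_plus[OF pd] distrib_right sum.distrib)
    next
      case (mult p q)
      thus ?case by (simp add: ring_hom_fun_mult[OF rh] ring_hom_fun_add[OF rh] mpderiv_mult pd_times[OF pd] pd_D_times[OF pd]
          distrib_right sum.distrib sum_distrib_left mult.assoc)
    qed
    obtain b where b: "residue b \<noteq> 0" "\<forall>v\<in>UNIV. \<exists>a. residue a = residue b * D (residue (mvar v))"
      using common_denominator[of UNIV "\<lambda>v. D (residue (mvar v))"] by auto
    have "\<forall>v. \<exists>a. residue a = residue b * D (residue (mvar v))" using b(2) by blast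
    then obtain w where w: "\<And>v. residue (w v) = residue b * D (residue (mvar v))" using choice[of "\<lambda>v a. residue a = residue b * D (residue (mvar v))"] by blast
    have S: "residue (\<Sum>v\<in>UNIV. mpderiv v g * w v) = residue b * D (residue g)" for g
      using D[of g] by (simp add: ring_hom_fun_sum[OF rh] ring_hom_fun_mult[OF rh] w sum_distrib_left ac_simps)
    have "(\<Sum>v\<in>UNIV. mpderiv v g * w v) \<in> supp exceptional_cone" if "g \<in> supp exceptional_cone" for g
      using S[of g] that pd_D_0[OF pd] by (simp add: residue_eq_0_iff[symmetric])
    moreover have "(\<Sum>v\<in>UNIV. mpderiv v f * w v) \<notin> supp exceptional_cone"
      using S[of f] LD(3) b(1) by (simp add: residue_eq_0_iff[symmetric])
    ultimately show ?thesis by blast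
  qed
qed

section \<open>Transfer of sign conditions to the reals\<close>

definition split_var :: "'v::finite \<Rightarrow> 'v mpoly \<Rightarrow> 'v mpoly poly" where
  "split_var w p = (\<Sum>a\<in>Poly_Mapping.keys p. monom (Poly_Mapping.single (a - Poly_Mapping.single w (lk a w)) (lk p a)) (lk a w))"

lemma map_poly_hom_sum:
  "ring_hom_fun e \<Longrightarrow> map_poly e (sum g A) = (\<Sum>a\<in>A. map_poly e (g a))"
  by (induction A rule: infinite_finite_induct) (simp_all add: map_poly_hom_add)

text \<open>The coefficients produced by \<open>split_var\<close> do not contain \<open>w\<close>,
  so they may be evaluated with \<open>w\<close> set to 0. They remain in the same polynomial ring,
  which lets an induction over variables stay within one type.\<close>

lemma mpoly_eval_split_var:
  fixes \<xi> :: "'v::finite \<Rightarrow> 'k::comm_ring_1"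
  assumes hom: "ring_hom_fun \<iota>"
  shows "mpoly_eval \<iota> \<xi> p = poly (map_poly (mpoly_eval \<iota> (\<xi>(w := 0))) (split_var w p)) (\<xi> w)"
proof -
  define \<zeta> where "\<zeta> = \<xi>(w := 0)"
  have \<zeta>: "\<zeta> w = 0" "\<And>v. v \<noteq> w \<Longrightarrow> \<zeta> v = \<xi> v" by (auto simp: \<zeta>_def)
  note gh = mpoly_eval_hom[OF hom, of \<zeta>]
  have pr: "(\<Prod>v\<in>UNIV. \<xi> v ^ lk a v) = (\<Prod>v\<in>UNIV. \<zeta> v ^ lk (a - Poly_Mapping.single w (lk a w)) v) * \<xi> w ^ lk a w" for a
  proof -
    have "(\<Prod>v\<in>UNIV. \<xi> v ^ lk a v) = (\<Prod>v\<in>UNIV - {w}. \<xi> v ^ lk a v) * \<xi> w ^ lk a w"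
      by (subst prod.remove[of UNIV w]) (simp_all add: mult.commute)
    also have "(\<Prod>v\<in>UNIV - {w}. \<xi> v ^ lk a v) = (\<Prod>v\<in>UNIV - {w}. \<zeta> v ^ lk (a - Poly_Mapping.single w (lk a w)) v)"
      by (intro prod.cong) (auto simp: lookup_minus lookup_single \<zeta>)
    also have "\<dots> = (\<Prod>v\<in>UNIV. \<zeta> v ^ lk (a - Poly_Mapping.single w (lk a w)) v)"
      by (subst prod.remove[of UNIV w]) (simp_all add: lookup_minus lookup_single)
    finally show ?thesis .
  qed
  have "poly (map_poly (mpoly_eval \<iota> \<zeta>) (split_var w p)) (\<xi> w) =
    (\<Sum>a\<in>Poly_Mapping.keys p. mpoly_eval \<iota> \<zeta> (Poly_Mapping.single (a - Poly_Mapping.single w (lk a w)) (lk p a)) * \<xi> w ^ lk a w)"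
    unfolding split_var_def map_poly_hom_sum[OF gh] by (simp add: poly_sum map_poly_monom ring_hom_fun_zero[OF gh] poly_monom)
  also have "\<dots> = mpoly_eval \<iota> \<xi> p" unfolding mpoly_eval_def[of \<iota> \<xi> p]
    by (intro sum.cong refl) (simp add: mpoly_eval_single[OF hom] pr mult.assoc)
  finally show ?thesis by (simp add: \<zeta>_def)
qed

text \<open>\<open>S\<close> holds the variables whose values are not yet real. To treat
  \<open>w\<close>, the induction hypothesis is applied to the coefficients \<open>C\<close> that
  control \<open>F\<close> as polynomials in \<open>w\<close>; once their signs are realized by real
  values, \<open>sign_transfer\<close> supplies the value of \<open>w\<close>.\<close>

lemma sign_realization:
  fixes \<iota> :: "real \<Rightarrow> 'k::real_closed"
  assumes hom: "ring_hom_fun \<iota>" and "finite S"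
  shows "finite F \<Longrightarrow> (\<forall>v. v \<notin> S \<longrightarrow> \<xi> v = \<iota> (a v)) \<Longrightarrow>
    \<exists>x. (\<forall>v. v \<notin> S \<longrightarrow> x v = a v) \<and> (\<forall>f\<in>F. same_sign (mpoly_eval (\<lambda>x. x) x f) (mpoly_eval \<iota> \<xi> f))"
  using \<open>finite S\<close>
proof (induction S arbitrary: F \<xi> a rule: finite_induct)
  case (empty F \<xi> a)
  have "\<xi> = (\<lambda>v. \<iota> (a v))" using empty by auto
  have eh: "ring_hom_fun (\<lambda>p. \<iota> (mpoly_eval (\<lambda>x. x) a p))"
    using mpoly_eval_hom[OF id_hom, of a] hom unfolding ring_hom_fun_def by simp
  have "mpoly_eval \<iota> \<xi> f = \<iota> (mpoly_eval (\<lambda>x. x) a f)" for f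
    using hom_eq_mpoly_eval[OF eh, of f] \<open>\<xi> = _\<close> by (simp add: mpoly_eval_mconst[OF id_hom] mpoly_eval_mvar[OF id_hom])
  thus ?case using hom_real_same_sign[OF hom] by (intro exI[of _ a]) simp
next
  case (insert w S F \<xi> a)
  have "finite (split_var w ` F)" using insert.prems by simp
  have "\<exists>C. finite C \<and> (\<forall>(e1 :: 'a mpoly \<Rightarrow> real) (e2 :: 'a mpoly \<Rightarrow> 'k).
    ring_hom_fun e1 \<longrightarrow> ring_hom_fun e2 \<longrightarrow> (\<forall>c\<in>C. same_sign (e1 c) (e2 c)) \<longrightarrow>
    (\<forall>y. \<exists>x. \<forall>f\<in>split_var w ` F. same_sign (poly (map_poly e1 f) x) (poly (map_poly e2 f) y)))"
    by (rule sign_transfer) fact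
  then obtain C where C: "finite C" and T: "\<forall>(e1 :: 'a mpoly \<Rightarrow> real) (e2 :: 'a mpoly \<Rightarrow> 'k).
    ring_hom_fun e1 \<longrightarrow> ring_hom_fun e2 \<longrightarrow> (\<forall>c\<in>C. same_sign (e1 c) (e2 c)) \<longrightarrow>
    (\<forall>y. \<exists>x. \<forall>f\<in>split_var w ` F. same_sign (poly (map_poly e1 f) x) (poly (map_poly e2 f) y))"
    by (elim exE conjE)
  have "\<forall>v. v \<notin> S \<longrightarrow> (\<xi>(w := 0)) v = \<iota> ((a(w := 0)) v)" using insert.prems ring_hom_fun_zero[OF hom] by auto
  from insert.IH[OF C this] obtain x where x: "\<forall>v. v \<notin> S \<longrightarrow> x v = (a(w := 0)) v"
    "\<forall>f\<in>C. same_sign (mpoly_eval (\<lambda>x. x) x f) (mpoly_eval \<iota> (\<xi>(w := 0)) f)" by blast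
  have xw: "x w = 0" using x(1) insert.hyps by auto
  obtain x0 where x0: "\<forall>f\<in>F. same_sign (poly (map_poly (mpoly_eval (\<lambda>x. x) x) (split_var w f)) x0) (poly (map_poly (mpoly_eval \<iota> (\<xi>(w := 0))) (split_var w f)) (\<xi> w))"
    using T[rule_format, OF mpoly_eval_hom[OF id_hom, of x] mpoly_eval_hom[OF hom, of "\<xi>(w := 0)"], OF x(2)[rule_format], of "\<xi> w"] by auto
  define x' where "x' = x(w := x0)"
  have "x'(w := 0) = x" "x' w = x0" using xw by (auto simp: x'_def)
  hence "\<forall>f\<in>F. same_sign (mpoly_eval (\<lambda>x. x) x' f) (mpoly_eval \<iota> \<xi> f)"
    using x0 mpoly_eval_split_var[OF id_hom, of x' _ w] mpoly_eval_split_var[OF hom, of \<xi> _ w] by simp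
  moreover have "\<forall>v. v \<notin> insert w S \<longrightarrow> x' v = a v" using x(1) by (auto simp: x'_def)
  ultimately show ?case by blast
qed

text \<open>The images of the variables in the real closure of the residue field form a point at
  which every member of the cone is nonnegative; its signs on \<open>F\<close> are then realized
  over the reals.\<close>

lemma exceptional_cone_has_real_points: "has_real_points (exceptional_cone :: 'v::finite mpoly set)"
  unfolding has_real_points_def
proof (intro allI impI)
  fix F :: "'v mpoly set" assume F: "finite F"
  define e where "e p = to_rc (residue p)" for p :: "'v mpoly"
  have eh: "ring_hom_fun e" using to_rc_hom residue_hom unfolding ring_hom_fun_def e_def by metis
  have hc: "ring_hom_fun (\<lambda>c. e (mconst c))" using eh mconst_1 mconst_add mconst_mult unfolding ring_hom_fun_def by metis
  obtain x where x: "\<forall>f\<in>F. same_sign (mpoly_eval (\<lambda>x. x) x f) (mpoly_eval (\<lambda>c. e (mconst c)) (\<lambda>v. e (mvar v)) f)"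
    using sign_realization[OF hc finite_class.finite_UNIV F] by auto
  have "meval f (\<chi> v. x v) \<ge> 0" if "f \<in> F" "f \<in> exceptional_cone" for f
  proof -
    have "e f \<ge> 0" using that(2) by (simp add: e_def to_rc_nonneg residue_nonneg_iff)
    moreover have "same_sign (meval f (\<chi> v. x v)) (e f)" using x that(1) hom_eq_mpoly_eval[OF eh, of f] by (simp add: meval_conv_mpoly_eval)
    ultimately show ?thesis by (simp add: same_sign_def not_less[symmetric])
  qed
  thus "\<exists>x. \<forall>f\<in>F. f \<in> exceptional_cone \<longrightarrow> meval f x \<ge> 0" by blast
qed

lemmas Artin_Lang = exceptional_cone_suffices(1)[OF exceptional_cone_has_real_points exceptional_cone_has_tangents, unfolded has_real_points_def, rule_format]
lemmas tangent_vectors = exceptional_cone_suffices(2)[OF exceptional_cone_has_real_points exceptional_cone_has_tangents, unfolded has_tangents_def, rule_format]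

section \<open>Certificates from prime cones\<close>

lemma SOS_add: "p \<in> SOS \<Longrightarrow> q \<in> SOS \<Longrightarrow> p + q \<in> SOS"
proof -
  assume "p \<in> SOS" "q \<in> SOS"
  then obtain ps qs where "p = (\<Sum>q\<leftarrow>ps. q * q)" "q = (\<Sum>q\<leftarrow>qs. q * q)" by (auto simp: SOS_def)
  thus ?thesis unfolding SOS_def by (intro CollectI exI[of _ "ps @ qs"]) simp
qed

lemma SOS_square: "q * q \<in> SOS"
  unfolding SOS_def by (intro CollectI exI[of _ "[q]"]) simp

lemma SOS_0: "0 \<in> SOS"
  unfolding SOS_def by (intro CollectI exI[of _ "[]"]) simp

lemma SOS_square_mult: "p \<in> SOS \<Longrightarrow> a * a * p \<in> SOS"
proof -
  assume "p \<in> SOS"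
  then obtain ps where ps: "p = (\<Sum>q\<leftarrow>ps. q * q)" by (auto simp: SOS_def)
  have "a * a * p = (\<Sum>q\<leftarrow>map (\<lambda>q. a * q) ps. q * q)"
    unfolding ps by (simp add: sum_list_const_mult[symmetric] o_def mult_ac)
  thus ?thesis unfolding SOS_def by blast
qed

lemma ring_preordering_SOS: "ring_preordering (SOS :: 'v::finite mpoly set)"
  unfolding ring_preordering_def
proof (intro conjI allI ballI)
  fix p q :: "'v mpoly" assume p: "p \<in> SOS" and q: "q \<in> SOS"
  show "p + q \<in> SOS" by (rule SOS_add[OF p q])
  obtain ps where ps: "p = (\<Sum>q\<leftarrow>ps. q * q)" using p by (auto simp: SOS_def)
  show "p * q \<in> SOS" unfolding ps
    by (induction ps) (simp_all add: SOS_0 distrib_right SOS_add SOS_square_mult[OF q])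
qed (rule SOS_square)

lemma mconst_nonneg_square: "c \<ge> 0 \<Longrightarrow> mconst c = mconst (sqrt c) * mconst (sqrt c)"
  by (simp add: mconst_mult[symmetric])

definition quadratic_module :: "'v::finite mpoly set \<Rightarrow> bool" where
  "quadratic_module M \<longleftrightarrow> 1 \<in> M \<and> (\<forall>a\<in>M. \<forall>b\<in>M. a + b \<in> M) \<and> (\<forall>a. \<forall>m\<in>M. a * a * m \<in> M)"

lemma quadratic_moduleD:
  assumes "quadratic_module M"
  shows "a \<in> M \<Longrightarrow> b \<in> M \<Longrightarrow> a + b \<in> M" "m \<in> M \<Longrightarrow> a * a * m \<in> M" "a * a \<in> M" "0 \<in> M"
proof -
  have sq: "a * a * m \<in> M" if "m \<in> M" for a m using assms that by (auto simp: quadratic_module_def)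
  show "a \<in> M \<Longrightarrow> b \<in> M \<Longrightarrow> a + b \<in> M" using assms by (auto simp: quadratic_module_def)
  show "m \<in> M \<Longrightarrow> a * a * m \<in> M" by (rule sq)
  show "a * a \<in> M" "0 \<in> M" using sq[of 1 a] sq[of 1 0] assms by (auto simp: quadratic_module_def)
qed

lemma quadratic_module_SOS_mult:
  assumes M: "quadratic_module M" and s: "s \<in> SOS" and m: "m \<in> M"
  shows "m * s \<in> M"
proof -
  obtain ps where ps: "s = (\<Sum>q\<leftarrow>ps. q * q)" using s by (auto simp: SOS_def)
  show ?thesis unfolding ps
    by (induction ps) (use quadratic_moduleD[OF M] m in \<open>simp_all add: distrib_left mult.commute[of m]\<close>)
qed

lemma quadratic_module_SOS: "quadratic_module M \<Longrightarrow> s \<in> SOS \<Longrightarrow> s \<in> M"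
  using quadratic_module_SOS_mult[of M s 1] by (simp add: quadratic_module_def)

lemma quadratic_module_scale:
  assumes "quadratic_module M" "m \<in> M" "c \<ge> 0" shows "mconst c * m \<in> M"
  unfolding mconst_nonneg_square[OF assms(3)] by (rule quadratic_moduleD(2)[OF assms(1,2)])

lemma Ideal_mem: "finite H \<Longrightarrow> h \<in> H \<Longrightarrow> h * a \<in> Ideal H"
proof -
  assume H: "finite H" "h \<in> H"
  have "(\<Sum>k\<in>H. k * (if k = h then a else 0)) = (\<Sum>k\<in>H. if k = h then h * a else 0)" by (intro sum.cong) auto
  also have "\<dots> = h * a" using H by simp
  finally show ?thesis unfolding Ideal_def by (intro CollectI exI[of _ "\<lambda>k. if k = h then a else 0"]) simp
qed

lemma Ideal_add: "p \<in> Ideal H \<Longrightarrow> q \<in> Ideal H \<Longrightarrow> p + q \<in> Ideal H"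
proof -
  assume "p \<in> Ideal H" "q \<in> Ideal H"
  then obtain a b where "p = (\<Sum>h\<in>H. h * a h)" "q = (\<Sum>h\<in>H. h * b h)" by (auto simp: Ideal_def)
  thus ?thesis unfolding Ideal_def by (intro CollectI exI[of _ "\<lambda>h. a h + b h"]) (simp add: sum.distrib distrib_left)
qed

lemma Ideal_mult: "p \<in> Ideal H \<Longrightarrow> p * q \<in> Ideal H"
proof -
  assume "p \<in> Ideal H"
  then obtain a where "p = (\<Sum>h\<in>H. h * a h)" by (auto simp: Ideal_def)
  thus ?thesis unfolding Ideal_def by (intro CollectI exI[of _ "\<lambda>h. a h * q"]) (simp add: sum_distrib_right mult.assoc)
qed

lemma Ideal_0: "0 \<in> Ideal H"
  unfolding Ideal_def by (intro CollectI exI[of _ "\<lambda>h. 0"]) simp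

lemma meval_Ideal: "p \<in> Ideal H \<Longrightarrow> \<forall>h\<in>H. meval h u = 0 \<Longrightarrow> meval p u = 0"
  by (auto simp: Ideal_def meval_simps)

lemma meval_SOS: "p \<in> SOS \<Longrightarrow> meval p u \<ge> 0"
proof -
  assume "p \<in> SOS"
  then obtain ps where ps: "p = (\<Sum>q\<leftarrow>ps. q * q)" by (auto simp: SOS_def)
  show ?thesis unfolding ps by (induction ps) (simp_all add: meval_simps)
qed

definition sos_ideal :: "'v::finite mpoly set \<Rightarrow> 'v mpoly set" where
  "sos_ideal H = {s + j | s j. s \<in> SOS \<and> j \<in> Ideal H}"

lemma ring_preordering_sos_ideal: "ring_preordering (sos_ideal (H :: 'v::finite mpoly set))"
  unfolding ring_preordering_def
proof (intro conjI allI ballI)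
  fix a :: "'v mpoly"
  show "a * a \<in> sos_ideal H" unfolding sos_ideal_def using SOS_square Ideal_0 by (intro CollectI exI[of _ "a * a"] exI[of _ 0]) auto
next
  fix a b :: "'v mpoly" assume "a \<in> sos_ideal H" "b \<in> sos_ideal H"
  then obtain s j s' j' where h: "a = s + j" "b = s' + j'" "s \<in> SOS" "j \<in> Ideal H" "s' \<in> SOS" "j' \<in> Ideal H"
    by (auto simp: sos_ideal_def)
  have "a + b = (s + s') + (j + j')" using h by (simp add: algebra_simps)
  thus "a + b \<in> sos_ideal H" unfolding sos_ideal_def using h SOS_add Ideal_add by blast
  have "a * b = s * s' + (j * s' + j' * s + j * j')" using h by (simp add: algebra_simps)
  moreover have "j * s' + j' * s + j * j' \<in> Ideal H" using h by (intro Ideal_add Ideal_mult)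
  moreover have "s * s' \<in> SOS" using ring_preorderingD(3)[OF ring_preordering_SOS h(3,5)] .
  ultimately show "a * b \<in> sos_ideal H" unfolding sos_ideal_def by blast
qed

lemma Ideal_subset_sos_ideal: "Ideal H \<subseteq> sos_ideal H"
  unfolding sos_ideal_def using SOS_0 by force

definition sos_ideal1 :: "'v::finite mpoly set \<Rightarrow> 'v mpoly \<Rightarrow> 'v mpoly set" where
  "sos_ideal1 H \<rho> = {s + \<rho> * t | s t. s \<in> sos_ideal H \<and> t \<in> sos_ideal H}"

lemma sos_ideal1: "ring_preordering (sos_ideal1 H \<rho>)" "sos_ideal H \<subseteq> sos_ideal1 H \<rho>" "\<rho> \<in> sos_ideal1 H \<rho>"
  unfolding sos_ideal1_def using ring_preordering_adjoin[OF ring_preordering_sos_ideal[of H], of \<rho>] by blast+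

lemma sos_ideal1_subset:
  assumes M: "quadratic_module M" and H: "Ideal H \<subseteq> M" and r: "\<rho> \<in> M"
  shows "sos_ideal1 H \<rho> \<subseteq> M"
proof
  note d = quadratic_moduleD[OF M]
  fix x assume "x \<in> sos_ideal1 H \<rho>"
  then obtain s j s' j' where h: "x = s + j + \<rho> * (s' + j')" "s \<in> SOS" "j \<in> Ideal H" "s' \<in> SOS" "j' \<in> Ideal H"
    by (auto simp: sos_ideal1_def sos_ideal_def)
  have "j' * \<rho> \<in> M" "j \<in> M" using h Ideal_mult H by blast+
  moreover have "s \<in> M" "\<rho> * s' \<in> M" using quadratic_module_SOS[OF M] quadratic_module_SOS_mult[OF M _ r] h by blast+
  ultimately have "(s + j) + (\<rho> * s' + j' * \<rho>) \<in> M" using d(1) by blast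
  thus "x \<in> M" unfolding h by (simp add: algebra_simps)
qed

lemma real_point_of_preordering:
  fixes T :: "'v::finite mpoly set"
  assumes T: "ring_preordering T" "-1 \<notin> T" and F: "finite F" "F \<subseteq> T"
  shows "\<exists>u. \<forall>q\<in>F. meval q u \<ge> 0"
proof -
  obtain P where P: "prime_cone P" "T \<subseteq> P" using prime_cone_exists[OF T(1), of "{1}"] T(2) by auto
  obtain u where "\<forall>q\<in>F. q \<in> P \<longrightarrow> meval q u \<ge> 0" using Artin_Lang[OF P(1) F(1)] by (rule exE)
  hence "\<forall>q\<in>F. meval q u \<ge> 0" using F(2) P(2) by blast
  thus ?thesis ..
qed

lemma critical_value_of_cone:
  fixes f :: "'v::finite mpoly"
  assumes P: "prime_cone P" and EI: "finite E" "finite I"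
    and eq: "\<And>i. i \<in> E \<Longrightarrow> c i \<in> supp P" and phi: "phi_set f c p E I \<subseteq> supp P"
  shows "\<exists>v. f - mconst v \<in> supp P"
proof (rule ccontr)
  assume "\<not> ?thesis"
  with tangent_vectors[OF P, of f] obtain w where w: "\<And>g. g \<in> supp P \<Longrightarrow> (\<Sum>v\<in>UNIV. mpderiv v g * w v) \<in> supp P"
    and wf: "(\<Sum>v\<in>UNIV. mpderiv v f * w v) \<notin> supp P" by blast
  note s = supp_prime_cone[OF P]
  have ssum: "(\<And>i. i \<in> A \<Longrightarrow> g i \<in> supp P) \<Longrightarrow> sum g A \<in> supp P" for g and A :: "'b set"
    by (induction A rule: infinite_finite_induct) (auto intro: s)
  have ssumv: "(\<And>i. i \<in> A \<Longrightarrow> g i \<in> supp P) \<Longrightarrow> sum g A \<in> supp P" for g and A :: "'v set"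
    by (induction A rule: infinite_finite_induct) (auto intro: s)
  have pc: "p i * (\<Sum>v\<in>UNIV. mpderiv v (c i) * w v) \<in> supp P" if i: "i \<in> E \<union> I" for i
  proof -
    have "p i \<in> supp P \<or> c i \<in> supp P"
    proof (cases "i \<in> E")
      case True thus ?thesis using eq by blast
    next
      case False
      hence "p i * c i \<in> supp P" using phi i by (auto simp: phi_set_def)
      thus ?thesis using P by (auto simp: prime_cone_def)
    qed
    thus ?thesis using s(4,5) w by blast
  qed
  have "(\<Sum>v\<in>UNIV. mpderiv v f * w v) =
    (\<Sum>v\<in>UNIV. (mpderiv v f - (\<Sum>i\<in>E \<union> I. p i * mpderiv v (c i))) * w v) + (\<Sum>i\<in>E \<union> I. p i * (\<Sum>v\<in>UNIV. mpderiv v (c i) * w v))"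
  proof -
    have "(\<Sum>i\<in>E \<union> I. p i * (\<Sum>v\<in>UNIV. mpderiv v (c i) * w v)) = (\<Sum>v\<in>UNIV. (\<Sum>i\<in>E \<union> I. p i * mpderiv v (c i)) * w v)"
      unfolding sum_distrib_left sum_distrib_right by (subst sum.swap) (simp add: mult.assoc)
    thus ?thesis by (simp add: left_diff_distrib sum_subtractf)
  qed
  also have "\<dots> \<in> supp P"
    using phi by (intro s(2) ssum ssumv pc s(4)) (auto simp: phi_set_def)
  finally show False using wf by simp
qed

text \<open>The admissible products form the multiplicative set to be avoided. The bound \<gamma>
  may be infinite: for \<infinity> only the empty product is left and -1 is certified, while for
  -\<infinity> the hypothesis on \<rho> is vacuous.\<close>

lemma critical_certificate:
  fixes f :: "'v::finite mpoly" and \<gamma> :: ereal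
  assumes EI: "finite E" "finite I"
    and neg: "\<And>u. \<forall>h\<in>c ` E \<union> phi_set f c p E I. meval h u = 0 \<Longrightarrow> ereal (meval f u) < \<gamma> \<Longrightarrow> meval \<rho> u < 0"
  shows "\<exists>vs. (\<forall>v\<in>set vs. \<gamma> \<le> ereal v) \<and>
    - ((\<Prod>v\<leftarrow>vs. f - mconst v) * (\<Prod>v\<leftarrow>vs. f - mconst v)) \<in> sos_ideal1 (c ` E \<union> phi_set f c p E I) \<rho>"
proof (rule ccontr)
  assume n: "\<not> ?thesis"
  define H where "H = c ` E \<union> phi_set f c p E I"
  have finH: "finite H" using EI by (simp add: H_def phi_set_def)
  define D where "D = {(\<Prod>v\<leftarrow>vs. f - mconst v) | vs. \<forall>v\<in>set vs. \<gamma> \<le> ereal v}"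
  have D1: "1 \<in> D" unfolding D_def by (intro CollectI exI[of _ "[]"]) simp
  have Dm: "d * e \<in> D" if "d \<in> D" "e \<in> D" for d e
  proof -
    from that obtain vs ws where "d = (\<Prod>v\<leftarrow>vs. f - mconst v)" "e = (\<Prod>v\<leftarrow>ws. f - mconst v)" "\<forall>v\<in>set vs. \<gamma> \<le> ereal v" "\<forall>v\<in>set ws. \<gamma> \<le> ereal v"
      by (auto simp: D_def)
    thus ?thesis unfolding D_def by (intro CollectI exI[of _ "vs @ ws"]) auto
  qed
  have Dn: "- (d * d) \<notin> sos_ideal1 H \<rho>" if "d \<in> D" for d using n that by (auto simp: D_def H_def)
  from prime_cone_exists[OF sos_ideal1(1) D1 Dm Dn] obtain P where
    P: "prime_cone P" "sos_ideal1 H \<rho> \<subseteq> P" "D \<inter> supp P = {}" by blast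
  have HP: "h \<in> supp P" if "h \<in> H" for h
  proof -
    have "h * 1 \<in> Ideal H" "h * (-1) \<in> Ideal H" using Ideal_mem[OF finH that] by blast+
    thus ?thesis using Ideal_subset_sos_ideal sos_ideal1(2) P(2) unfolding supp_def by fastforce
  qed
  obtain v where v: "f - mconst v \<in> supp P"
    using critical_value_of_cone[OF P(1) EI, of c f p] HP by (auto simp: H_def)
  have "\<not> \<gamma> \<le> ereal v"
  proof
    assume "\<gamma> \<le> ereal v"
    hence "f - mconst v \<in> D" unfolding D_def by (intro CollectI exI[of _ "[v]"]) auto
    thus False using v P(3) by blast
  qed
  define F where "F = {\<rho>, f - mconst v, - (f - mconst v)} \<union> H \<union> uminus ` H"
  have finF: "finite F" using finH by (simp add: F_def)
  have FP: "F \<subseteq> P" using HP v sos_ideal1(3) P(2) by (auto simp: F_def supp_def)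
  obtain u where "\<forall>q\<in>F. q \<in> P \<longrightarrow> meval q u \<ge> 0" using Artin_Lang[OF P(1) finF] by (rule exE)
  hence u: "\<forall>q\<in>F. meval q u \<ge> 0" using FP by blast
  have "meval h u = 0" if "h \<in> H" for h
  proof -
    have "meval h u \<ge> 0" "meval (- h) u \<ge> 0" using u that unfolding F_def by blast+
    thus ?thesis by (simp add: meval_simps)
  qed
  moreover have "meval f u = v" using u by (auto simp: F_def meval_simps meval_mconst)
  moreover have "meval \<rho> u \<ge> 0" using u by (simp add: F_def)
  ultimately show False using neg[of u] \<open>\<not> \<gamma> \<le> ereal v\<close> by (auto simp: H_def not_le)
qed

section \<open>Bounded elements and Woermann's argument\<close>

definition bounded_in :: "'v::finite mpoly set \<Rightarrow> 'v mpoly \<Rightarrow> bool" where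
  "bounded_in T q \<longleftrightarrow> (\<exists>n\<ge>0. mconst n - q \<in> T \<and> mconst n + q \<in> T)"

lemma ring_preordering_mconst: "ring_preordering T \<Longrightarrow> c \<ge> 0 \<Longrightarrow> mconst c \<in> T"
  by (subst mconst_nonneg_square) (simp_all add: ring_preorderingD(1))

definition sqnorm :: "'v::finite mpoly" where
  "sqnorm = (\<Sum>v\<in>UNIV. mvar v * mvar v)"

lemma ring_preordering_sum: "ring_preordering T \<Longrightarrow> (\<And>i. i \<in> A \<Longrightarrow> g i \<in> T) \<Longrightarrow> sum g A \<in> T"
  by (induction A rule: infinite_finite_induct) (auto intro: ring_preorderingD)

text \<open>Bounded elements form a subring, so the ball is needed for the variables only. For
  products, 2 (n m - p q) = (n - p) (m + q) + (n + p) (m - q).\<close>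

lemma ball_bounds_all:
  assumes T: "ring_preordering T" and ball: "mconst N - sqnorm \<in> T" and N: "N \<ge> 0"
  shows "bounded_in T q"
proof (induction q rule: mpoly_induct)
  note d = ring_preorderingD[OF T]
  case (const c)
  show ?case unfolding bounded_in_def
    using ring_preordering_mconst[OF T, of "\<bar>c\<bar> - c"] ring_preordering_mconst[OF T, of "\<bar>c\<bar> + c"]
    by (intro exI[of _ "\<bar>c\<bar>"]) (auto simp: mconst_add ring_hom_fun_diff[OF mconst_hom])
next
  note d = ring_preorderingD[OF T]
  case (var v)
  have sq: "sqnorm = mvar v * mvar v + (\<Sum>u\<in>UNIV - {v}. mvar u * mvar u)" unfolding sqnorm_def by (subst sum.remove[of UNIV v]) auto
  have "(\<Sum>u\<in>UNIV - {v}. mvar u * mvar u) \<in> T" by (intro ring_preordering_sum[OF T] d)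
  from d(2)[OF ball this] have b: "mconst N - mvar v * mvar v \<in> T" unfolding sq by (simp add: algebra_simps)
  have h: "mconst (1/2) + mconst (1/2) = 1" "mconst (1/2) * mconst (1/2) = mconst (1/4)"
    by (simp_all add: mconst_add[symmetric] mconst_mult[symmetric] mconst_1)
  \<comment> \<open>Completing the square: the bound N on x^2 gives the bound N + 1/4 on x.\<close>
  have e: "(mconst N - x * x) + (x - mconst (1/2)) * (x - mconst (1/2)) = mconst (N + 1/4) - x" for x :: "'a mpoly"
  proof -
    have "(mconst N - x * x) + (x - mconst (1/2)) * (x - mconst (1/2)) = mconst N + mconst (1/2) * mconst (1/2) - (mconst (1/2) + mconst (1/2)) * x"
      by (simp add: algebra_simps)
    thus ?thesis unfolding h by (simp add: mconst_add)
  qed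
  have e': "(mconst N - x * x) + (x + mconst (1/2)) * (x + mconst (1/2)) = mconst (N + 1/4) + x" for x :: "'a mpoly"
    using e[of "-x"] by (simp add: algebra_simps)
  show ?case unfolding bounded_in_def
    using d(2)[OF b d(1)[of "mvar v - mconst (1/2)"]] d(2)[OF b d(1)[of "mvar v + mconst (1/2)"]] N
    unfolding e e' by (intro exI[of _ "N + 1/4"]) auto
next
  note d = ring_preorderingD[OF T]
  case (add p q)
  then obtain n m where nm: "n \<ge> 0" "mconst n - p \<in> T" "mconst n + p \<in> T" "m \<ge> 0" "mconst m - q \<in> T" "mconst m + q \<in> T"
    by (auto simp: bounded_in_def)
  show ?case unfolding bounded_in_def using d(2)[OF nm(2,5)] d(2)[OF nm(3,6)] nm
    by (intro exI[of _ "n + m"]) (simp add: mconst_add algebra_simps)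
next
  note d = ring_preorderingD[OF T]
  case (mult p q)
  then obtain n m where nm: "n \<ge> 0" "mconst n - p \<in> T" "mconst n + p \<in> T" "m \<ge> 0" "mconst m - q \<in> T" "mconst m + q \<in> T"
    by (auto simp: bounded_in_def)
  have half: "x \<in> T" if "x + x \<in> T" for x
  proof -
    have "mconst (1/2) * (x + x) = mconst (1/2 + 1/2) * x" by (simp only: mconst_add distrib_left distrib_right)
    thus ?thesis using d(3)[OF ring_preordering_mconst[OF T] that, of "1/2"] by (simp add: mconst_1)
  qed
  have "(mconst n - p) * (mconst m + q) + (mconst n + p) * (mconst m - q) \<in> T" by (intro d nm)
  also have "(mconst n - p) * (mconst m + q) + (mconst n + p) * (mconst m - q) = (mconst n * mconst m - p * q) + (mconst n * mconst m - p * q)" by (simp add: algebra_simps)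
  finally have 1: "mconst n * mconst m - p * q \<in> T" by (rule half)
  have "(mconst n - p) * (mconst m - q) + (mconst n + p) * (mconst m + q) \<in> T" by (intro d nm)
  also have "(mconst n - p) * (mconst m - q) + (mconst n + p) * (mconst m + q) = (mconst n * mconst m + p * q) + (mconst n * mconst m + p * q)" by (simp add: algebra_simps)
  finally have 2: "mconst n * mconst m + p * q \<in> T" by (rule half)
  show ?case unfolding bounded_in_def using 1 2 nm by (intro exI[of _ "n * m"]) (simp add: mconst_mult)
qed

text \<open>Woermann's argument, and the descent \<open>n(a + r - 1/n) = (n - t)(a + r) + (at - 1) + rt\<close>.\<close>

lemma positive_on_compact_in_preordering:
  fixes T :: "'v::finite mpoly set"
  assumes T: "ring_preordering T" and F: "finite F" "F \<subseteq> T" and bdd: "bounded {u. \<forall>q\<in>F. meval q u \<ge> 0}"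
    and pos: "\<And>u. \<forall>q\<in>F. meval q u \<ge> 0 \<Longrightarrow> meval a u > 0"
  shows "a \<in> T"
proof -
  note d = ring_preorderingD[OF T]
  \<comment> \<open>Were -1 not in \<open>T\<close> - a \<open>T\<close>, there would be a real
    point satisfying \<open>F\<close> with a \<le> 0.\<close>
  have strict: "\<exists>s\<in>T. \<exists>t\<in>T. a * t = 1 + s" if pos: "\<And>u. \<forall>q\<in>F. meval q u \<ge> 0 \<Longrightarrow> meval a u > 0" for a
  proof -
    note ad = ring_preordering_adjoin[OF T, of "-a"]
    have "-1 \<in> {s + - a * t | s t. s \<in> T \<and> t \<in> T}"
    proof (rule ccontr)
      assume n: "-1 \<notin> {s + - a * t | s t. s \<in> T \<and> t \<in> T}"
      obtain u where "\<forall>q\<in>insert (-a) F. meval q u \<ge> 0"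
        using real_point_of_preordering[OF ad(1) n, of "insert (-a) F"] F ad(2,3) by blast
      thus False using pos[of u] by (simp add: meval_simps)
    qed
    then obtain s t where st: "s \<in> T" "t \<in> T" "-1 = s + - a * t" by blast
    hence "a * t = 1 + s" by (simp add: algebra_simps eq_neg_iff_add_eq_0)
    thus ?thesis using st by blast
  qed
  obtain B0 where B0: "\<forall>u\<in>{u. \<forall>q\<in>F. meval q u \<ge> 0}. norm u \<le> B0" using bdd unfolding bounded_iff by (rule exE)
  define B where "B = max 0 B0"
  have B: "norm u \<le> B" if "\<forall>q\<in>F. meval q u \<ge> 0" for u
    using bspec[OF B0, of u] that by (simp add: B_def)
  define N where "N = B\<^sup>2 + 1"
  have N0: "N \<ge> 0" by (simp add: N_def)
  define a0 where "a0 = mconst N - (sqnorm :: 'v mpoly)"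
  have sqn: "meval sqnorm u = (norm u)\<^sup>2" for u :: "real^'v"
    by (simp add: sqnorm_def meval_simps meval_mvar norm_vec_def L2_set_def sum_nonneg power2_eq_square)
  have "meval a0 u > 0" if "\<forall>q\<in>F. meval q u \<ge> 0" for u
  proof -
    have "(norm u)\<^sup>2 \<le> B\<^sup>2" using B[OF that] by (intro power_mono) auto
    thus ?thesis by (simp add: a0_def meval_simps meval_mconst sqn N_def)
  qed
  from strict[OF this] obtain s t where st: "s \<in> T" "t \<in> T" "a0 * t = 1 + s" by blast
  have "(1 + s) * a0 = a0 * a0 * t" using st(3) by (metis mult.assoc mult.commute)
  hence sa: "(1 + s) * a0 \<in> T" using d(3)[OF d(1) st(2)] by simp
  note ad = ring_preordering_adjoin[OF T, of a0]
  \<comment> \<open>Once \<open>a0\<close> is adjoined, the ball is available and bounds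
    \<open>s\<close>. Multiplication by 1 + s leads back to \<open>T\<close>, since (1 + s) a0 lies
    in \<open>T\<close>.\<close>
  have "bounded_in {x + a0 * y | x y. x \<in> T \<and> y \<in> T} s" using ball_bounds_all[OF ad(1) _ N0] ad(3) by (simp add: a0_def)
  then obtain m where m: "m \<ge> 0" "mconst m - s \<in> {x + a0 * y | x y. x \<in> T \<and> y \<in> T}" by (auto simp: bounded_in_def)
  then obtain x y where xy: "mconst m - s = x + a0 * y" "x \<in> T" "y \<in> T" by blast
  have 1: "(1 + s) * (mconst m - s) \<in> T"
  proof -
    have "(1 + s) * (mconst m - s) = (1 + s) * x + ((1 + s) * a0) * y" unfolding xy by (simp add: algebra_simps)
    thus ?thesis using d(2)[OF d(3)[OF d(2)[OF d(5) st(1)] xy(2)] d(3)[OF sa xy(3)]] by simp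
  qed
  have mm: "mconst m = mconst (m/2) + mconst (m/2)" "mconst (m + m\<^sup>2/4) = mconst m + mconst (m/2) * mconst (m/2)"
    by (simp_all add: mconst_add[symmetric] mconst_mult[symmetric] power2_eq_square)
  \<comment> \<open>The added square cancels the quadratic term and leaves a constant bound on
    \<open>s\<close> within \<open>T\<close>.\<close>
  have "(1 + s) * (mconst m - s) + (s - mconst (m/2)) * (s - mconst (m/2)) = mconst m + mconst (m/2) * mconst (m/2) - s"
    by (subst (1) mm(1)) (simp add: algebra_simps mm(1))
  with d(2)[OF 1 d(1)[of "s - mconst (m/2)"]] have 2: "mconst (m + m\<^sup>2/4) - s \<in> T" unfolding mm(2) by simp
  have sqT: "sqnorm \<in> T" unfolding sqnorm_def by (intro ring_preordering_sum[OF T] d)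
  \<comment> \<open>The terms containing \<open>s\<close> cancel, which leaves a ball in
    \<open>T\<close>, of larger radius.\<close>
  have "mconst N * (mconst (m + m\<^sup>2/4) - s) + (1 + s) * a0 + s * sqnorm \<in> T"
    by (rule d(2)[OF d(2)[OF d(3)[OF ring_preordering_mconst[OF T N0] 2] sa] d(3)[OF st(1) sqT]])
  also have "mconst N * (mconst (m + m\<^sup>2/4) - s) + (1 + s) * a0 + s * sqnorm = mconst (N * (m + m\<^sup>2/4) + N) - sqnorm"
    unfolding a0_def mconst_add[of "N * (m + m\<^sup>2/4)"] mconst_mult[of N] by (simp only: ring_distribs mult_1_left) (simp only: ac_simps add_diff_eq diff_add_eq diff_diff_eq2 diff_diff_add, simp)
  finally have ball: "mconst (N * (m + m\<^sup>2/4) + N) - sqnorm \<in> T" .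
  have bd: "bounded_in T q" for q using ball_bounds_all[OF T ball] N0 m(1) by simp
  obtain s t where st: "s \<in> T" "t \<in> T" "a * t = 1 + s" using strict[OF pos] by blast
  obtain n0 where n0: "n0 \<ge> 0" "mconst n0 - t \<in> T" using bd[of t] by (auto simp: bounded_in_def)
  define n where "n = n0 + 1"
  have n: "n > 0" "mconst n - t \<in> T" using n0 d(2)[OF n0(2) d(5)] by (auto simp: n_def mconst_add mconst_1 algebra_simps)
  obtain r0 where r0: "r0 \<ge> 0" "mconst r0 + a \<in> T" using bd[of a] by (auto simp: bounded_in_def)
  have desc: "a + mconst (r - 1/n) \<in> T" if r: "r \<ge> 0" "a + mconst r \<in> T" for r
  proof -
    have "(mconst n - t) * (a + mconst r) + s + mconst r * t \<in> T" by (intro d n r st ring_preordering_mconst[OF T])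
    also have "(mconst n - t) * (a + mconst r) + s + mconst r * t = mconst n * (a + mconst r) - 1" using st(3) by (simp add: algebra_simps)
    finally have "mconst (1/n) * (mconst n * (a + mconst r) - 1) \<in> T" using n by (intro d(3) ring_preordering_mconst[OF T]) auto
    also have "mconst (1/n) * (mconst n * (a + mconst r) - 1) = mconst (1/n * n) * (a + mconst r) - mconst (1/n)"
      by (simp only: mconst_mult right_diff_distrib mult.assoc mult_1_right)
    also have "\<dots> = a + mconst (r - 1/n)" using n by (simp add: mconst_1 ring_hom_fun_diff[OF mconst_hom])
    finally show ?thesis .
  qed
  \<comment> \<open>Each descent lowers the slack by 1/n; it is cut off at 0 because
    \<open>desc\<close> asks for a nonnegative slack.\<close>
  have "a + mconst (max 0 (r0 - of_nat k / n)) \<in> T" for k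
  proof (induction k)
    case 0 show ?case using r0 by (simp add: add.commute max_def)
  next
    case (Suc k)
    define r where "r = max 0 (r0 - of_nat k / n)"
    have 1: "a + mconst (r - 1/n) \<in> T" using desc[of r] Suc by (simp add: r_def)
    define r' where "r' = max 0 (r0 - of_nat (Suc k) / n)"
    have "r' - (r - 1/n) \<ge> 0" using n by (auto simp: r_def r'_def field_simps max_def)
    from d(2)[OF 1 ring_preordering_mconst[OF T this]] have "a + mconst r' \<in> T"
      by (simp add: ring_hom_fun_diff[OF mconst_hom])
    thus ?case unfolding r'_def .
  qed
  moreover obtain k where "r0 * n \<le> of_nat k" using real_arch_simple by blast
  hence "max 0 (r0 - of_nat k / n) = 0" using n by (simp add: field_simps max_def)
  ultimately have "a + mconst 0 \<in> T" by metis
  thus ?thesis by (simp add: mconst_0)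
qed

text \<open>For y \<ge> 0 put z = y / N: Bernoulli gives (1 - z)^(2l) (1 + 2 l z) \<le> (1 -
  z^2)^(2l) \<le> 1, so the damped value is at most N / (2 l). For y < 0 the factor is at least 1,
  so a violation is never diminished.\<close>

lemma damped_bound:
  fixes y N :: real and l :: nat
  assumes N: "N > 0" "\<bar>y\<bar> \<le> N" and l: "l > 0"
  shows "y * ((1 - 1 / N * y) ^ l)\<^sup>2 \<le> - max 0 (- y) + N / (2 * l)"
proof (cases "y \<ge> 0")
  case True
  define z where "z = y / N"
  have z: "0 \<le> z" "z \<le> 1" "y = N * z" using N True by (auto simp: z_def field_simps)
  have "1 + real (2 * l) * z \<le> (1 + z) ^ (2 * l)" using Bernoulli_inequality[of z "2*l"] z by simp
  hence "(1 - z) ^ (2*l) * (1 + real (2 * l) * z) \<le> (1 - z) ^ (2*l) * (1 + z) ^ (2 * l)" using z by (intro mult_left_mono) auto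
  also have "\<dots> = (1 - z\<^sup>2) ^ (2 * l)" by (simp add: power_mult_distrib[symmetric] algebra_simps power2_eq_square)
  also have "\<dots> \<le> 1" using z by (intro power_le_one) (auto simp: power2_eq_square mult_le_one)
  finally have b: "(1 - z) ^ (2*l) * (1 + real (2 * l) * z) \<le> 1" .
  have nn: "(1 - z) ^ (2*l) \<ge> 0" using z by simp
  have "(1 - z) ^ (2*l) * (real (2 * l) * z) \<le> 1" using b nn unfolding distrib_left mult_1_right by linarith
  hence "z * (1 - z) ^ (2*l) \<le> 1 / real (2 * l)" using l by (simp add: field_simps)
  hence "N * (z * (1 - z) ^ (2*l)) \<le> N * (1 / real (2 * l))" using N by (intro mult_left_mono) auto
  moreover have "max 0 (- y) = 0" using True by simp
  ultimately show ?thesis using z(3) N by (simp add: power_mult[symmetric] mult.commute[of l 2] mult.assoc)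
next
  case False
  have "1 \<le> (1 - 1 / N * y) ^ l" using False N by (intro one_le_power) (simp add: field_simps)
  hence "1 \<le> ((1 - 1 / N * y) ^ l)\<^sup>2" by (simp add: one_le_power)
  hence "y * ((1 - 1 / N * y) ^ l)\<^sup>2 \<le> y * 1" using False by (intro mult_left_mono_neg) auto
  moreover have "0 \<le> N / (2 * l)" using N by simp
  moreover have "max 0 (- y) = - y" using False by simp
  ultimately show ?thesis by linarith
qed

text \<open>Some constraint is violated at each point of \<open>K\<close>, so by compactness the
  total violation has a positive minimum \<delta>. After damping, the satisfied constraints
  contribute at most N / (2 l) each, and \<open>l\<close> is chosen so that the total error is at
  most \<delta> / 2.\<close>

lemma negative_combination_on_compact:
  fixes G :: "'v::finite mpoly set"
  assumes G: "finite G" and K: "compact K" and neg: "\<And>u. u \<in> K \<Longrightarrow> \<exists>g\<in>G. meval g u < 0"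
    and M: "quadratic_module M" "G \<subseteq> M"
  shows "\<exists>\<rho>\<in>M. \<exists>\<delta>>0. \<forall>u\<in>K. meval \<rho> u \<le> - \<delta>"
proof (cases "K = {}")
  case True
  thus ?thesis using quadratic_moduleD(4)[OF M(1)] zero_less_one by blast
next
  case False
  define \<phi> where "\<phi> u = (\<Sum>g\<in>G. max 0 (- meval g u))" for u
  have "continuous_on K \<phi>" unfolding \<phi>_def by (intro continuous_intros continuous_on_max continuous_on_meval)
  then obtain u0 where u0: "u0 \<in> K" "\<forall>u\<in>K. \<phi> u0 \<le> \<phi> u" using continuous_attains_inf[OF K False] by blast
  define \<delta> where "\<delta> = \<phi> u0"
  have d0: "\<delta> > 0"
  proof -
    obtain g where g: "g \<in> G" "meval g u0 < 0" using neg[OF u0(1)] by blast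
    have "max 0 (- meval g u0) \<le> \<phi> u0" unfolding \<phi>_def using g(1) G by (intro member_le_sum) auto
    thus ?thesis using g(2) by (simp add: \<delta>_def)
  qed
  have "\<exists>B. \<forall>u\<in>K. \<bar>meval g u\<bar> \<le> B" for g
    using compact_imp_bounded[OF compact_continuous_image[OF continuous_on_meval K, of g]] unfolding bounded_iff by auto
  then obtain B where B: "\<And>g u. u \<in> K \<Longrightarrow> \<bar>meval g u\<bar> \<le> B g" by metis
  define N where "N = 1 + (\<Sum>g\<in>G. \<bar>B g\<bar>)"
  have N: "N > 0" by (simp add: N_def add_pos_nonneg sum_nonneg)
  have BN: "\<bar>meval g u\<bar> \<le> N" if "g \<in> G" "u \<in> K" for g u
  proof -
    have "\<bar>B g\<bar> \<le> (\<Sum>g\<in>G. \<bar>B g\<bar>)" using that G by (intro member_le_sum) auto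
    thus ?thesis using B[OF that(2), of g] by (simp add: N_def)
  qed
  obtain l :: nat where l: "real (card G) * N / \<delta> < real l" using reals_Archimedean2 by blast
  have l0: "l > 0" using l N d0 by (metis divide_nonneg_pos gr0I less_le_not_le mult_nonneg_nonneg of_nat_0 of_nat_0_le_iff order_less_imp_le)
  define q where "q g = (1 - mconst (1/N) * g) ^ l" for g :: "'v mpoly"
  define \<rho> where "\<rho> = (\<Sum>g\<in>G. q g * q g * g)"
  have mem: "(\<Sum>g\<in>A. q g * q g * g) \<in> M" if "A \<subseteq> G" for A
    using finite_subset[OF that G] that
    by (induction A rule: finite_induct) (use quadratic_moduleD[OF M(1)] M(2) in auto)
  have bound: "meval \<rho> u \<le> - (\<delta> / 2)" if u: "u \<in> K" for u
  proof -
    have "meval \<rho> u = (\<Sum>g\<in>G. meval g u * ((1 - 1 / N * meval g u) ^ l)\<^sup>2)"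
      by (simp add: \<rho>_def q_def meval_simps meval_mconst power2_eq_square ac_simps)
    also have "\<dots> \<le> (\<Sum>g\<in>G. - max 0 (- meval g u) + N / (2 * l))"
      using BN u by (intro sum_mono damped_bound[OF N _ l0]) auto
    also have "\<dots> = - \<phi> u + real (card G) * N / (2 * l)" by (simp add: \<phi>_def sum.distrib sum_negf sum_subtractf)
    also have "real (card G) * N / (2 * l) \<le> \<delta> / 2" using l l0 d0 by (simp add: field_simps)
    finally show ?thesis using u0(2) u by (fastforce simp: \<delta>_def)
  qed
  show ?thesis using mem[of G] bound d0 by (intro bexI[of _ \<rho>] exI[of _ "\<delta>/2"]) (auto simp: \<rho>_def)
qed

section \<open>Nonnegativity of multipliers at minimizers\<close>

definition gradv :: "'v::finite mpoly \<Rightarrow> real^'v \<Rightarrow> real^'v" where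
  "gradv q x = (\<chi> v. meval (mpderiv v q) x)"

lemma meval_has_derivative_gradv: "(meval q has_derivative (\<lambda>h. gradv q x \<bullet> h)) (at x)"
  using meval_has_derivative[of q x] by (simp add: gradv_def inner_vec_def)

lemma continuous_on_gradv: "continuous_on S (gradv q)"
  unfolding gradv_def by (intro continuous_on_vec_lambda continuous_on_meval)

text \<open>The component of g k orthogonal to the span of the others is nonzero by independence;
  suitably scaled, it is the k-th dual vector.\<close>

lemma dual_vectors:
  fixes g :: "'i \<Rightarrow> real^'v::finite"
  assumes A: "finite A" and indep: "\<And>\<mu>. (\<Sum>i\<in>A. \<mu> i *\<^sub>R g i) = 0 \<Longrightarrow> \<forall>i\<in>A. \<mu> i = 0"
  shows "\<exists>w. \<forall>i\<in>A. \<forall>k\<in>A. g i \<bullet> w k = (if i = k then 1 else 0)"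
proof -
  have "\<exists>w. \<forall>i\<in>A. g i \<bullet> w = (if i = k then 1 else 0)" if k: "k \<in> A" for k
  proof -
    obtain y z where yz: "y \<in> span (g ` (A - {k}))" "\<And>x. x \<in> span (g ` (A - {k})) \<Longrightarrow> orthogonal z x" "g k = y + z"
      using orthogonal_subspace_decomp_exists[of "g ` (A - {k})" "g k"] by metis
    have "z \<noteq> 0"
    proof
      assume "z = 0"
      hence "g k \<in> span (g ` (A - {k}))" using yz by simp
      hence "\<exists>\<nu>. g k = (\<Sum>i\<in>A - {k}. \<nu> i *\<^sub>R g i)"
      proof (induction rule: span_induct_alt)
        case base show ?case by (rule exI[of _ "\<lambda>_. 0"]) simp
      next
        case (step c x y)
        then obtain \<nu> l where l: "l \<in> A - {k}" "x = g l" "y = (\<Sum>i\<in>A - {k}. \<nu> i *\<^sub>R g i)" by blast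
        have "(\<Sum>i\<in>A - {k}. (\<nu> i + (if i = l then c else 0)) *\<^sub>R g i) = y + (\<Sum>i\<in>A - {k}. if i = l then c *\<^sub>R g l else 0)"
          unfolding l(3) sum.distrib[symmetric] by (intro sum.cong) (auto simp: scaleR_add_left)
        also have "(\<Sum>i\<in>A - {k}. if i = l then c *\<^sub>R g l else 0) = c *\<^sub>R x" using l A by simp
        finally have "c *\<^sub>R x + y = (\<Sum>i\<in>A - {k}. (\<nu> i + (if i = l then c else 0)) *\<^sub>R g i)" by (simp add: add.commute)
        thus ?case by (rule exI[of _ "\<lambda>i. \<nu> i + (if i = l then c else 0)"])
      qed
      then obtain \<nu> where nu: "g k = (\<Sum>i\<in>A - {k}. \<nu> i *\<^sub>R g i)" by blast
      define \<mu> where "\<mu> i = (if i = k then -1 else \<nu> i)" for i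
      have "(\<Sum>i\<in>A. \<mu> i *\<^sub>R g i) = \<mu> k *\<^sub>R g k + (\<Sum>i\<in>A - {k}. \<mu> i *\<^sub>R g i)" using A k by (simp add: sum.remove)
      also have "(\<Sum>i\<in>A - {k}. \<mu> i *\<^sub>R g i) = (\<Sum>i\<in>A - {k}. \<nu> i *\<^sub>R g i)" by (intro sum.cong) (auto simp: \<mu>_def)
      also have "\<dots> = g k" using nu by simp
      finally have "(\<Sum>i\<in>A. \<mu> i *\<^sub>R g i) = 0" by (simp add: \<mu>_def)
      with indep k have "\<mu> k = 0" by blast
      thus False by (simp add: \<mu>_def)
    qed
    hence zz: "z \<bullet> z > 0" by simp
    have "g i \<bullet> z = (if i = k then z \<bullet> z else 0)" if i: "i \<in> A" for i
    proof (cases "i = k")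
      case True
      have "y \<bullet> z = 0" using yz(2)[OF yz(1)] by (simp add: orthogonal_def inner_commute)
      thus ?thesis using True yz(3) by (simp add: inner_add_left)
    next
      case False
      hence "orthogonal z (g i)" using i by (intro yz(2) span_base) auto
      thus ?thesis using False by (simp add: orthogonal_def inner_commute)
    qed
    thus ?thesis using zz by (intro exI[of _ "(1 / (z \<bullet> z)) *\<^sub>R z"]) auto
  qed
  hence "\<forall>k. \<exists>w. k \<in> A \<longrightarrow> (\<forall>i\<in>A. g i \<bullet> w = (if i = k then 1 else 0))" by blast
  from choice[OF this] show ?thesis by blast
qed

text \<open>The map \<open>x \<mapsto> x - u - \<Sum>\<^sub>i (\<nabla>c\<^sub>i(u) \<bullet> (x - u) - c\<^sub>i(x)) w\<^sub>i\<close> has derivative id at u and turns each active \<open>c\<^sub>k\<close>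
  into the linear function with gradient \<open>\<nabla>c\<^sub>k(u)\<close>.\<close>

lemma active_constraint_curve:
  fixes c :: "'i \<Rightarrow> 'v::finite mpoly"
  assumes A: "finite A" and act: "\<And>i. i \<in> A \<Longrightarrow> meval (c i) u = 0"
    and dual: "\<forall>i\<in>A. \<forall>k\<in>A. gradv (c i) u \<bullet> w k = (if i = k then 1 else 0)" and j: "j \<in> A"
  shows "\<exists>x. x 0 = u \<and> (x has_vector_derivative w j) (at 0) \<and>
    (\<forall>\<^sub>F t in nhds 0. \<forall>k\<in>A. meval (c k) (x t) = (if k = j then t else 0))"
proof -
  define F where "F x = x - u - (\<Sum>i\<in>A. (gradv (c i) u \<bullet> (x - u) - meval (c i) x) *\<^sub>R w i)" for x
  define F' where "F' x = id_blinfun - (\<Sum>i\<in>A. blinfun_scaleR_left (w i) o\<^sub>L blinfun_inner_left (gradv (c i) u - gradv (c i) x))" for x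
  have F'_apply: "blinfun_apply (F' x) h = h - (\<Sum>i\<in>A. (gradv (c i) u \<bullet> h - gradv (c i) x \<bullet> h) *\<^sub>R w i)" for x h
    by (simp add: F'_def blinfun.diff_left blinfun.sum_left inner_diff_left inner_commute inner_diff_right)
  have der: "(F has_derivative blinfun_apply (F' x)) (at x)" for x
  proof -
    have "(F has_derivative (\<lambda>h. h - 0 - (\<Sum>i\<in>A. (gradv (c i) u \<bullet> (h - 0) - gradv (c i) x \<bullet> h) *\<^sub>R w i))) (at x)"
      unfolding F_def by (intro derivative_intros meval_has_derivative_gradv)
    thus ?thesis by (rule has_derivative_eq_rhs) (simp add: fun_eq_iff F'_apply)
  qed
  have cont: "continuous_on UNIV F'"
    unfolding F'_def by (intro continuous_intros continuous_on_gradv bounded_linear.continuous_on[OF bounded_linear_blinfun_inner_left])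
  have Fu: "F u = 0" using act by (simp add: F_def)
  have id: "F' u = id_blinfun" by (rule blinfun_eqI) (simp add: F'_apply)
  have iv: "id_blinfun o\<^sub>L F' u = id_blinfun" using id by (simp add: blinfun_eqI)
  obtain U V g g' where UV: "open U" "U \<subseteq> UNIV" "u \<in> U" "open V" "F u \<in> V" "homeomorphism U V F g"
    "\<And>y. y \<in> V \<Longrightarrow> (g has_derivative (g' y)) (at y)" "\<And>y. y \<in> V \<Longrightarrow> g' y = inv_into UNIV (blinfun_apply (F' (g y)))"
    "\<And>y. y \<in> V \<Longrightarrow> bij (blinfun_apply (F' (g y)))"
    by (rule inverse_function_theorem[OF open_UNIV der cont UNIV_I iv]) (rule that)
  have g0: "g 0 = u" using homeomorphism_apply1[OF UV(6,3)] Fu by simp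
  have V0: "0 \<in> V" using UV(5) Fu by simp
  have "g' 0 = (\<lambda>h. h)" using UV(8)[OF V0] g0 id by (simp add: id_def[symmetric])
  hence dg: "(g has_derivative (\<lambda>h. h)) (at 0)" using UV(7)[OF V0] by simp
  define x where "x t = g (t *\<^sub>R w j)" for t
  have "((\<lambda>t. g (t *\<^sub>R w j)) has_derivative (\<lambda>t. t *\<^sub>R w j)) (at 0)"
    using has_derivative_compose[of "\<lambda>t. t *\<^sub>R w j" "\<lambda>t. t *\<^sub>R w j" 0 UNIV g "\<lambda>h. h"] dg
    by (simp add: has_derivative_scaleR_left bounded_linear_imp_has_derivative bounded_linear_scaleR_left)
  hence "(x has_vector_derivative w j) (at 0)" by (simp add: has_vector_derivative_def x_def[abs_def])
  moreover have "\<forall>\<^sub>F t in nhds 0. \<forall>k\<in>A. meval (c k) (x t) = (if k = j then t else 0)"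
  proof -
    have "((\<lambda>t. t *\<^sub>R w j) \<longlongrightarrow> 0 *\<^sub>R w j) (nhds 0)" by (intro tendsto_intros filterlim_ident)
    hence "\<forall>\<^sub>F t in nhds 0. t *\<^sub>R w j \<in> V" using topological_tendstoD[of _ "0 *\<^sub>R w j" "nhds 0" V] UV(4) V0 by simp
    thus ?thesis
    proof eventually_elim
      case (elim t)
      have Fx: "F (x t) = t *\<^sub>R w j" unfolding x_def using homeomorphism_apply2[OF UV(6) elim] .
      show ?case
      proof
        fix k assume k: "k \<in> A"
        \<comment> \<open>By duality only the k-th summand survives, and the linear parts cancel.
          The curve is the preimage under \<open>F\<close> of the line spanned by
          \<open>w j\<close>.\<close>
        have "gradv (c k) u \<bullet> F (x t) = gradv (c k) u \<bullet> (x t - u) - (\<Sum>i\<in>A. (gradv (c i) u \<bullet> (x t - u) - meval (c i) (x t)) * (gradv (c k) u \<bullet> w i))"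
          unfolding F_def by (simp add: inner_diff_right inner_sum_right)
        also have "(\<Sum>i\<in>A. (gradv (c i) u \<bullet> (x t - u) - meval (c i) (x t)) * (gradv (c k) u \<bullet> w i)) =
          (\<Sum>i\<in>A. if i = k then gradv (c k) u \<bullet> (x t - u) - meval (c k) (x t) else 0)"
          using dual k by (intro sum.cong) auto
        also have "\<dots> = gradv (c k) u \<bullet> (x t - u) - meval (c k) (x t)" using A k by simp
        finally have "gradv (c k) u \<bullet> F (x t) = meval (c k) (x t)" by simp
        moreover have "gradv (c k) u \<bullet> F (x t) = (if k = j then t else 0)" unfolding Fx using dual k j by auto
        ultimately show "meval (c k) (x t) = (if k = j then t else 0)" by simp
      qed
    qed
  qed
  ultimately show ?thesis using g0 by (intro exI[of _ x]) (simp add: x_def)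
qed

text \<open>Along the curve of \<open>active_constraint_curve\<close> the other active constraints
  stay 0 while the j-th one equals t, so small t > 0 are feasible. The objective has slope
  \<open>lam j\<close> there, and a negative slope contradicts minimality.\<close>

lemma multiplier_nonneg:
  fixes f :: "'v::finite mpoly" and c p :: "'i \<Rightarrow> 'v mpoly"
  assumes EI: "finite E" "finite I" "E \<inter> I = {}"
    and assmA: "\<forall>(x, lam)\<in>crit_pairs f c E I. \<forall>i\<in>E \<union> I. lam i = meval (p i) x"
    and u: "(u, lam) \<in> crit_pairs f c E I" and feas: "feasible c E I u"
    and opt: "\<And>x. feasible c E I x \<Longrightarrow> meval f u \<le> meval f x" and j: "j \<in> I"
  shows "lam j \<ge> 0"
proof (rule ccontr)
  assume neg: "\<not> lam j \<ge> 0"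
  define A where "A = {i \<in> E \<union> I. meval (c i) u = 0}"
  have A: "finite A" "A \<subseteq> E \<union> I" using EI by (auto simp: A_def)
  have cp: "\<forall>i\<in>E. meval (c i) u = 0" "\<forall>j\<in>I. lam j * meval (c j) u = 0"
    "\<And>v. meval (mpderiv v f) u = (\<Sum>i\<in>E \<union> I. lam i * meval (mpderiv v (c i)) u)" using u by (auto simp: crit_pairs_def)
  have jA: "j \<in> A" using cp(2) j neg by (auto simp: A_def)
  have EA: "E \<subseteq> A" using cp(1) by (auto simp: A_def)
  have inact: "lam i = 0" if "i \<in> E \<union> I" "i \<notin> A" for i using cp(2) that EA by (auto simp: A_def)
  have indep: "\<forall>i\<in>A. \<mu> i = 0" if mu: "(\<Sum>i\<in>A. \<mu> i *\<^sub>R gradv (c i) u) = 0" for \<mu>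
  proof -
    \<comment> \<open>A linear relation among active gradients can be added to the multipliers:
      complementarity is preserved, as only active indices change.\<close>
    define lam' where "lam' i = (if i \<in> A then lam i + \<mu> i else lam i)" for i
    have "(\<Sum>i\<in>E \<union> I. lam' i * meval (mpderiv v (c i)) u) = (\<Sum>i\<in>E \<union> I. lam i * meval (mpderiv v (c i)) u)" for v
    proof -
      have "(\<Sum>i\<in>A. \<mu> i * meval (mpderiv v (c i)) u) = 0" using arg_cong[OF mu, of "\<lambda>z. z $ v"] by (simp add: gradv_def)
      hence "(\<Sum>i\<in>E \<union> I. if i \<in> A then \<mu> i * meval (mpderiv v (c i)) u else 0) = 0"
        using A EI by (simp add: sum.If_cases Int_absorb1)
      moreover have "(\<Sum>i\<in>E \<union> I. lam' i * meval (mpderiv v (c i)) u) = (\<Sum>i\<in>E \<union> I. lam i * meval (mpderiv v (c i)) u) + (\<Sum>i\<in>E \<union> I. if i \<in> A then \<mu> i * meval (mpderiv v (c i)) u else 0)"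
        unfolding sum.distrib[symmetric] by (intro sum.cong) (auto simp: lam'_def distrib_right)
      ultimately show ?thesis by simp
    qed
    hence "(u, lam') \<in> crit_pairs f c E I" using cp by (auto simp: crit_pairs_def lam'_def A_def)
    hence "\<forall>i\<in>E \<union> I. lam' i = meval (p i) u" using assmA by blast
    moreover have "\<forall>i\<in>E \<union> I. lam i = meval (p i) u" using assmA u by blast
    ultimately have "\<forall>i\<in>E \<union> I. lam' i = lam i" by simp
    hence "lam i + \<mu> i = lam i" if "i \<in> A" for i using that A(2) by (force simp: lam'_def)
    thus ?thesis by simp
  qed
  have "\<exists>w. \<forall>i\<in>A. \<forall>k\<in>A. gradv (c i) u \<bullet> w k = (if i = k then 1 else 0)" by (rule dual_vectors[OF A(1)]) (rule indep)
  then obtain w where w: "\<forall>i\<in>A. \<forall>k\<in>A. gradv (c i) u \<bullet> w k = (if i = k then 1 else 0)" by (rule exE)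
  have act: "meval (c i) u = 0" if "i \<in> A" for i using that by (simp add: A_def)
  have "\<exists>x. x 0 = u \<and> (x has_vector_derivative w j) (at 0) \<and>
    (\<forall>\<^sub>F t in nhds 0. \<forall>k\<in>A. meval (c k) (x t) = (if k = j then t else 0))"
    by (rule active_constraint_curve[OF A(1) _ w jA]) (rule act)
  then obtain x where x0: "x 0 = u" and dx: "(x has_vector_derivative w j) (at 0)"
    and cx: "\<forall>\<^sub>F t in nhds 0. \<forall>k\<in>A. meval (c k) (x t) = (if k = j then t else 0)"
    by (elim exE conjE)
  have "gradv f u \<bullet> w j = (\<Sum>i\<in>E \<union> I. lam i * (gradv (c i) u \<bullet> w j))"
    by (simp add: gradv_def inner_vec_def cp(3) sum_distrib_right sum_distrib_left mult.assoc) (rule sum.swap)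
  also have "\<dots> = (\<Sum>i\<in>E \<union> I. if i = j then lam j else 0)"
    using inact w jA by (intro sum.cong refl) (metis (no_types) mult_zero_left mult_zero_right mult.right_neutral)
  also have "\<dots> = lam j" using EI j by simp
  finally have slope: "gradv f u \<bullet> w j = lam j" .
  have "((\<lambda>t. meval f (x t)) has_derivative (\<lambda>t. gradv f u \<bullet> (t *\<^sub>R w j))) (at 0)"
    using has_derivative_compose[of x "\<lambda>t. t *\<^sub>R w j" 0 UNIV "meval f" "\<lambda>h. gradv f u \<bullet> h"] dx meval_has_derivative_gradv[of f u] x0
    by (simp add: has_vector_derivative_def)
  hence "((\<lambda>t. meval f (x t)) has_real_derivative lam j) (at 0)"
    by (simp add: has_field_derivative_def slope mult_commute_abs)
  from DERIV_neg_dec_right[OF this] neg obtain e where e: "e > 0" "\<And>t. t > 0 \<Longrightarrow> t < e \<Longrightarrow> meval f (x t) < meval f u"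
    using x0 by auto
  have contx: "isCont x 0" using dx by (rule has_vector_derivative_continuous)
  have "\<forall>\<^sub>F t in at 0. meval (c i) (x t) > 0" if i: "i \<in> I - A" for i
  proof -
    have "meval (c i) u > 0" using feas i by (auto simp: feasible_def A_def less_le)
    moreover have "((\<lambda>t. meval (c i) (x t)) \<longlongrightarrow> meval (c i) u) (at 0)"
      using isCont_o2[OF contx, of "meval (c i)"] continuous_on_meval[of UNIV "c i"] x0
      by (simp add: continuous_on_eq_continuous_at isCont_def)
    ultimately show ?thesis by (auto dest: order_tendstoD(1))
  qed
  hence "\<forall>\<^sub>F t in at 0. \<forall>i\<in>I - A. meval (c i) (x t) > 0" using EI by (intro eventually_ball_finite) auto
  moreover have "\<forall>\<^sub>F t in at 0. \<forall>k\<in>A. meval (c k) (x t) = (if k = j then t else 0)"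
    using cx by (simp add: eventually_at_filter eventually_mono)
  ultimately have "\<forall>\<^sub>F t in at 0. (\<forall>i\<in>I - A. meval (c i) (x t) > 0) \<and> (\<forall>k\<in>A. meval (c k) (x t) = (if k = j then t else 0))"
    by (rule eventually_conj)
  hence "\<forall>\<^sub>F t in at_right 0. (\<forall>i\<in>I - A. meval (c i) (x t) > 0) \<and> (\<forall>k\<in>A. meval (c k) (x t) = (if k = j then t else 0))"
    by (rule filter_leD[OF at_le, rotated]) simp
  moreover have "\<forall>\<^sub>F t in at_right 0. 0 < t \<and> t < e" using e(1) eventually_at_right_real[of 0 e] by simp
  ultimately have ev: "\<forall>\<^sub>F t in at_right 0. ((\<forall>i\<in>I - A. meval (c i) (x t) > 0) \<and>
    (\<forall>k\<in>A. meval (c k) (x t) = (if k = j then t else 0))) \<and> 0 < t \<and> t < e" by (rule eventually_conj)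
  obtain t where t: "((\<forall>i\<in>I - A. meval (c i) (x t) > 0) \<and>
    (\<forall>k\<in>A. meval (c k) (x t) = (if k = j then t else 0))) \<and> 0 < t \<and> t < e"
    using eventually_happens'[OF trivial_limit_at_right_real ev] by (rule exE)
  have "feasible c E I (x t)" unfolding feasible_def
  proof (intro conjI ballI)
    fix i assume i: "i \<in> E"
    hence "i \<noteq> j" "i \<in> A" using EI(3) j EA by auto
    thus "meval (c i) (x t) = 0" using t by simp
  next
    fix i assume "i \<in> I"
    thus "meval (c i) (x t) \<ge> 0" using t by (cases "i \<in> A") (auto simp: less_imp_le)
  qed
  thus False using opt[of "x t"] e(2)[of t] t by auto
qed

section \<open>Tightness of the relaxations\<close>

lemma mpair_superset: "finite S \<Longrightarrow> Poly_Mapping.keys p \<subseteq> S \<Longrightarrow> mpair p y = (\<Sum>a\<in>S. lk p a * y a)"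
  unfolding mpair_def by (intro sum.mono_neutral_left) (auto simp: in_keys_iff)

lemma mpair_add: "mpair (p + q) y = mpair p y + mpair q y"
proof -
  have S: "finite (Poly_Mapping.keys p \<union> Poly_Mapping.keys q)" "Poly_Mapping.keys (p + q) \<subseteq> Poly_Mapping.keys p \<union> Poly_Mapping.keys q" by (simp_all add: keys_add)
  show ?thesis using mpair_superset[OF S] mpair_superset[OF S(1), of p] mpair_superset[OF S(1), of q]
    by (simp add: lookup_add sum.distrib[symmetric] distrib_right)
qed

lemma mpair_single: "mpair (Poly_Mapping.single a c) y = c * y a"
  using mpair_superset[of "{a}" "Poly_Mapping.single a c"] by (simp add: lookup_single)

lemma mpair_scale: "mpair (mconst c * p) y = c * mpair p y"
proof (induction p rule: mpoly_additive_induct)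
  case (1 a d)
  show ?case by (simp add: mconst_def mult_single mpair_single)
qed (simp add: distrib_left mpair_add)

lemma mpair_0: "mpair 0 y = 0" by (simp add: mpair_def)

lemma poly_space_0: "0 \<in> poly_space d" by (simp add: poly_space_def)

lemma poly_space_add: "p \<in> poly_space d \<Longrightarrow> q \<in> poly_space d \<Longrightarrow> p + q \<in> poly_space d"
  using mdeg_add[of p q] by (auto simp: poly_space_def)

lemma poly_space_scale: "p \<in> poly_space d \<Longrightarrow> mconst c * p \<in> poly_space d"
  using mdeg_mult[of "mconst c" p] by (auto simp: poly_space_def mdeg_mconst)

lemma poly_spaceI: "int (mdeg p) \<le> d \<Longrightarrow> p \<in> poly_space d" by (simp add: poly_space_def)

section \<open>Convex cones of truncated certificates\<close>

definition add_cone :: "'v::finite mpoly set \<Rightarrow> bool" where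
  "add_cone S \<longleftrightarrow> 0 \<in> S \<and> (\<forall>x\<in>S. \<forall>y\<in>S. x + y \<in> S) \<and> (\<forall>c\<ge>0. \<forall>x\<in>S. mconst c * x \<in> S)"

lemma add_coneD:
  assumes "add_cone S"
  shows "0 \<in> S" "x \<in> S \<Longrightarrow> y \<in> S \<Longrightarrow> x + y \<in> S" "c \<ge> 0 \<Longrightarrow> x \<in> S \<Longrightarrow> mconst c * x \<in> S"
  using assms by (auto simp: add_cone_def)

lemma add_cone_set_plus:
  assumes A: "add_cone A" and B: "add_cone B" shows "add_cone (set_plus_mp A B)"
  unfolding add_cone_def
proof (intro conjI ballI allI impI)
  have I: "a + b \<in> set_plus_mp A B" if "a \<in> A" "b \<in> B" for a b using that by (auto simp: set_plus_mp_def)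
  show "0 \<in> set_plus_mp A B" using I[OF add_coneD(1)[OF A] add_coneD(1)[OF B]] by simp
  fix x assume "x \<in> set_plus_mp A B"
  then obtain a b where x: "x = a + b" "a \<in> A" "b \<in> B" by (auto simp: set_plus_mp_def)
  {
    fix y assume "y \<in> set_plus_mp A B"
    then obtain a' b' where y: "y = a' + b'" "a' \<in> A" "b' \<in> B" by (auto simp: set_plus_mp_def)
    show "x + y \<in> set_plus_mp A B"
      using I[OF add_coneD(2)[OF A x(2) y(2)] add_coneD(2)[OF B x(3) y(3)]] x y by (simp add: algebra_simps)
  next
    fix c :: real assume "c \<ge> 0"
    thus "mconst c * x \<in> set_plus_mp A B"
      using I[OF add_coneD(3)[OF A _ x(2)] add_coneD(3)[OF B _ x(3)]] x by (simp add: distrib_left)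
  }
qed

lemma set_plus_mp_I:
  assumes "add_cone A" "add_cone B"
  shows "x \<in> A \<Longrightarrow> x \<in> set_plus_mp A B" "x \<in> B \<Longrightarrow> x \<in> set_plus_mp A B"
proof -
  show "x \<in> A \<Longrightarrow> x \<in> set_plus_mp A B" unfolding set_plus_mp_def
    using add_coneD(1)[OF assms(2)] by (intro CollectI exI[of _ x] exI[of _ 0]) simp
  show "x \<in> B \<Longrightarrow> x \<in> set_plus_mp A B" unfolding set_plus_mp_def
    using add_coneD(1)[OF assms(1)] by (intro CollectI exI[of _ 0] exI[of _ x]) simp
qed

lemma SOS_scale: "c \<ge> 0 \<Longrightarrow> p \<in> SOS \<Longrightarrow> mconst c * p \<in> SOS"
  by (subst mconst_nonneg_square) (simp_all add: SOS_square_mult)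

lemma add_cone_SOS_trunc: "add_cone (SOS_trunc d)"
  unfolding add_cone_def SOS_trunc_def
  by (auto simp: SOS_0 poly_space_0 SOS_add poly_space_add SOS_scale poly_space_scale)

lemma add_cone_Ideal_trunc: "add_cone (Ideal_trunc H d)"
  unfolding add_cone_def
proof (intro conjI ballI allI impI)
  show "0 \<in> Ideal_trunc H d" unfolding Ideal_trunc_def by (intro CollectI exI[of _ "\<lambda>_. 0"]) (simp add: poly_space_0)
  fix x assume "x \<in> Ideal_trunc H d"
  then obtain a where a: "\<forall>h\<in>H. a h \<in> poly_space (int d - int (mdeg h))" "x = (\<Sum>h\<in>H. h * a h)" by (auto simp: Ideal_trunc_def)
  {
    fix y assume "y \<in> Ideal_trunc H d"
    then obtain b where b: "\<forall>h\<in>H. b h \<in> poly_space (int d - int (mdeg h))" "y = (\<Sum>h\<in>H. h * b h)" by (auto simp: Ideal_trunc_def)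
    show "x + y \<in> Ideal_trunc H d" unfolding Ideal_trunc_def
      using a b by (intro CollectI exI[of _ "\<lambda>h. a h + b h"]) (auto simp: poly_space_add distrib_left sum.distrib)
  next
    fix c :: real
    show "mconst c * x \<in> Ideal_trunc H d" unfolding Ideal_trunc_def
      using a by (intro CollectI exI[of _ "\<lambda>h. mconst c * a h"]) (auto simp: poly_space_scale sum_distrib_left ac_simps)
  }
qed

lemma add_cone_Qmod_trunc: "add_cone (Qmod_trunc G d)"
  unfolding add_cone_def
proof (intro conjI ballI allI impI)
  note S = add_coneD[OF add_cone_SOS_trunc]
  show "0 \<in> Qmod_trunc G d" unfolding Qmod_trunc_def by (intro CollectI exI[of _ 0] exI[of _ "\<lambda>_. 0"]) (simp add: S(1))
  fix x assume "x \<in> Qmod_trunc G d"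
  then obtain s0 s where s: "s0 \<in> SOS_trunc (int d)" "\<forall>g\<in>G. s g \<in> SOS_trunc (int d - int (mdeg g))" "x = s0 + (\<Sum>g\<in>G. g * s g)" by (auto simp: Qmod_trunc_def)
  {
    fix y assume "y \<in> Qmod_trunc G d"
    then obtain t0 t where t: "t0 \<in> SOS_trunc (int d)" "\<forall>g\<in>G. t g \<in> SOS_trunc (int d - int (mdeg g))" "y = t0 + (\<Sum>g\<in>G. g * t g)" by (auto simp: Qmod_trunc_def)
    show "x + y \<in> Qmod_trunc G d" unfolding Qmod_trunc_def
      using s t by (intro CollectI exI[of _ "s0 + t0"] exI[of _ "\<lambda>h. s h + t h"]) (auto simp: distrib_left sum.distrib S(2))
  next
    fix c :: real assume "c \<ge> 0"
    thus "mconst c * x \<in> Qmod_trunc G d" unfolding Qmod_trunc_def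
      using s by (intro CollectI exI[of _ "mconst c * s0"] exI[of _ "\<lambda>h. mconst c * s h"]) (auto simp: sum_distrib_left distrib_left S(3) mult.left_commute)
  }
qed

lemma IQ_trunc_conv: "IQ_trunc H G d = set_plus_mp (Ideal_trunc H d) (Qmod_trunc G d)"
  by (simp add: IQ_trunc_def set_plus_mp_def)

lemma add_cone_IQ_trunc: "add_cone (IQ_trunc H G d)"
  unfolding IQ_trunc_conv by (intro add_cone_set_plus add_cone_Ideal_trunc add_cone_Qmod_trunc)

lemma Ideal_trunc_mem:
  assumes "finite H" "h \<in> H" "a \<in> poly_space (int d - int (mdeg h))"
  shows "h * a \<in> Ideal_trunc H d"
proof -
  have "(\<Sum>k\<in>H. k * (if k = h then a else 0)) = (\<Sum>k\<in>H. if k = h then h * a else 0)" by (intro sum.cong) auto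
  also have "\<dots> = h * a" using assms by simp
  finally show ?thesis unfolding Ideal_trunc_def using assms
    by (intro CollectI exI[of _ "\<lambda>k. if k = h then a else 0"]) (auto simp: poly_space_0)
qed

lemma Qmod_trunc_mem:
  assumes "finite G" "g \<in> G" "s \<in> SOS_trunc (int d - int (mdeg g))"
  shows "g * s \<in> Qmod_trunc G d"
proof -
  note S = add_coneD(1)[OF add_cone_SOS_trunc]
  have "(\<Sum>k\<in>G. k * (if k = g then s else 0)) = (\<Sum>k\<in>G. if k = g then g * s else 0)" by (intro sum.cong) auto
  also have "\<dots> = g * s" using assms by simp
  finally show ?thesis unfolding Qmod_trunc_def using assms
    by (intro CollectI exI[of _ 0] exI[of _ "\<lambda>k. if k = g then s else 0"]) (auto simp: S)
qed

lemma SOS_trunc_subset_Qmod_trunc: "s \<in> SOS_trunc (int d) \<Longrightarrow> s \<in> Qmod_trunc G d"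
  unfolding Qmod_trunc_def
  by (intro CollectI exI[of _ s] exI[of _ "\<lambda>_. 0"]) (auto simp: add_coneD(1)[OF add_cone_SOS_trunc])

lemma IQ_parts:
  fixes H G :: "'v::finite mpoly set"
  shows "Ideal H \<subseteq> IQ H G" "Qmod G \<subseteq> IQ H G" "SOS \<subseteq> Qmod G" "0 \<in> Qmod G"
proof -
  show S: "SOS \<subseteq> Qmod G" unfolding Qmod_def
  proof
    fix s :: "'v mpoly" assume "s \<in> SOS"
    thus "s \<in> {q. \<exists>s0 s. s0 \<in> SOS \<and> (\<forall>g\<in>G. s g \<in> SOS) \<and> q = s0 + (\<Sum>g\<in>G. g * s g)}"
      by (intro CollectI exI[of _ s] exI[of _ "\<lambda>_. 0"]) (simp add: SOS_0)
  qed
  thus Q0: "0 \<in> Qmod G" using SOS_0 by blast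
  show "Ideal H \<subseteq> IQ H G" unfolding IQ_def using Q0 by force
  show "Qmod G \<subseteq> IQ H G" unfolding IQ_def using Ideal_0[of H] by force
qed

lemma Qmod_add: "x \<in> Qmod G \<Longrightarrow> y \<in> Qmod G \<Longrightarrow> x + y \<in> Qmod G"
proof -
  assume "x \<in> Qmod G" "y \<in> Qmod G"
  then obtain s0 s t0 t where "s0 \<in> SOS" "\<forall>g\<in>G. s g \<in> SOS" "x = s0 + (\<Sum>g\<in>G. g * s g)"
    "t0 \<in> SOS" "\<forall>g\<in>G. t g \<in> SOS" "y = t0 + (\<Sum>g\<in>G. g * t g)" by (auto simp: Qmod_def)
  thus ?thesis unfolding Qmod_def
    by (intro CollectI exI[of _ "s0 + t0"] exI[of _ "\<lambda>g. s g + t g"]) (auto simp: SOS_add distrib_left sum.distrib)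
qed

lemma Qmod_square_mult: "x \<in> Qmod G \<Longrightarrow> a * a * x \<in> Qmod G"
proof -
  assume "x \<in> Qmod G"
  then obtain s0 s where "s0 \<in> SOS" "\<forall>g\<in>G. s g \<in> SOS" "x = s0 + (\<Sum>g\<in>G. g * s g)" by (auto simp: Qmod_def)
  moreover from this have "a * a * x = a * a * s0 + (\<Sum>g\<in>G. g * (a * a * s g))"
    by (simp add: distrib_left sum_distrib_left ac_simps)
  ultimately show ?thesis unfolding Qmod_def
    by (intro CollectI exI[of _ "a * a * s0"] exI[of _ "\<lambda>g. a * a * s g"]) (simp add: SOS_square_mult)
qed

lemma Qmod_mem: "finite G \<Longrightarrow> g \<in> G \<Longrightarrow> s \<in> SOS \<Longrightarrow> g * s \<in> Qmod G"
proof -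
  assume G: "finite G" "g \<in> G" and s: "s \<in> SOS"
  have "(\<Sum>k\<in>G. k * (if k = g then s else 0)) = (\<Sum>k\<in>G. if k = g then g * s else 0)" by (intro sum.cong) auto
  also have "\<dots> = g * s" using G by simp
  finally show ?thesis unfolding Qmod_def using s SOS_0
    by (intro CollectI exI[of _ 0] exI[of _ "\<lambda>k. if k = g then s else 0"]) auto
qed

lemma IQ_add: "x \<in> IQ H G \<Longrightarrow> y \<in> IQ H G \<Longrightarrow> x + y \<in> IQ H G"
proof -
  assume "x \<in> IQ H G" "y \<in> IQ H G"
  then obtain a b a' b' where h: "x = a + b" "y = a' + b'" "a \<in> Ideal H" "b \<in> Qmod G" "a' \<in> Ideal H" "b' \<in> Qmod G" by (auto simp: IQ_def)
  have "x + y = (a + a') + (b + b')" using h by (simp add: algebra_simps)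
  thus ?thesis unfolding IQ_def using Ideal_add[OF h(3,5)] Qmod_add[OF h(4,6)] by blast
qed

lemma IQ_square_mult: "x \<in> IQ H G \<Longrightarrow> a * a * x \<in> IQ H G"
proof -
  assume "x \<in> IQ H G"
  then obtain b d where h: "x = b + d" "b \<in> Ideal H" "d \<in> Qmod G" by (auto simp: IQ_def)
  have "a * a * x = b * (a * a) + a * a * d" using h by (simp add: algebra_simps)
  thus ?thesis unfolding IQ_def using Ideal_mult[OF h(2)] Qmod_square_mult[OF h(3)] by blast
qed

section \<open>Certificates valid for both relaxations\<close>

locale critical_problem =
  fixes f :: "'v::finite mpoly" and c p :: "'i \<Rightarrow> 'v mpoly" and E I :: "'i set"
  assumes fin: "finite E" "finite I"
begin

abbreviation "\<Phi> \<equiv> phi_set f c p E I"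
abbreviation "\<Psi> \<equiv> psi_set p I"

definition iq_module :: "'v mpoly set" where
  "iq_module = set_plus_mp (IQ (c ` E) (c ` I)) (IQ \<Phi> \<Psi>)"

definition iq_module_trunc :: "nat \<Rightarrow> 'v mpoly set" where
  "iq_module_trunc k = set_plus_mp (IQ_trunc (c ` E) (c ` I) (2 * k)) (IQ_trunc \<Phi> \<Psi> (2 * k))"

definition moments :: "nat \<Rightarrow> (('v \<Rightarrow>\<^sub>0 nat) \<Rightarrow> real) set" where
  "moments k = {y. (\<forall>a. mdeg_mono a > 2 * k \<longrightarrow> y a = 0) \<and> mpair 1 y = 1 \<and> loc_psd k 1 y \<and>
      (\<forall>i\<in>E. loc_zero k (c i) y) \<and> (\<forall>j\<in>I. loc_psd k (c j) y) \<and>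
      (\<forall>q\<in>\<Phi>. loc_zero k q y) \<and> (\<forall>q\<in>\<Psi>. loc_psd k q y)}"

text \<open>Membership in the truncated module bounds the sum of squares value, nonnegative pairing
  bounds the moment value. Both are checked on generators and pass to the convex cone they span, so
  no duality between the truncated problems is invoked.\<close>

definition certified :: "nat \<Rightarrow> 'v mpoly set" where
  "certified k = {m \<in> iq_module_trunc k. \<forall>y\<in>moments k. mpair m y \<ge> 0}"

definition Fc :: ereal where "Fc = f_c f c p E I"

lemma finite_sets: "finite (c ` E)" "finite (c ` I)" "finite \<Phi>" "finite \<Psi>"
  using fin by (simp_all add: phi_set_def psi_set_def)

lemma add_cone_certified: "add_cone (certified k)"
proof -
  have "add_cone (iq_module_trunc k)" unfolding iq_module_trunc_def by (intro add_cone_set_plus add_cone_IQ_trunc)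
  thus ?thesis unfolding add_cone_def certified_def by (auto simp: mpair_add mpair_scale mpair_0)
qed

lemma iq_module_trunc_parts:
  "x \<in> Ideal_trunc (c ` E) (2 * k) \<Longrightarrow> x \<in> iq_module_trunc k" "x \<in> Qmod_trunc (c ` I) (2 * k) \<Longrightarrow> x \<in> iq_module_trunc k"
  "x \<in> Ideal_trunc \<Phi> (2 * k) \<Longrightarrow> x \<in> iq_module_trunc k" "x \<in> Qmod_trunc \<Psi> (2 * k) \<Longrightarrow> x \<in> iq_module_trunc k"
  unfolding iq_module_trunc_def
  by (intro set_plus_mp_I add_cone_IQ_trunc; simp add: IQ_trunc_conv set_plus_mp_I add_cone_Ideal_trunc add_cone_Qmod_trunc)+

lemma certified_square: "mdeg q \<le> k \<Longrightarrow> q * q \<in> certified k"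
proof -
  assume q: "mdeg q \<le> k"
  have "q * q \<in> SOS_trunc (int (2 * k))" using mdeg_mult[of q q] q by (auto simp: SOS_trunc_def SOS_square intro!: poly_spaceI)
  hence "q * q \<in> iq_module_trunc k" by (intro iq_module_trunc_parts(2) SOS_trunc_subset_Qmod_trunc)
  moreover have "mpair (q * q) y \<ge> 0" if "y \<in> moments k" for y
  proof -
    have "loc_psd k 1 y" using that by (simp add: moments_def)
    moreover have "q \<in> poly_space (int k - int ((mdeg (1 :: 'v mpoly) + 1) div 2))"
      using q by (intro poly_spaceI) (simp add: mdeg_mconst[of 1, unfolded mconst_1])
    ultimately have "mpair (1 * q * q) y \<ge> 0" unfolding loc_psd_def by blast
    thus ?thesis by simp
  qed
  ultimately show ?thesis by (simp add: certified_def)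
qed

text \<open>The bound on \<open>k\<close> is generous: it dominates the degree condition of the
  truncated module as well as that of the localizing matrix.\<close>

lemma certified_inequality:
  assumes g: "g \<in> c ` I \<union> \<Psi>" and k: "mdeg g + mdeg q \<le> k"
  shows "g * (q * q) \<in> certified k"
proof -
  have "q * q \<in> SOS_trunc (int (2 * k) - int (mdeg g))"
    using mdeg_mult[of q q] k by (auto simp: SOS_trunc_def SOS_square intro!: poly_spaceI)
  hence "g * (q * q) \<in> iq_module_trunc k"
    using g iq_module_trunc_parts(2,4) Qmod_trunc_mem finite_sets by (metis Un_iff)
  moreover have "mpair (g * (q * q)) y \<ge> 0" if y: "y \<in> moments k" for y
  proof -
    have "loc_psd k g y" using g y by (auto simp: moments_def)
    moreover have "q \<in> poly_space (int k - int ((mdeg g + 1) div 2))" using k by (intro poly_spaceI) linarith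
    ultimately have "mpair (g * q * q) y \<ge> 0" unfolding loc_psd_def by blast
    thus ?thesis by (simp add: mult.assoc)
  qed
  ultimately show ?thesis by (simp add: certified_def)
qed

lemma certified_equation:
  assumes h: "h \<in> c ` E \<union> \<Phi>" and k: "mdeg h + mdeg a \<le> k"
  shows "h * a \<in> certified k"
proof -
  have "a \<in> poly_space (int (2 * k) - int (mdeg h))" using k by (intro poly_spaceI) linarith
  hence "h * a \<in> iq_module_trunc k"
    using h iq_module_trunc_parts(1,3) Ideal_trunc_mem finite_sets by (metis Un_iff)
  moreover have "mpair (h * a) y \<ge> 0" if y: "y \<in> moments k" for y
  proof -
    have "loc_zero k h y" using h y by (auto simp: moments_def)
    \<comment> \<open>The order is high enough for the whole cofactor \<open>a\<close> to be one
      argument of the bilinear form, the other being 1.\<close>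
    moreover have "a \<in> poly_space (int k - int ((mdeg h + 1) div 2))" "1 \<in> poly_space (int k - int ((mdeg h + 1) div 2))"
      using k by (intro poly_spaceI; simp add: mdeg_mconst[of 1, unfolded mconst_1]; linarith)+
    ultimately have "mpair (h * a * 1) y = 0" unfolding loc_zero_def by blast
    thus ?thesis by simp
  qed
  ultimately show ?thesis by (simp add: certified_def)
qed

definition certifiable :: "'v mpoly set" where
  "certifiable = {m. \<exists>K. \<forall>k\<ge>K. m \<in> certified k}"

lemma certifiable_add: "a \<in> certifiable \<Longrightarrow> b \<in> certifiable \<Longrightarrow> a + b \<in> certifiable"
proof -
  assume "a \<in> certifiable" "b \<in> certifiable"
  then obtain K L where "\<forall>k\<ge>K. a \<in> certified k" "\<forall>k\<ge>L. b \<in> certified k" by (auto simp: certifiable_def)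
  thus ?thesis unfolding certifiable_def using add_coneD(2)[OF add_cone_certified]
    by (intro CollectI exI[of _ "max K L"]) auto
qed

lemma certifiable_0: "0 \<in> certifiable"
  using add_coneD(1)[OF add_cone_certified] by (auto simp: certifiable_def)

lemma certifiable_sum: "(\<And>i. i \<in> A \<Longrightarrow> g i \<in> certifiable) \<Longrightarrow> sum g A \<in> certifiable"
  by (induction A rule: infinite_finite_induct) (auto simp: certifiable_0 certifiable_add)

lemma certifiable_equation: "h \<in> c ` E \<union> \<Phi> \<Longrightarrow> h * a \<in> certifiable"
  unfolding certifiable_def using certified_equation by blast

lemma certifiable_inequality:
  assumes g: "g \<in> c ` I \<union> \<Psi>" and s: "s \<in> SOS"
  shows "g * s \<in> certifiable"
proof -
  obtain qs where qs: "s = (\<Sum>q\<leftarrow>qs. q * q)" using s by (auto simp: SOS_def)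
  have "g * (q * q) \<in> certifiable" for q unfolding certifiable_def using certified_inequality[OF g] by blast
  thus ?thesis unfolding qs by (induction qs) (simp_all add: certifiable_0 certifiable_add distrib_left)
qed

lemma certifiable_SOS:
  assumes s: "s \<in> SOS"
  shows "s \<in> certifiable"
proof -
  obtain qs where qs: "s = (\<Sum>q\<leftarrow>qs. q * q)" using s by (auto simp: SOS_def)
  have "q * q \<in> certifiable" for q unfolding certifiable_def using certified_square by blast
  thus ?thesis unfolding qs by (induction qs) (simp_all add: certifiable_0 certifiable_add)
qed

lemma iq_moduleE:
  assumes "m \<in> iq_module"
  obtains a s0 s b t0 t where "s0 \<in> SOS" "t0 \<in> SOS" "\<forall>g\<in>c ` I. s g \<in> SOS" "\<forall>g\<in>\<Psi>. t g \<in> SOS"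
    "m = ((\<Sum>h\<in>c ` E. h * a h) + (s0 + (\<Sum>g\<in>c ` I. g * s g))) + ((\<Sum>h\<in>\<Phi>. h * b h) + (t0 + (\<Sum>g\<in>\<Psi>. g * t g)))"
proof -
  obtain x y where xy: "m = x + y" "x \<in> IQ (c ` E) (c ` I)" "y \<in> IQ \<Phi> \<Psi>" using assms by (auto simp: iq_module_def set_plus_mp_def)
  obtain x1 x2 where x: "x = x1 + x2" "x1 \<in> Ideal (c ` E)" "x2 \<in> Qmod (c ` I)" using xy(2) by (auto simp: IQ_def)
  obtain y1 y2 where y: "y = y1 + y2" "y1 \<in> Ideal \<Phi>" "y2 \<in> Qmod \<Psi>" using xy(3) by (auto simp: IQ_def)
  obtain a where a: "x1 = (\<Sum>h\<in>c ` E. h * a h)" using x(2) by (auto simp: Ideal_def)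
  obtain b where b: "y1 = (\<Sum>h\<in>\<Phi>. h * b h)" using y(2) by (auto simp: Ideal_def)
  obtain s0 s where s: "s0 \<in> SOS" "\<forall>g\<in>c ` I. s g \<in> SOS" "x2 = s0 + (\<Sum>g\<in>c ` I. g * s g)" using x(3) by (auto simp: Qmod_def)
  obtain t0 t where t: "t0 \<in> SOS" "\<forall>g\<in>\<Psi>. t g \<in> SOS" "y2 = t0 + (\<Sum>g\<in>\<Psi>. g * t g)" using y(3) by (auto simp: Qmod_def)
  show ?thesis by (rule that[OF s(1) t(1) s(2) t(2)]) (simp only: xy(1) x(1) y(1) a b s(3) t(3))
qed

lemma iq_module_certifiable: "m \<in> iq_module \<Longrightarrow> m \<in> certifiable"
proof (erule iq_moduleE)
  fix a s0 s b t0 t assume h: "s0 \<in> SOS" "t0 \<in> SOS" "\<forall>g\<in>c ` I. s g \<in> SOS" "\<forall>g\<in>\<Psi>. t g \<in> SOS"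
    and m: "m = ((\<Sum>h\<in>c ` E. h * a h) + (s0 + (\<Sum>g\<in>c ` I. g * s g))) + ((\<Sum>h\<in>\<Phi>. h * b h) + (t0 + (\<Sum>g\<in>\<Psi>. g * t g)))"
  have "(\<Sum>h\<in>c ` E. h * a h) \<in> certifiable" "(\<Sum>h\<in>\<Phi>. h * b h) \<in> certifiable"
    by (rule certifiable_sum, rule certifiable_equation, simp)+
  moreover have "(\<Sum>g\<in>c ` I. g * s g) \<in> certifiable" "(\<Sum>g\<in>\<Psi>. g * t g) \<in> certifiable"
    using h(3,4) by (intro certifiable_sum certifiable_inequality; blast)+
  ultimately show "m \<in> certifiable" unfolding m using certifiable_SOS[OF h(1)] certifiable_SOS[OF h(2)] by (intro certifiable_add)
qed

lemma iq_module_I: "x \<in> IQ (c ` E) (c ` I) \<Longrightarrow> x \<in> iq_module" "x \<in> IQ \<Phi> \<Psi> \<Longrightarrow> x \<in> iq_module"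
proof -
  have z: "0 \<in> IQ H G" for H G :: "'v mpoly set" using IQ_parts by blast
  show "x \<in> IQ (c ` E) (c ` I) \<Longrightarrow> x \<in> iq_module" unfolding iq_module_def set_plus_mp_def using z by (intro CollectI exI[of _ x] exI[of _ 0]) simp
  show "x \<in> IQ \<Phi> \<Psi> \<Longrightarrow> x \<in> iq_module" unfolding iq_module_def set_plus_mp_def using z by (intro CollectI exI[of _ 0] exI[of _ x]) simp
qed

lemma quadratic_iq_module: "quadratic_module iq_module"
  unfolding quadratic_module_def
proof (intro conjI ballI allI)
  have "1 * 1 \<in> Qmod (c ` I)" using SOS_square IQ_parts(3) by blast
  thus "1 \<in> iq_module" using iq_module_I(1) IQ_parts(2) by fastforce
  fix x assume "x \<in> iq_module"
  then obtain a b where x: "x = a + b" "a \<in> IQ (c ` E) (c ` I)" "b \<in> IQ \<Phi> \<Psi>" by (auto simp: iq_module_def set_plus_mp_def)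
  {
    fix y assume "y \<in> iq_module"
    then obtain a' b' where y: "y = a' + b'" "a' \<in> IQ (c ` E) (c ` I)" "b' \<in> IQ \<Phi> \<Psi>" by (auto simp: iq_module_def set_plus_mp_def)
    have "x + y = (a + a') + (b + b')" using x y by (simp add: algebra_simps)
    thus "x + y \<in> iq_module" unfolding iq_module_def set_plus_mp_def using IQ_add[OF x(2) y(2)] IQ_add[OF x(3) y(3)] by blast
  next
    fix q :: "'v mpoly"
    have "q * q * x = q * q * a + q * q * b" using x by (simp add: distrib_left)
    thus "q * q * x \<in> iq_module" unfolding iq_module_def set_plus_mp_def using IQ_square_mult[OF x(2)] IQ_square_mult[OF x(3)] by blast
  }
qed

lemma iq_module_sum: "(\<And>i. i \<in> A \<Longrightarrow> g i \<in> iq_module) \<Longrightarrow> sum g A \<in> iq_module"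
  by (induction A rule: infinite_finite_induct) (auto intro: quadratic_moduleD[OF quadratic_iq_module])

lemma Ideal_subset_iq_module: "Ideal (c ` E \<union> \<Phi>) \<subseteq> iq_module"
proof
  fix x assume "x \<in> Ideal (c ` E \<union> \<Phi>)"
  then obtain a where a: "x = (\<Sum>h\<in>c ` E \<union> \<Phi>. h * a h)" by (auto simp: Ideal_def)
  have "h * a h \<in> iq_module" if "h \<in> c ` E \<union> \<Phi>" for h
  proof (cases "h \<in> c ` E")
    case True
    thus ?thesis by (intro iq_module_I(1) subsetD[OF IQ_parts(1)] Ideal_mem finite_sets)
  next
    case False
    thus ?thesis using that by (intro iq_module_I(2) subsetD[OF IQ_parts(1)] Ideal_mem finite_sets) blast
  qed
  thus "x \<in> iq_module" unfolding a by (rule iq_module_sum)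
qed

lemma Qmod_subset_iq_module: "Qmod (c ` I \<union> \<Psi>) \<subseteq> iq_module"
proof
  fix x assume "x \<in> Qmod (c ` I \<union> \<Psi>)"
  then obtain s0 s where s: "s0 \<in> SOS" "\<forall>g\<in>c ` I \<union> \<Psi>. s g \<in> SOS" "x = s0 + (\<Sum>g\<in>c ` I \<union> \<Psi>. g * s g)" by (auto simp: Qmod_def)
  have "g * s g \<in> iq_module" if "g \<in> c ` I \<union> \<Psi>" for g
  proof (cases "g \<in> c ` I")
    case True
    thus ?thesis using s(2) by (intro iq_module_I(1) subsetD[OF IQ_parts(2)] Qmod_mem finite_sets) auto
  next
    case False
    thus ?thesis using s(2) that by (intro iq_module_I(2) subsetD[OF IQ_parts(2)] Qmod_mem finite_sets) auto
  qed
  thus "x \<in> iq_module" unfolding s(3) by (intro quadratic_moduleD(1)[OF quadratic_iq_module] iq_module_sum quadratic_module_SOS[OF quadratic_iq_module s(1)])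
qed

definition feas :: "real^'v \<Rightarrow> bool" where
  "feas x \<longleftrightarrow> (\<forall>h\<in>c ` E \<union> \<Phi>. meval h x = 0) \<and> (\<forall>g\<in>c ` I \<union> \<Psi>. meval g x \<ge> 0)"

lemma Fc_altdef: "Fc = Inf {ereal (meval f x) | x. feas x}"
  unfolding Fc_def f_c_def feas_def feasible_def by (rule arg_cong[of _ _ Inf]) (auto simp: ball_Un)

lemma Fc_le: "feas x \<Longrightarrow> Fc \<le> ereal (meval f x)"
  unfolding Fc_altdef by (rule Inf_lower) blast

lemma iq_module_trunc_subset: "iq_module_trunc k \<subseteq> iq_module"
proof
  fix x assume "x \<in> iq_module_trunc k"
  then obtain a b a' b' where h: "x = (a + b) + (a' + b')" "a \<in> Ideal_trunc (c ` E) (2 * k)" "b \<in> Qmod_trunc (c ` I) (2 * k)"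
    "a' \<in> Ideal_trunc \<Phi> (2 * k)" "b' \<in> Qmod_trunc \<Psi> (2 * k)" by (auto simp: iq_module_trunc_def set_plus_mp_def IQ_trunc_def)
  have I: "Ideal_trunc H d \<subseteq> Ideal H" for H and d by (auto simp: Ideal_trunc_def Ideal_def)
  have Q: "Qmod_trunc G d \<subseteq> Qmod G" for G and d by (force simp: Qmod_trunc_def Qmod_def SOS_trunc_def)
  have "a + b \<in> IQ (c ` E) (c ` I)" "a' + b' \<in> IQ \<Phi> \<Psi>" using h I Q unfolding IQ_def by blast+
  thus "x \<in> iq_module" using h(1) by (auto simp: iq_module_def set_plus_mp_def)
qed

lemma meval_module: "m \<in> iq_module \<Longrightarrow> feas x \<Longrightarrow> meval m x \<ge> 0"
proof (erule iq_moduleE)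
  fix a s0 s b t0 t assume x: "feas x" and h: "s0 \<in> SOS" "t0 \<in> SOS" "\<forall>g\<in>c ` I. s g \<in> SOS" "\<forall>g\<in>\<Psi>. t g \<in> SOS"
    and m: "m = ((\<Sum>h\<in>c ` E. h * a h) + (s0 + (\<Sum>g\<in>c ` I. g * s g))) + ((\<Sum>h\<in>\<Phi>. h * b h) + (t0 + (\<Sum>g\<in>\<Psi>. g * t g)))"
  have "meval (\<Sum>h\<in>c ` E. h * a h) x = 0" "meval (\<Sum>h\<in>\<Phi>. h * b h) x = 0"
    unfolding meval_simps using x by (intro sum.neutral; simp add: feas_def ball_Un)+
  moreover have S: "meval (\<Sum>g\<in>G. g * r g) x \<ge> 0" if "\<forall>g\<in>G. meval g x \<ge> 0" "\<forall>g\<in>G. r g \<in> SOS" for G r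
    unfolding meval_simps using that meval_SOS by (intro sum_nonneg mult_nonneg_nonneg) blast+
  moreover have "meval (\<Sum>g\<in>c ` I. g * s g) x \<ge> 0" by (rule S) (use x h in \<open>auto simp: feas_def\<close>)
  moreover have "meval (\<Sum>g\<in>\<Psi>. g * t g) x \<ge> 0" by (rule S) (use x h in \<open>auto simp: feas_def\<close>)
  ultimately show "meval m x \<ge> 0" using meval_SOS[OF h(1), of x] meval_SOS[OF h(2), of x] unfolding m ring_hom_fun_add[OF meval_hom] by linarith
qed

lemma f_sos_le: "f_sos k f c p E I \<le> Fc"
  unfolding f_sos_def Fc_altdef
proof (rule Sup_least, rule Inf_greatest)
  fix s i assume "s \<in> {ereal \<gamma> | \<gamma>. f - mconst \<gamma> \<in> set_plus_mp (IQ_trunc (c ` E) (c ` I) (2 * k)) (IQ_trunc \<Phi> \<Psi> (2 * k))}"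
    "i \<in> {ereal (meval f x) | x. feas x}"
  then obtain \<gamma> x where h: "s = ereal \<gamma>" "f - mconst \<gamma> \<in> iq_module_trunc k" "i = ereal (meval f x)" "feas x" by (auto simp: iq_module_trunc_def)
  have "meval (f - mconst \<gamma>) x \<ge> 0" using meval_module[OF _ h(4)] iq_module_trunc_subset h(2) by blast
  thus "s \<le> i" using h by (simp add: meval_simps meval_mconst)
qed

text \<open>\<open>y\<close> holds the truncated moments of the point mass at \<open>x\<close>.
  Pairing with polynomials of degree at most 2 k is evaluation, so the constraints at
  \<open>x\<close> carry over to the localizing matrices.\<close>

lemma point_moments:
  fixes k :: nat
  assumes x: "feas x"
  defines "y \<equiv> \<lambda>a. if mdeg_mono a \<le> 2 * k then (\<Prod>v\<in>UNIV. (x $ v) ^ lk a v) else 0"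
  shows "mdeg q \<le> 2 * k \<Longrightarrow> mpair q y = meval q x" "y \<in> moments k"
proof -
  have ev: "mpair q y = meval q x" if "mdeg q \<le> 2 * k" for q
    unfolding mpair_def meval_def using that by (intro sum.cong refl) (auto simp: y_def mdeg_le_iff)
  show "mdeg q \<le> 2 * k \<Longrightarrow> mpair q y = meval q x" by (rule ev)
  have deg: "mpair (q * a1 * a2) y = meval (q * a1 * a2) x"
    if a: "a1 \<in> poly_space (int k - int ((mdeg q + 1) div 2))" "a2 \<in> poly_space (int k - int ((mdeg q + 1) div 2))" for q a1 a2
  proof (cases "a1 = 0 \<or> a2 = 0")
    case True thus ?thesis by (auto simp: mpair_0 meval_simps)
  next
    case False
    hence "int (mdeg a1) \<le> int k - int ((mdeg q + 1) div 2)" "int (mdeg a2) \<le> int k - int ((mdeg q + 1) div 2)" using a by (auto simp: poly_space_def)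
    moreover have "mdeg (q * a1 * a2) \<le> mdeg q + mdeg a1 + mdeg a2" using mdeg_mult[of "q * a1" a2] mdeg_mult[of q a1] by linarith
    ultimately have "mdeg (q * a1 * a2) \<le> 2 * k" by linarith
    thus ?thesis by (rule ev)
  qed
  have psd: "loc_psd k q y" if "meval q x \<ge> 0" for q
    unfolding loc_psd_def
  proof
    fix a :: "'v mpoly" assume "a \<in> poly_space (int k - int ((mdeg q + 1) div 2))"
    from deg[OF this this] show "mpair (q * a * a) y \<ge> 0" using that by (simp add: meval_simps mult.assoc)
  qed
  have zero: "loc_zero k q y" if "meval q x = 0" for q
    unfolding loc_zero_def
  proof (intro ballI)
    fix a1 a2 :: "'v mpoly" assume "a1 \<in> poly_space (int k - int ((mdeg q + 1) div 2))" "a2 \<in> poly_space (int k - int ((mdeg q + 1) div 2))"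
    from deg[OF this] show "mpair (q * a1 * a2) y = 0" using that by (simp add: meval_simps)
  qed
  have "mpair 1 y = 1" using ev[of 1] by (simp add: mdeg_mconst[of 1, unfolded mconst_1] meval_simps)
  moreover have "loc_psd k 1 y" by (rule psd) (simp add: meval_simps)
  moreover have "\<forall>a. mdeg_mono a > 2 * k \<longrightarrow> y a = 0" by (simp add: y_def)
  ultimately show "y \<in> moments k" unfolding moments_def using x psd zero by (simp add: feas_def ball_Un)
qed

lemma f_mom_altdef: "f_mom k f c p E I = Inf {ereal (mpair f y) | y. y \<in> moments k}"
  by (simp add: f_mom_def moments_def)

lemma f_mom_le:
  assumes "mdeg f \<le> 2 * k"
  shows "f_mom k f c p E I \<le> Fc"
  unfolding f_mom_altdef Fc_altdef
proof (rule Inf_mono)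
  fix b assume "b \<in> {ereal (meval f x) | x. feas x}"
  then obtain x where x: "b = ereal (meval f x)" "feas x" by blast
  from point_moments(1)[OF x(2), where k = k and q = f] point_moments(2)[OF x(2), where k = k] assms x(1)
  show "\<exists>a\<in>{ereal (mpair f y) | y. y \<in> moments k}. a \<le> b" by force
qed

lemma certified_lower_bounds:
  assumes cert: "f - mconst \<gamma> \<in> certified k"
  shows "ereal \<gamma> \<le> f_sos k f c p E I" "ereal \<gamma> \<le> f_mom k f c p E I"
proof -
  show "ereal \<gamma> \<le> f_sos k f c p E I" unfolding f_sos_def
    by (rule Sup_upper) (use cert in \<open>auto simp: certified_def iq_module_trunc_def\<close>)
  show "ereal \<gamma> \<le> f_mom k f c p E I" unfolding f_mom_altdef
  proof (rule Inf_greatest)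
    fix b assume "b \<in> {ereal (mpair f y) | y. y \<in> moments k}"
    then obtain y where y: "b = ereal (mpair f y)" "y \<in> moments k" by blast
    have "0 \<le> mpair (f + mconst (- \<gamma>) * 1) y" using cert y(2) by (auto simp: certified_def ring_hom_fun_uminus[OF mconst_hom])
    also have "\<dots> = mpair f y - \<gamma>" using y(2) by (simp only: mpair_add mpair_scale) (simp add: moments_def)
    finally show "ereal \<gamma> \<le> b" using y by simp
  qed
qed

text \<open>The order \<open>K\<close> is chosen before \<gamma>; an order depending on \<gamma>
  would only give convergence in the limit. Since the extended reals are dense, \<gamma> <
  \<open>Fc\<close> suffices, also for infinite \<open>Fc\<close>.\<close>

lemma tight_if_certified:
  assumes "\<exists>K. \<forall>k\<ge>K. \<forall>\<gamma>. ereal \<gamma> < Fc \<longrightarrow> f - mconst \<gamma> \<in> certified k"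
  shows "\<exists>K. \<forall>k\<ge>K. f_sos k f c p E I = Fc \<and> f_mom k f c p E I = Fc"
proof -
  obtain K where K: "\<And>k \<gamma>. k \<ge> K \<Longrightarrow> ereal \<gamma> < Fc \<Longrightarrow> f - mconst \<gamma> \<in> certified k" using assms by blast
  have low: "Fc \<le> z" if "\<And>\<gamma>. ereal \<gamma> < Fc \<Longrightarrow> ereal \<gamma> \<le> z" for z
  proof (rule dense_le)
    fix b assume "b < Fc"
    thus "b \<le> z" using that by (cases b) auto
  qed
  show ?thesis
  proof (intro exI[of _ "max K (mdeg f)"] allI impI conjI antisym)
    fix k assume k: "max K (mdeg f) \<le> k"
    show "f_sos k f c p E I \<le> Fc" by (rule f_sos_le)
    show "f_mom k f c p E I \<le> Fc" using k by (intro f_mom_le) auto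
    show "Fc \<le> f_sos k f c p E I" "Fc \<le> f_mom k f c p E I"
      using K[of k] k certified_lower_bounds by (intro low; force)+
  qed
qed

lemma mdeg_poly_le: "degree q \<le> n \<Longrightarrow> mdeg (poly (map_poly mconst q) g) \<le> n * mdeg g"
proof (induction q arbitrary: n)
  case 0
  show ?case by (simp add: mdeg_mconst[of 0, unfolded mconst_0])
next
  case (pCons a q)
  have e: "poly (map_poly mconst (pCons a q)) g = mconst a + g * poly (map_poly mconst q) g"
    by (simp add: map_poly_pCons mconst_0)
  show ?case
  proof (cases "q = 0")
    case True thus ?thesis unfolding e by (simp add: mdeg_mconst)
  next
    case False
    then obtain m where m: "n = Suc m" "degree q \<le> m" using pCons.prems by (cases n) auto
    have "mdeg (g * poly (map_poly mconst q) g) \<le> mdeg g + m * mdeg g"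
      using mdeg_mult[of g "poly (map_poly mconst q) g"] pCons.IH[OF m(2)] by linarith
    thus ?thesis unfolding e using mdeg_add[of "mconst a" "g * poly (map_poly mconst q) g"] m(1) by (simp add: mdeg_mconst)
  qed
qed

text \<open>The order is uniform in \<gamma>: the squares that make up q(f) have degrees bounded
  through \<pi> alone, and \<open>C\<close> is a scalar in front of one fixed certified
  element.\<close>

lemma certified_if_certificate:
  assumes vs: "\<forall>v\<in>set vs. Fc \<le> ereal v"
    and cert: "- ((\<Prod>v\<leftarrow>vs. f - mconst v) * (\<Prod>v\<leftarrow>vs. f - mconst v)) \<in> iq_module"
  shows "\<exists>K. \<forall>k\<ge>K. \<forall>\<gamma>. ereal \<gamma> < Fc \<longrightarrow> f - mconst \<gamma> \<in> certified k"
proof (cases "Fc = \<infinity>")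
  case True
  note qm = quadratic_moduleD[OF quadratic_iq_module]
  have "vs = []" using vs True by (cases vs) auto
  hence m1: "-1 \<in> iq_module" using cert by simp
  \<comment> \<open>With -1 in the module, 4 f = (f + 1)^2 - (f - 1)^2 puts \<open>f\<close> there
    as well. Then f - \<gamma> is a nonnegative combination of f, 1 and -1, at one order for all
    \<gamma>.\<close>
  have "mconst (1/4) * ((f + 1) * (f + 1) * 1 + (f - 1) * (f - 1) * (-1)) \<in> iq_module"
    using qm(2)[OF m1, of "f - 1"] qm(3)[of "f + 1"] by (intro quadratic_module_scale[OF quadratic_iq_module] qm(1)) auto
  also have "mconst (1/4) * ((f + 1) * (f + 1) * 1 + (f - 1) * (f - 1) * (-1)) = (mconst (1/4) + mconst (1/4) + mconst (1/4) + mconst (1/4)) * f"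
    by (simp add: algebra_simps)
  also have "\<dots> = f" by (simp add: mconst_add[symmetric] mconst_1)
  finally have fm: "f \<in> iq_module" .
  have om: "1 \<in> iq_module" using qm(3)[of 1] by simp
  obtain K1 K2 K3 where K: "\<forall>k\<ge>K1. f \<in> certified k" "\<forall>k\<ge>K2. 1 \<in> certified k" "\<forall>k\<ge>K3. -1 \<in> certified k"
    using iq_module_certifiable[OF fm] iq_module_certifiable[OF om] iq_module_certifiable[OF m1] unfolding certifiable_def by blast
  have "f - mconst \<gamma> \<in> certified k" if k: "k \<ge> max K1 (max K2 K3)" for k \<gamma>
  proof -
    note ac = add_coneD[OF add_cone_certified[of k]]
    have "f + mconst \<gamma>' * e \<in> certified k" if "\<gamma>' \<ge> 0" "e = 1 \<or> e = -1" for \<gamma>' e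
      using that K k by (intro ac(2) ac(3)) auto
    from this[of "\<gamma>" "-1"] this[of "-\<gamma>" 1] show ?thesis
      by (cases "\<gamma> \<ge> 0") (auto simp: ring_hom_fun_uminus[OF mconst_hom])
  qed
  thus ?thesis by blast
next
  case False
  then obtain v0 where v0: "Fc \<le> ereal v0" by (cases Fc) auto
  note qm = quadratic_moduleD[OF quadratic_iq_module]
  \<comment> \<open>Prepending \<open>v0\<close> keeps the list nonempty, as
    \<open>linear_plus_square_nonneg\<close> requires; the certificate is multiplied by the square
    of f - v0 accordingly.\<close>
  define ws where "ws = v0 # vs"
  define \<pi> where "\<pi> = (\<Prod>v\<leftarrow>ws. [:-v, 1:])"
  have ws: "ws \<noteq> []" "\<forall>v\<in>set ws. Fc \<le> ereal v" using vs v0 by (auto simp: ws_def)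
  have ev\<pi>: "poly (map_poly mconst (\<Prod>v\<leftarrow>us. [:-v, 1:])) f = (\<Prod>v\<leftarrow>us. f - mconst v)" for us
    by (induction us)
      (simp_all add: map_poly_hom_mult[OF mconst_hom] map_poly_pCons mconst_0 mconst_1 ring_hom_fun_uminus[OF mconst_hom] one_pCons algebra_simps del: mult_pCons_left mult_pCons_right)
  define m where "m = - (poly (map_poly mconst \<pi>) f * poly (map_poly mconst \<pi>) f)"
  have "m = (f - mconst v0) * (f - mconst v0) * - ((\<Prod>v\<leftarrow>vs. f - mconst v) * (\<Prod>v\<leftarrow>vs. f - mconst v))"
    unfolding m_def \<pi>_def ev\<pi> by (simp add: ws_def algebra_simps)
  hence "m \<in> iq_module" using qm(2)[OF cert, of "f - mconst v0"] by simp
  then obtain K where K: "\<forall>k\<ge>K. m \<in> certified k" using iq_module_certifiable by (auto simp: certifiable_def)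
  \<comment> \<open>A bound for the degree of each r(f), where r runs through the squares composing
    the univariate polynomial below.\<close>
  define N where "N = Suc (2 * degree \<pi>) * mdeg f"
  have "f - mconst \<gamma> \<in> certified k" if k: "k \<ge> max K N" and \<gamma>: "ereal \<gamma> < Fc" for k \<gamma>
  proof -
    note ac = add_coneD[OF add_cone_certified[of k]]
    have "\<gamma> < v" if "v \<in> set ws" for v using less_le_trans[OF \<gamma>] ws(2) that by fastforce
    then obtain C where C: "C \<ge> 0" "\<forall>t. t - \<gamma> + C * (\<Prod>v\<leftarrow>ws. t - v)\<^sup>2 \<ge> 0"
      using linear_plus_square_nonneg[OF ws(1), of \<gamma>] by blast
    define q where "q = [:-\<gamma>, 1:] + [:C:] * (\<pi> * \<pi>)"
    have p\<pi>: "poly \<pi> t = (\<Prod>v\<leftarrow>ws. t - v)" for t unfolding \<pi>_def by (induction ws) (simp_all add: algebra_simps)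
    have "poly q t \<ge> 0" for t using C(2) by (simp add: q_def p\<pi> power2_eq_square)
    then obtain qs where qs: "q = (\<Sum>r\<leftarrow>qs. r * r)" "\<forall>r\<in>set qs. 2 * degree r \<le> degree q" using nonneg_poly_sum_squares by blast
    have dq: "degree q \<le> Suc (2 * degree \<pi>)"
      unfolding q_def using degree_mult_le[of \<pi> \<pi>] degree_smult_le[of C "\<pi> * \<pi>"] by (intro degree_add_le) auto
    have "poly (map_poly mconst (\<Sum>r\<leftarrow>rs. r * r)) f \<in> certified k" if "set rs \<subseteq> set qs" for rs
      using that
    proof (induction rs)
      case Nil show ?case using ac(1) by simp
    next
      case (Cons r rs)
      have "degree r \<le> Suc (2 * degree \<pi>)" using Cons.prems qs(2) dq by fastforce
      hence "mdeg (poly (map_poly mconst r) f) \<le> k" using mdeg_poly_le[of r "Suc (2 * degree \<pi>)" f] k by (simp add: N_def)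
      hence "poly (map_poly mconst r) f * poly (map_poly mconst r) f \<in> certified k" by (rule certified_square)
      from ac(2)[OF this Cons.IH] Cons.prems show ?case by (simp add: map_poly_hom_add[OF mconst_hom] map_poly_hom_mult[OF mconst_hom])
    qed
    hence 1: "poly (map_poly mconst q) f \<in> certified k" unfolding qs(1) by blast
    have 2: "mconst C * m \<in> certified k" using K k C(1) by (intro ac(3)) auto
    have "poly (map_poly mconst q) f = (f - mconst \<gamma>) + mconst C * (poly (map_poly mconst \<pi>) f * poly (map_poly mconst \<pi>) f)"
      unfolding q_def map_poly_hom_add[OF mconst_hom] map_poly_hom_mult[OF mconst_hom]
      by (simp add: map_poly_pCons mconst_0 mconst_1 ring_hom_fun_uminus[OF mconst_hom])
    hence "f - mconst \<gamma> = poly (map_poly mconst q) f + mconst C * m" by (simp add: m_def)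
    thus ?thesis using ac(2)[OF 1 2] by simp
  qed
  thus ?thesis by blast
qed

lemma tight_if_separating:
  assumes "\<rho> \<in> iq_module" and neg: "\<And>u. \<forall>h\<in>c ` E \<union> \<Phi>. meval h u = 0 \<Longrightarrow> ereal (meval f u) < Fc \<Longrightarrow> meval \<rho> u < 0"
  shows "\<exists>K. \<forall>k\<ge>K. f_sos k f c p E I = Fc \<and> f_mom k f c p E I = Fc"
proof -
  obtain vs where vs: "\<forall>v\<in>set vs. Fc \<le> ereal v"
    "- ((\<Prod>v\<leftarrow>vs. f - mconst v) * (\<Prod>v\<leftarrow>vs. f - mconst v)) \<in> sos_ideal1 (c ` E \<union> \<Phi>) \<rho>"
    using critical_certificate[OF fin neg] by blast
  hence "- ((\<Prod>v\<leftarrow>vs. f - mconst v) * (\<Prod>v\<leftarrow>vs. f - mconst v)) \<in> iq_module"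
    using sos_ideal1_subset[OF quadratic_iq_module Ideal_subset_iq_module assms(1)] by blast
  from tight_if_certified[OF certified_if_certificate[OF vs(1) this]] show ?thesis .
qed

text \<open>For \<gamma> = -\<infinity> and \<rho> = 1 the certificate places the negative of a
  square in a set that is nonnegative at critical points; there the product of the factors f - v
  must vanish.\<close>

lemma finitely_many_critical_values:
  "\<exists>vs. \<forall>u. (\<forall>h\<in>c ` E \<union> \<Phi>. meval h u = 0) \<longrightarrow> meval f u \<in> set vs"
proof -
  obtain vs where vs: "- ((\<Prod>v\<leftarrow>vs. f - mconst v) * (\<Prod>v\<leftarrow>vs. f - mconst v)) \<in> sos_ideal1 (c ` E \<union> \<Phi>) 1"
    using critical_certificate[OF fin, of c f p "-\<infinity>" 1] by auto
  have "meval f u \<in> set vs" if u: "\<forall>h\<in>c ` E \<union> \<Phi>. meval h u = 0" for u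
  proof -
    have nn: "meval x u \<ge> 0" if "x \<in> sos_ideal (c ` E \<union> \<Phi>)" for x
      using that meval_SOS meval_Ideal[OF _ u] by (auto simp: sos_ideal_def meval_simps)
    have "meval x u \<ge> 0" if "x \<in> sos_ideal1 (c ` E \<union> \<Phi>) 1" for x
      using that nn by (auto simp: sos_ideal1_def meval_simps)
    from this[OF vs] have "meval (\<Prod>v\<leftarrow>vs. f - mconst v) u = 0"
      by (simp add: meval_simps) (metis mult_eq_0_iff linorder_not_less not_square_less_zero order_antisym)
    moreover have "meval (\<Prod>v\<leftarrow>us. f - mconst v) u = 0 \<Longrightarrow> meval f u \<in> set us" for us
      by (induction us) (auto simp: meval_simps meval_mconst)
    ultimately show ?thesis by blast
  qed
  thus ?thesis by blast
qed

text \<open>Compactness concerns the region p0 \<ge> 0, so \<rho>0 is known to be negative merely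
  there. Membership of -\<rho>0 - \<delta>/2 in the preordering of \<open>p0\<close>, modulo the
  critical equations and \<open>b\<close>, removes this restriction: its part s + p0 t can be added
  to \<rho>0 within the module.\<close>

lemma tight_if_archimedean:
  assumes "p0 \<in> iq_module" and comp: "compact {x. meval p0 x \<ge> 0}"
  shows "\<exists>K. \<forall>k\<ge>K. f_sos k f c p E I = Fc \<and> f_mom k f c p E I = Fc"
proof -
  note qm = quadratic_moduleD[OF quadratic_iq_module]
  define H where "H = c ` E \<union> \<Phi>"
  obtain vs where vs: "\<And>u. \<forall>h\<in>H. meval h u = 0 \<Longrightarrow> meval f u \<in> set vs" using finitely_many_critical_values unfolding H_def by blast
  define bs where "bs = filter (\<lambda>v. ereal v < Fc) vs"
  \<comment> \<open>Among the critical points, \<open>b\<close> cuts out those with value below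
    \<open>Fc\<close>; this works because the critical values are finite in number.\<close>
  define b where "b = (\<Prod>v\<leftarrow>bs. f - mconst v)"
  have ev: "meval (\<Prod>v\<leftarrow>us. f - mconst v) u = 0 \<longleftrightarrow> meval f u \<in> set us" for us u
    by (induction us) (auto simp: meval_simps meval_mconst)
  define H' where "H' = insert b H"
  have finH': "finite H'" using finite_sets by (simp add: H'_def H_def)
  define T where "T = sos_ideal1 H' p0"
  note T = sos_ideal1(1)[of H' p0, folded T_def]
  define F where "F = insert p0 (H' \<union> uminus ` H')"
  have FT: "finite F" "F \<subseteq> T"
  proof -
    show "finite F" using finH' by (simp add: F_def)
    have "h \<in> T \<and> - h \<in> T" if "h \<in> H'" for h
    proof -
      have "h * 1 \<in> Ideal H'" "h * (-1) \<in> Ideal H'" using Ideal_mem[OF finH' that] by blast+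
      thus ?thesis using Ideal_subset_sos_ideal sos_ideal1(2) unfolding T_def by fastforce
    qed
    thus "F \<subseteq> T" using sos_ideal1(3) by (auto simp: F_def T_def)
  qed
  define Z where "Z = {u. \<forall>q\<in>F. meval q u \<ge> 0}"
  have Zs: "Z \<subseteq> {x. meval p0 x \<ge> 0}" by (auto simp: Z_def F_def)
  have "Z = (\<Inter>q\<in>F. {u. 0 \<le> meval q u})" by (auto simp: Z_def)
  hence "closed Z" by (simp only:) (intro closed_INT ballI closed_Collect_le continuous_on_const continuous_on_meval)
  hence Zc: "compact Z" using comp Zs by (metis compact_Int_closed inf.absorb2)
  have ZH: "\<forall>h\<in>H'. meval h u = 0" if "u \<in> Z" for u
  proof
    fix h assume "h \<in> H'"
    hence "meval h u \<ge> 0" "meval (- h) u \<ge> 0" using that by (auto simp: Z_def F_def)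
    thus "meval h u = 0" by (simp add: meval_simps)
  qed
  have "\<exists>g\<in>c ` I \<union> \<Psi>. meval g u < 0" if u: "u \<in> Z" for u
  proof (rule ccontr)
    assume "\<not> ?thesis"
    hence "feas u" using ZH[OF u] unfolding feas_def H'_def H_def by (auto simp: not_less)
    hence "Fc \<le> ereal (meval f u)" by (rule Fc_le)
    moreover have "meval f u \<in> set bs" using ZH[OF u] ev by (auto simp: H'_def b_def)
    ultimately show False by (auto simp: bs_def)
  qed
  moreover have Gm: "c ` I \<union> \<Psi> \<subseteq> iq_module"
  proof
    fix g assume "g \<in> c ` I \<union> \<Psi>"
    hence "g * (1 * 1) \<in> Qmod (c ` I \<union> \<Psi>)" using finite_sets by (intro Qmod_mem SOS_square) auto
    thus "g \<in> iq_module" using Qmod_subset_iq_module by auto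
  qed
  moreover have "finite (c ` I \<union> \<Psi>)" using finite_sets by simp
  ultimately obtain \<rho>0 \<delta> where \<rho>0: "\<rho>0 \<in> iq_module" "\<delta> > 0" "\<forall>u\<in>Z. meval \<rho>0 u \<le> - \<delta>"
    using negative_combination_on_compact[OF _ Zc _ quadratic_iq_module] by blast
  define a where "a = - \<rho>0 - mconst (\<delta> / 2)"
  have "a \<in> T"
  proof (rule positive_on_compact_in_preordering[OF T FT])
    show "bounded {u. \<forall>q\<in>F. meval q u \<ge> 0}" using compact_imp_bounded[OF Zc] by (simp add: Z_def)
    fix u assume "\<forall>q\<in>F. meval q u \<ge> 0"
    hence "meval \<rho>0 u \<le> - \<delta>" using \<rho>0(3) by (simp add: Z_def)
    thus "meval a u > 0" using \<rho>0(2) by (simp add: a_def meval_simps meval_mconst)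
  qed
  then obtain s j t j' where st: "a = s + j + p0 * (t + j')" "s \<in> SOS" "t \<in> SOS" "j \<in> Ideal H'" "j' \<in> Ideal H'"
    by (auto simp: T_def sos_ideal1_def sos_ideal_def)
  have "j + j' * p0 \<in> Ideal H'" using st by (intro Ideal_add Ideal_mult)
  then obtain w where w: "j + j' * p0 = (\<Sum>h\<in>H'. h * w h)" by (auto simp: Ideal_def)
  \<comment> \<open>Cofactors are indexed by the polynomials themselves, so if \<open>b\<close>
    already belongs to \<open>H\<close> it has no cofactor of its own.\<close>
  have "\<exists>n\<in>Ideal H. \<exists>e. j + j' * p0 = n + b * e"
  proof (cases "b \<in> H")
    case True
    hence "H' = H" by (auto simp: H'_def)
    thus ?thesis using w by (intro bexI[of _ "j + j' * p0"] exI[of _ 0]) (auto simp: Ideal_def)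
  next
    case False
    have "j + j' * p0 = b * w b + (\<Sum>h\<in>H. h * w h)" unfolding w H'_def using False finite_sets by (simp add: H_def)
    thus ?thesis by (intro bexI[of _ "\<Sum>h\<in>H. h * w h"] exI[of _ "w b"]) (auto simp: Ideal_def add.commute)
  qed
  then obtain n e where ne: "n \<in> Ideal H" "j + j' * p0 = n + b * e" by blast
  \<comment> \<open>This differs from the constant -\<delta>/2 by a multiple of \<open>b\<close>, so
    it is negative wherever \<open>b\<close> vanishes, with no condition on
    \<open>p0\<close>.\<close>
  define \<rho> where "\<rho> = \<rho>0 + s + p0 * t + n"
  have "n \<in> iq_module" using ne(1) Ideal_subset_iq_module by (auto simp: H_def)
  hence \<rho>m: "\<rho> \<in> iq_module" unfolding \<rho>_def
    using \<rho>0(1) quadratic_module_SOS[OF quadratic_iq_module st(2)] quadratic_module_SOS_mult[OF quadratic_iq_module st(3) assms(1)] qm(1) by blast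
  have "\<rho> + b * e = mconst (- (\<delta> / 2))"
  proof -
    have "\<rho> + b * e = \<rho>0 + s + p0 * t + (n + b * e)" by (simp add: \<rho>_def algebra_simps)
    also have "\<dots> = \<rho>0 + a" unfolding ne(2)[symmetric] st(1) by (simp add: algebra_simps)
    finally show ?thesis by (simp add: a_def ring_hom_fun_uminus[OF mconst_hom])
  qed
  hence \<rho>e: "\<rho> = mconst (- (\<delta> / 2)) - b * e" by (simp add: algebra_simps)
  have "meval \<rho> u < 0" if u: "\<forall>h\<in>c ` E \<union> \<Phi>. meval h u = 0" "ereal (meval f u) < Fc" for u
  proof -
    have "meval f u \<in> set bs" using vs[of u] u by (auto simp: H_def bs_def)
    hence "meval b u = 0" using ev by (simp add: b_def)
    thus ?thesis unfolding \<rho>e using \<rho>0(2) by (simp add: meval_simps meval_mconst)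
  qed
  from tight_if_separating[OF \<rho>m this] show ?thesis .
qed

lemma critical_point_iff: "(\<forall>h\<in>c ` E \<union> \<Phi>. meval h u = 0) \<longleftrightarrow> (u, \<lambda>i. meval (p i) u) \<in> crit_pairs f c E I"
  unfolding phi_set_def ball_Un by (auto simp: crit_pairs_def meval_simps)

end

theorem theorem3p3:
  fixes f :: "'v::finite mpoly"
    and c :: "'i \<Rightarrow> 'v mpoly"
    and p :: "'i \<Rightarrow> 'v mpoly"
    and E I :: "'i set"
  assumes "finite E" and "finite I" and "E \<inter> I = {}"
    and "crit_points f c E I \<noteq> {}"
    and assmA: "\<forall>(x, lam)\<in>crit_pairs f c E I. \<forall>i\<in>E \<union> I. lam i = meval (p i) x"
    and conds: "archimedean (set_plus_mp (IQ (c ` E) (c ` I)) (IQ (phi_set f c p E I) (psi_set p I)))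
       \<or> archimedean (IQ (c ` E) (c ` I))
       \<or> (\<exists>\<rho>\<in>Qmod (c ` I \<union> psi_set p I). \<forall>u\<in>crit_points f c E I.
             ereal (meval f u) < f_c f c p E I \<longrightarrow> meval \<rho> u < 0)"
  shows "(\<exists>K. \<forall>k\<ge>K. f_sos k f c p E I = f_c f c p E I \<and> f_mom k f c p E I = f_c f c p E I)
    \<and> (\<forall>u. u \<in> crit_points f c E I \<and> feasible c E I u \<and>
           (\<forall>x. feasible c E I x \<longrightarrow> meval f u \<le> meval f x) \<longrightarrow>
         (\<exists>K. \<forall>k\<ge>K. f_sos k f c p E I = ereal (meval f u) \<and> f_mom k f c p E I = ereal (meval f u)))"
proof -
  interpret critical_problem f c p E I by standard (use assms in auto)
  have main: "\<exists>K. \<forall>k\<ge>K. f_sos k f c p E I = Fc \<and> f_mom k f c p E I = Fc"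
    using conds
  proof (elim disjE)
    assume "archimedean (set_plus_mp (IQ (c ` E) (c ` I)) (IQ (phi_set f c p E I) (psi_set p I)))"
    then obtain p0 where "p0 \<in> iq_module" "compact {x. meval p0 x \<ge> 0}" by (auto simp: archimedean_def iq_module_def)
    thus ?thesis by (rule tight_if_archimedean)
  next
    assume "archimedean (IQ (c ` E) (c ` I))"
    then obtain p0 where "p0 \<in> IQ (c ` E) (c ` I)" "compact {x. meval p0 x \<ge> 0}" by (auto simp: archimedean_def)
    thus ?thesis using tight_if_archimedean iq_module_I(1) by blast
  next
    assume "\<exists>\<rho>\<in>Qmod (c ` I \<union> psi_set p I). \<forall>u\<in>crit_points f c E I. ereal (meval f u) < f_c f c p E I \<longrightarrow> meval \<rho> u < 0"
    then obtain \<rho> where \<rho>: "\<rho> \<in> Qmod (c ` I \<union> \<Psi>)" "\<forall>u\<in>crit_points f c E I. ereal (meval f u) < Fc \<longrightarrow> meval \<rho> u < 0"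
      by (auto simp: Fc_def)
    show ?thesis
    proof (rule tight_if_separating)
      show "\<rho> \<in> iq_module" using \<rho>(1) Qmod_subset_iq_module by blast
      fix u assume u: "\<forall>h\<in>c ` E \<union> \<Phi>. meval h u = 0" "ereal (meval f u) < Fc"
      \<comment> \<open>A common zero of the equations is critical, with the values of the
        \<open>p i\<close> as multipliers.\<close>
      have "u \<in> crit_points f c E I" using u(1) unfolding critical_point_iff crit_points_def by blast
      thus "meval \<rho> u < 0" using \<rho>(2) u(2) by blast
    qed
  qed
  \<comment> \<open>A minimizer satisfies the additional constraints, since its multipliers are the
    values of the \<open>p i\<close> and those of the inequalities are nonnegative. The restricted
    problem therefore has the same optimal value.\<close>
  have "Fc = ereal (meval f u)" if u: "u \<in> crit_points f c E I" "feasible c E I u" "\<And>x. feasible c E I x \<Longrightarrow> meval f u \<le> meval f x" for u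
  proof (rule antisym)
    obtain lam where lam: "(u, lam) \<in> crit_pairs f c E I" using u(1) by (auto simp: crit_points_def)
    have lp: "\<forall>i\<in>E \<union> I. lam i = meval (p i) u" using assmA lam by blast
    have nn: "meval (p j) u \<ge> 0" if "j \<in> I" for j
      using multiplier_nonneg[OF assms(1-3) assmA lam u(2,3) that] lp that by simp
    have "(u, \<lambda>i. meval (p i) u) \<in> crit_pairs f c E I" using lam lp by (auto simp: crit_pairs_def)
    hence "feas u" using u(2) nn unfolding feas_def critical_point_iff[symmetric] by (auto simp: feasible_def psi_set_def)
    thus "Fc \<le> ereal (meval f u)" by (rule Fc_le)
    show "ereal (meval f u) \<le> Fc" unfolding Fc_altdef
      by (rule Inf_greatest) (use u(3) in \<open>auto simp: feas_def feasible_def\<close>)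
  qed
  with main show ?thesis unfolding Fc_def[symmetric] by (intro conjI allI impI; metis)
qed

end
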